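(* For every fixed $\lambda>0$ and $\varepsilon>0$, for all sufficiently large $N$, the tree completion time $\omega_{N,\lambda}$ of the cylindrical Hastings-Levitov$(0)$ process $\mathrm{CHL}_N$ with particle size $\lambda$ satisfies $$\mathbb{E}[\omega_{N,\lambda}]\le (1+\varepsilon)\frac{\log N}{2\lambda}.$$
   Context: Slit maps. Fix real numbers $\lambda>0$ and $N\ge 1$. Let $\mathbb T_N=\mathbb R/2\pi N\mathbb Z$, identified with $[0,2\pi N)$ and with the boundary $\{\operatorname{Im} z=0\}$ of the cylinder $\mathbb T^N=\{z\in\mathbb C:\operatorname{Im} z>0\}/(z\sim z+2\pi N)$. Put $\delta=\delta(N,\lambda)=1-\frac{2}{e^{\lambda/N}+1}\in(0,1)$. Let $\mathbb D_0=\{|z|>1\}$, $\mathbb H=\{\operatorname{Im} z>0\}$, $f_N:\mathbb T^N\to\mathbb D_0$, $f_N(z)=e^{-iz/N}$; $g:\mathbb D_0\to\mathbb H$, $g(z)=i\frac{z-1}{z+1}$; $\phi_a:\mathbb H\to\mathbb H\setminus[0,ia]$, $\phi_a(z)=\sqrt{z^2(1-a^2)-a^2}$ (conformal branch). Define $S^{N,\lambda}=f_N^{-1}\circ g^{-1}\circ\phi_{\delta}\circ g\circ f_N$, a conformal map $\mathbb T^N\to\mathbb T^N\setminus[0,i\lambda]$, extended continuously to $\mathbb T_N$; then $S^{N,\lambda}(0)=i\lambda$ and $S^{N,\lambda}(\mathbb T_N)=\mathbb T_N\cup[0,i\lambda]$. For $x\in\mathbb T_N$ the slit map centered at $x$ is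 $S^{N,\lambda}_x(z)=x+S^{N,\lambda}(z-x)$ (modulo $2\pi N$). The process $\mathrm{CHL}_N$. Let $P$ be a Poisson point process of intensity $1$ on $\mathbb R_+\times\mathbb T_N$, with points $(t_1,x_1),(t_2,x_2),\dots$, $0<t_1<t_2<\cdots$. For $t\ge0$ let $n=\#\{j:t_j\le t\}$ and $\mathcal C_t^{N,\lambda}=S^{N,\lambda}_{x_1}\circ S^{N,\lambda}_{x_2}\circ\cdots\circ S^{N,\lambda}_{x_n}$ (identity if $n=0$). Trees. The trees at time $t$ are the connected components of $\mathcal C^{N,\lambda}_t(\mathbb T_N)\setminus\mathbb T_N$. Each tree at a given time is contained in a unique tree at any later time and the two are regarded as the same tree. The tree completion time $\omega_{N,\lambda}$ is the last time at which a new tree grows on $\mathbb T_N$, i.e. the last time at which the number of trees increases. *)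

theory Defs
  imports
    "HOL-Probability.Probability"
    "HOL-Library.Real_Mod"
begin

section \<open>The cylinder\<close>

text \<open>
  A point of the closed cylinder \<open>{z. Im z \<ge> 0} / (z \<sim> z + 2\<pi>N)\<close> is represented by the
  complex number in its class with real part in \<open>[0, 2\<pi>N)\<close>; \<open>cyl_mod N\<close> is the projection.
  The topology \<open>cylinder N\<close> is the quotient topology transported to these representatives,
  so \<open>Re z = 0\<close> and \<open>Re z = 2\<pi>N\<close> are glued; it is not the subspace topology of the plane.
\<close>

definition cyl_mod :: "real \<Rightarrow> complex \<Rightarrow> complex" where
  "cyl_mod N z = Complex (Re z rmod (2 * pi * N)) (Im z)"

definition closed_cyl :: "real \<Rightarrow> complex set" where
  "closed_cyl N = {z. 0 \<le> Re z \<and> Re z < 2 * pi * N \<and> 0 \<le> Im z}"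

definition open_cyl :: "real \<Rightarrow> complex set" where
  "open_cyl N = {z. 0 \<le> Re z \<and> Re z < 2 * pi * N \<and> 0 < Im z}"

definition cyl_boundary :: "real \<Rightarrow> complex set" where
  "cyl_boundary N = {z. 0 \<le> Re z \<and> Re z < 2 * pi * N \<and> Im z = 0}"

definition cylinder :: "real \<Rightarrow> complex topology" where
  "cylinder N = topology (\<lambda>U. U \<subseteq> closed_cyl N \<and>
     openin (top_of_set {z. 0 \<le> Im z}) {z \<in> {z. 0 \<le> Im z}. cyl_mod N z \<in> U})"

lemma istopology_cylinder:
  "istopology (\<lambda>U. U \<subseteq> closed_cyl N \<and>
     openin (top_of_set {z. 0 \<le> Im z}) {z \<in> {z. 0 \<le> Im z}. cyl_mod N z \<in> U})"
    (is "istopology ?P")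
  unfolding istopology_def
proof (intro conjI allI impI)
  fix S T assume "?P S" "?P T"
  moreover have "{z \<in> {z. 0 \<le> Im z}. cyl_mod N z \<in> S \<inter> T} =
      {z \<in> {z. 0 \<le> Im z}. cyl_mod N z \<in> S} \<inter> {z \<in> {z. 0 \<le> Im z}. cyl_mod N z \<in> T}"
    by blast
  ultimately show "S \<inter> T \<subseteq> closed_cyl N"
    "openin (top_of_set {z. 0 \<le> Im z}) {z \<in> {z. 0 \<le> Im z}. cyl_mod N z \<in> S \<inter> T}"
    by (auto simp only: openin_Int)
next
  fix \<K> assume K: "\<forall>K\<in>\<K>. ?P K"
  have "{z \<in> {z. 0 \<le> Im z}. cyl_mod N z \<in> \<Union>\<K>} =
      \<Union>((\<lambda>K. {z \<in> {z. 0 \<le> Im z}. cyl_mod N z \<in> K}) ` \<K>)"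
    by blast
  then show "\<Union>\<K> \<subseteq> closed_cyl N"
    "openin (top_of_set {z. 0 \<le> Im z}) {z \<in> {z. 0 \<le> Im z}. cyl_mod N z \<in> \<Union>\<K>}"
    using K by (auto simp only: intro!: openin_Union)
qed

lemma openin_cylinder:
  "openin (cylinder N) U \<longleftrightarrow> U \<subseteq> closed_cyl N \<and>
     openin (top_of_set {z. 0 \<le> Im z}) {z \<in> {z. 0 \<le> Im z}. cyl_mod N z \<in> U}"
  unfolding cylinder_def topology_inverse'[OF istopology_cylinder] ..

lemma cyl_mod_image:
  assumes "N > 0"
  shows "cyl_mod N ` {z. 0 \<le> Im z} = closed_cyl N"
proof
  show "cyl_mod N ` {z. 0 \<le> Im z} \<subseteq> closed_cyl N"
    using assms by (auto simp: cyl_mod_def closed_cyl_def rmod_conv_frac' frac_lt_1)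
  have "cyl_mod N z = z" if "z \<in> closed_cyl N" for z
    using that assms
    by (intro complex_eqI) (auto simp: cyl_mod_def closed_cyl_def rmod_idem)
  then show "closed_cyl N \<subseteq> cyl_mod N ` {z. 0 \<le> Im z}"
    by (force simp: closed_cyl_def image_iff)
qed

lemma quotient_map_cyl_mod:
  assumes "N > 0"
  shows "quotient_map (top_of_set {z. 0 \<le> Im z}) (cylinder N) (cyl_mod N)"
proof -
  have "{z \<in> {z. 0 \<le> Im z}. cyl_mod N z \<in> closed_cyl N} = {z. 0 \<le> Im z}"
    using cyl_mod_image[OF assms] by blast
  then have "openin (cylinder N) (closed_cyl N)"
    by (simp add: openin_cylinder)
  then have "topspace (cylinder N) = closed_cyl N"
    by (metis openin_cylinder openin_subset openin_topspace subset_antisym)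
  then show ?thesis
    unfolding quotient_map_def using cyl_mod_image[OF assms]
    by (auto simp: openin_cylinder)
qed


section \<open>Slit maps\<close>

definition slit_delta :: "real \<Rightarrow> real \<Rightarrow> real" where
  "slit_delta N lam = 1 - 2 / (exp (lam / N) + 1)"

definition ext_disc :: "complex set" where
  "ext_disc = {z. 1 < norm z}"

definition cyl_to_disc :: "real \<Rightarrow> complex \<Rightarrow> complex" where
  "cyl_to_disc N z = exp (- \<i> * z / of_real N)"

definition disc_to_half :: "complex \<Rightarrow> complex" where
  "disc_to_half z = \<i> * (z - 1) / (z + 1)"

text \<open>
  The branch of the square root that is holomorphic off \<open>[0, \<infinity>)\<close> and takes values in the
  upper half-plane; for \<open>0 < a < 1\<close> and \<open>Im z > 0\<close> its argument in \<open>half_slit\<close> avoids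
  \<open>[0, \<infinity>)\<close>.
\<close>

definition upper_sqrt :: "complex \<Rightarrow> complex" where
  "upper_sqrt u = \<i> * csqrt (- u)"

definition half_slit :: "real \<Rightarrow> complex \<Rightarrow> complex" where
  "half_slit a z = upper_sqrt (z\<^sup>2 * (1 - (of_real a)\<^sup>2) - (of_real a)\<^sup>2)"

text \<open>
  The image of \<open>disc_to_half\<close> on \<open>ext_disc\<close> is the upper half-plane without the point \<open>\<i>\<close>;
  as \<open>half_slit a\<close> is injective there and fixes \<open>\<i>\<close>, the inverse below is only applied inside
  that image.
\<close>

definition open_slit_map :: "real \<Rightarrow> real \<Rightarrow> complex \<Rightarrow> complex" where
  "open_slit_map N lam =
     inv_into (open_cyl N) (cyl_to_disc N) \<circ> inv_into ext_disc disc_to_half \<circ>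
     half_slit (slit_delta N lam) \<circ> disc_to_half \<circ> cyl_to_disc N"

text \<open>Boundary values are limits, in the topology of the cylinder, from the open cylinder.\<close>

definition slit_map :: "real \<Rightarrow> real \<Rightarrow> complex \<Rightarrow> complex" where
  "slit_map N lam z =
     (if 0 < Im z then open_slit_map N lam z
      else (THE l. limitin (cylinder N) (open_slit_map N lam) l
                     (atin_within (cylinder N) z (open_cyl N))))"

definition slit_map_at :: "real \<Rightarrow> real \<Rightarrow> real \<Rightarrow> complex \<Rightarrow> complex" where
  "slit_map_at N lam x z = cyl_mod N (of_real x + slit_map N lam (cyl_mod N (z - of_real x)))"


section \<open>The cylindrical Hastings-Levitov process and its trees\<close>

text \<open>Sequences are indexed from \<open>0\<close>, so \<open>t 0, x 0\<close> are the first arrival time and position.\<close>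

primrec slit_comp :: "real \<Rightarrow> real \<Rightarrow> (nat \<Rightarrow> real) \<Rightarrow> nat \<Rightarrow> complex \<Rightarrow> complex" where
  "slit_comp N lam x 0 = id"
| "slit_comp N lam x (Suc n) = slit_comp N lam x n \<circ> slit_map_at N lam (x n)"

definition chl_map ::
    "real \<Rightarrow> real \<Rightarrow> (nat \<Rightarrow> real) \<Rightarrow> (nat \<Rightarrow> real) \<Rightarrow> real \<Rightarrow> complex \<Rightarrow> complex" where
  "chl_map N lam t x s = slit_comp N lam x (card {j. t j \<le> s})"

definition trees ::
    "real \<Rightarrow> real \<Rightarrow> (nat \<Rightarrow> real) \<Rightarrow> (nat \<Rightarrow> real) \<Rightarrow> real \<Rightarrow> complex set set" where
  "trees N lam t x s =
     connected_components_of
       (subtopology (cylinder N) (chl_map N lam t x s ` cyl_boundary N - cyl_boundary N))"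

definition tree_birth_times ::
    "real \<Rightarrow> real \<Rightarrow> (nat \<Rightarrow> real) \<Rightarrow> (nat \<Rightarrow> real) \<Rightarrow> real set" where
  "tree_birth_times N lam t x =
     {s. 0 < s \<and> (\<forall>\<^sub>F r in at_left s. card (trees N lam t x r) < card (trees N lam t x s))}"

text \<open>
  The last birth time, as an extended real: the value is \<open>\<infinity>\<close> if new trees keep appearing at
  unboundedly large times.
\<close>

definition tree_completion_time ::
    "real \<Rightarrow> real \<Rightarrow> (nat \<Rightarrow> real) \<Rightarrow> (nat \<Rightarrow> real) \<Rightarrow> ennreal" where
  "tree_completion_time N lam t x = (SUP s\<in>tree_birth_times N lam t x. ennreal s)"


section \<open>Poisson point processes\<close>

text \<open>
  The points are given by a sequence of random elements \<open>p 0, p 1, \<dots>\<close>; the number of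
  points is thus infinite, as it must be (almost surely) for an intensity measure of infinite
  total mass.  Null sets \<open>B\<close> are covered by the convention \<open>0 ^ 0 = 1\<close>.
\<close>

definition poisson_point_process ::
    "'w measure \<Rightarrow> 'b measure \<Rightarrow> (nat \<Rightarrow> 'w \<Rightarrow> 'b) \<Rightarrow> bool" where
  "poisson_point_process M \<mu> p \<longleftrightarrow>
     prob_space M \<and>
     (\<forall>j. p j \<in> measurable M \<mu>) \<and>
     (\<forall>B k. B \<in> sets \<mu> \<and> emeasure \<mu> B < \<infinity> \<longrightarrow>
        measure M {w \<in> space M. finite {j. p j w \<in> B} \<and> card {j. p j w \<in> B} = k} =
          measure \<mu> B ^ k / fact k * exp (- measure \<mu> B)) \<and>
     (\<forall>n (B :: nat \<Rightarrow> 'b set).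
        (\<forall>i<n. B i \<in> sets \<mu> \<and> emeasure \<mu> (B i) < \<infinity>) \<and> disjoint_family_on B {..<n} \<longrightarrow>
        prob_space.indep_vars M (\<lambda>_. count_space UNIV) (\<lambda>i w. card {j. p j w \<in> B i}) {..<n})"

definition chl_arrivals ::
    "real \<Rightarrow> 'w measure \<Rightarrow> (nat \<Rightarrow> 'w \<Rightarrow> real) \<Rightarrow> (nat \<Rightarrow> 'w \<Rightarrow> real) \<Rightarrow> bool" where
  "chl_arrivals N M t x \<longleftrightarrow>
     poisson_point_process M (restrict_space lborel ({0..} \<times> {0..<2 * pi * N}))
       (\<lambda>j w. (t j w, x j w)) \<and>
     (AE w in M. 0 < t 0 w \<and> strict_mono (\<lambda>j. t j w))"

end

theory Submission
  imports Defs "HOL-Real_Asymp.Real_Asymp"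
begin

text \<open>
  In the coordinate \<open>v = exp (\<i> z / N)\<close> the cylinder becomes the punctured closed unit disc, and the
  slit map is conjugate, under the Koebe function \<open>k v = v / (1 + v)\<^sup>2\<close>, to multiplication by a
  constant \<open>\<kappa> < 1\<close>: a point of the circle stays on the circle iff its real part is at most
  \<open>2 \<kappa> - 1\<close>. The \<open>n\<close>-th particle starts a new tree iff \<open>C x\<^sub>n\<close> lies on the circle, where \<open>C\<close>
  composes the slit maps of its predecessors. Following \<open>x\<^sub>n\<close> backwards through these maps, whose
  centres are independent and uniform, each step keeps it on the circle with the same probability
  wherever it is. This probability is at most \<open>q = 1 - 2 \<delta> / \<pi>\<close>, so particle \<open>n\<close> starts a tree with
  probability at most \<open>q\<^sup>n\<close>, independently of the arrival times. With
  \<open>r = 2 \<pi> N (1 - q) \<longrightarrow> 2 \<lambda>\<close> the expected number of births after time \<open>T\<close> is at most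
  \<open>2 \<pi> N exp (- r T) / r\<close>; integrating this bound for the tail of the completion time from
  \<open>T = ln N / r\<close> on gives an expectation of at most \<open>ln N / r + 2 \<pi> / r\<^sup>2\<close>.
\<close>

section \<open>The slit map of the disc\<close>

text \<open>The newest map is innermost, so a point meets the slits of its predecessors from the
  latest to the earliest, each with a centre that has not yet acted on it; a uniform centre makes
  its position relative to the next slit uniform, wherever it is on the circle. With
  \<open>c = 1 - 2 * \<delta>\<^sup>2\<close> the point leaves the circle when its angle to the
  centre has cosine above c. This is an arc of half-angle 2 arcsin \<delta>, which is at least 2
  \<delta>, hence a share of at least 2 \<delta> / \<pi> of the circle. The composed maps are
  injective only inside the disc, so the fact that a new slit avoids the older trees is carried
  through an induction; whether it touches them is decided at its base. The probabilistic obstacle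
  is that a Poisson process is described by counts in fixed sets, while the argument needs the
  positions of the first n + 1 points in order of arrival, independently of the number of arrivals
  before T. Time is cut into slots so short that two arrivals rarely share one; then the index of a
  point is the rank of its slot, which is a condition on counts, and the slot length tends to
  0.\<close>

definition koebe :: "complex \<Rightarrow> complex" where
  "koebe v = v / (1 + v)\<^sup>2"

text \<open>The function is invariant under inversion: after clearing denominators the difference of
  the two sides factors as (v - w) (1 - v w).\<close>

lemma koebe_eq_iff:
  assumes "v \<noteq> -1" "w \<noteq> -1"
  shows "koebe v = koebe w \<longleftrightarrow> v = w \<or> v * w = 1"
proof -
  have "1 + v \<noteq> 0" "1 + w \<noteq> 0"
    using assms by (metis add.commute add_eq_0_iff)+
  then have "koebe v = koebe w \<longleftrightarrow> v * (1 + w)\<^sup>2 = w * (1 + v)\<^sup>2"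
    unfolding koebe_def by (simp add: frac_eq_eq)
  also have "\<dots> \<longleftrightarrow> (v - w) * (1 - v * w) = 0"
    by (auto simp: algebra_simps power2_eq_square)
  finally show ?thesis by auto
qed

lemma inj_on_koebe: "inj_on koebe (ball 0 1)"
proof (rule inj_onI)
  fix v w :: complex
  assume *: "v \<in> ball 0 1" "w \<in> ball 0 1" "koebe v = koebe w"
  then have "v \<noteq> -1" "w \<noteq> -1" by auto
  moreover have "norm (v * w) < 1 * 1"
    unfolding norm_mult using * by (intro mult_strict_mono') auto
  then have "v * w \<noteq> 1" by auto
  ultimately show "v = w" using * koebe_eq_iff by blast
qed

text \<open>The Koebe function maps the disc onto the plane slit along [1/4, \<infinity>). The
  equation s (1 + v)^2 = v is quadratic with real coefficients and root product 1, so a nonreal root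
  lies on the circle, and for s \<ge> 1/4 a real root can only be 1.\<close>

lemma koebe_real_ge_imp_not_ball:
  assumes k: "koebe v = of_real s" and s: "s \<ge> 1/4"
  shows "norm v \<ge> 1"
proof (rule ccontr)
  assume n: "\<not> norm v \<ge> 1"
  then have v1: "1 + v \<noteq> 0" by (auto simp: add_eq_0_iff)
  have e: "of_real s * (1 + v)\<^sup>2 = v" using k v1 by (simp add: koebe_def field_simps)
  have v0: "v \<noteq> 0" using k s by (auto simp: koebe_def)
  have re: "s * ((1 + Re v)\<^sup>2 - (Im v)\<^sup>2) = Re v" and im: "s * (2 * (1 + Re v) * Im v) = Im v"
    using e by (auto simp: complex_eq_iff power2_eq_square algebra_simps)
  have nv: "(Re v)\<^sup>2 + (Im v)\<^sup>2 < 1"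
    using n by (simp add: cmod_def real_sqrt_ge_1_iff not_le)
  show False
  proof (cases "Im v = 0")
    case True
    then have "s * (1 + Re v)\<^sup>2 = Re v" using re by simp
    moreover have "1/4 * (1 + Re v)\<^sup>2 \<le> s * (1 + Re v)\<^sup>2" using s by (intro mult_right_mono) auto
    ultimately have "1/4 * (1 + Re v)\<^sup>2 \<le> Re v" by linarith
    moreover have "(1 - Re v)\<^sup>2 = (1 + Re v)\<^sup>2 - 4 * Re v" by (simp add: power2_eq_square algebra_simps)
    ultimately have "(1 - Re v)\<^sup>2 \<le> 0" by linarith
    then have "Re v = 1" by simp
    with True nv show False by simp
  next
    case False
    then have a: "2 * s * (1 + Re v) = 1"
    proof -
      have "(2 * s * (1 + Re v)) * Im v = 1 * Im v" using im by (simp add: algebra_simps)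
      then show ?thesis using False mult_right_cancel by blast
    qed
    have "2 * (s * ((1 + Re v)\<^sup>2 - (Im v)\<^sup>2)) = (2 * s * (1 + Re v)) * (1 + Re v) - 2 * s * (Im v)\<^sup>2"
      by (simp add: power2_eq_square algebra_simps)
    then have "2 * Re v = 1 + Re v - 2 * s * (Im v)\<^sup>2" using re a by simp
    then have b: "2 * s * (Im v)\<^sup>2 = 1 - Re v" by simp
    have "2 * s * ((Re v)\<^sup>2 + (Im v)\<^sup>2 - 1) = 2 * s * (1 + Re v) * (Re v - 1) + 2 * s * (Im v)\<^sup>2"
      by (simp add: power2_eq_square algebra_simps)
    also have "\<dots> = 0" using a b by simp
    finally show False using nv s by simp
  qed
qed

text \<open>Here 1 / v is the conjugate of v, so 1 / \<open>koebe v\<close> = v + 2 + 1 / v = 2 + 2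
  Re v.\<close>

lemma koebe_circle:
  assumes "norm v = 1" "v \<noteq> -1"
  shows "koebe v = of_real (1 / (2 + 2 * Re v))" "Re v > -1"
proof -
  have n: "(Re v)\<^sup>2 + (Im v)\<^sup>2 = 1" using assms(1) by (simp add: cmod_def)
  show r: "Re v > -1"
  proof (rule ccontr)
    assume "\<not> Re v > -1"
    moreover have "\<bar>Re v\<bar> \<le> 1" using abs_Re_le_cmod[of v] assms by simp
    ultimately have "Re v = -1" by simp
    with n have "v = -1" by (simp add: complex_eq_iff)
    with assms show False by simp
  qed
  have "(1 + v)\<^sup>2 = of_real (2 + 2 * Re v) * v"
    using n by (simp add: complex_eq_iff power2_eq_square algebra_simps)
  moreover have "v \<noteq> 0" using assms by auto
  ultimately show "koebe v = of_real (1 / (2 + 2 * Re v))"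
    using r by (simp add: koebe_def)
qed

text \<open>On the circle the values are at least 1/4, so v lies inside; there \<open>koebe\<close>
  is injective and commutes with conjugation, so a real value forces v to be real, and positivity
  fixes its sign.\<close>

lemma koebe_real_ball:
  assumes k: "koebe v = of_real s" and s: "0 < s" "s < 1/4" and n: "norm v \<le> 1"
  shows "v = of_real (norm v)" "norm v < 1"
proof -
  have vm: "v \<noteq> -1" using k s by (auto simp: koebe_def)
  show n1: "norm v < 1"
  proof (rule ccontr)
    assume "\<not> norm v < 1"
    then have "norm v = 1" using n by simp
    then have "of_real (1 / (2 + 2 * Re v)) = (of_real s :: complex)" "Re v > -1" "Re v \<le> 1"
      using koebe_circle[OF _ vm] k complex_Re_le_cmod[of v] by auto
    then have "1 / (2 + 2 * Re v) = s" "Re v > -1" "Re v \<le> 1" by (simp_all only: of_real_eq_iff)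
    moreover from this have "1 / (2 + 2 * Re v) \<ge> 1 / 4" by (intro divide_left_mono) auto
    ultimately show False using s by linarith
  qed
  have "koebe (cnj v) = cnj (koebe v)" by (simp add: koebe_def)
  then have "koebe (cnj v) = koebe v" using k by simp
  then have "cnj v = v" using inj_on_koebe n1 by (auto simp: inj_on_def)
  then have im: "Im v = 0" by (simp add: complex_eq_iff)
  then have v: "v = of_real (Re v)" by (simp add: complex_eq_iff)
  have "koebe (of_real (Re v)) = of_real (Re v / (1 + Re v)\<^sup>2)"
    by (simp add: koebe_def)
  then have "of_real (Re v / (1 + Re v)\<^sup>2) = (of_real s :: complex)" using k v by simp
  then have "Re v / (1 + Re v)\<^sup>2 > 0" using s by (simp only: of_real_eq_iff)
  then have "Re v > 0" by (simp add: zero_less_divide_iff)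
  then show "v = of_real (norm v)" using im by (simp add: complex_eq_iff cmod_def)
qed

text \<open>
  A branch of \<open>sqrt (1 - 2 c v + v\<^sup>2)\<close> that is continuous on the whole closed disc, because each factor
  has a radicand with nonnegative real part; the principal root of the product is not.
\<close>

definition slit_root :: "real \<Rightarrow> complex \<Rightarrow> complex" where
  "slit_root c v = csqrt (1 - Complex c (sqrt (1 - c\<^sup>2)) * v) *
     csqrt (1 - cnj (Complex c (sqrt (1 - c\<^sup>2))) * v)"

text \<open>Solving \<open>koebe w = k\<close> inside the disc gives w = (1 - h) / (1 + h), where h
  is the root of 1 - 4 k with positive real part. For k = (1 + c) / 2 times \<open>koebe v\<close>
  this is h = \<open>slit_root c v / (1 + v)\<close>; clearing the denominator 1 + v makes the
  formula meaningful at -1 as well.\<close>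

definition disc_slit_map :: "real \<Rightarrow> complex \<Rightarrow> complex" where
  "disc_slit_map c v = (1 + v - slit_root c v) / (1 + v + slit_root c v)"

section \<open>Conjugacy of the disc slit map with a scaling, and its boundary behaviour\<close>

locale disc_slit =
  fixes c :: real
  assumes c: "-1 < c" "c < 1"
begin

abbreviation "q \<equiv> slit_root c"
abbreviation "V \<equiv> disc_slit_map c"

lemma c2: "c\<^sup>2 < 1"
  using c by (simp add: abs_square_less_1)

lemma q_square: "(q v)\<^sup>2 = 1 - 2 * of_real c * v + v\<^sup>2"
proof -
  have "(q v)\<^sup>2 = (1 - Complex c (sqrt (1 - c\<^sup>2)) * v) * (1 - cnj (Complex c (sqrt (1 - c\<^sup>2))) * v)"
    by (simp add: slit_root_def power_mult_distrib)
  also have "\<dots> = 1 - (Complex c (sqrt (1 - c\<^sup>2)) + cnj (Complex c (sqrt (1 - c\<^sup>2)))) * v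
      + (Complex c (sqrt (1 - c\<^sup>2)) * cnj (Complex c (sqrt (1 - c\<^sup>2)))) * v\<^sup>2"
    by (simp add: algebra_simps power2_eq_square)
  also have "Complex c (sqrt (1 - c\<^sup>2)) + cnj (Complex c (sqrt (1 - c\<^sup>2))) = 2 * of_real c"
    by (simp add: complex_eq_iff)
  also have "Complex c (sqrt (1 - c\<^sup>2)) * cnj (Complex c (sqrt (1 - c\<^sup>2))) = 1"
    using c2 by (simp add: complex_eq_iff power2_eq_square)
  finally show ?thesis by simp
qed

text \<open>(1 + v + q v) (1 + v - q v) = 2 (1 + c) v, so the denominator could vanish only at v =
  0, where its value is 2.\<close>

lemma denom_nonzero: "1 + v + q v \<noteq> 0"
proof
  assume *: "1 + v + q v = 0"
  have "2 * (1 + of_real c) * v = (1 + v + q v) * (1 + v - q v)"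
    using q_square[of v] by (simp add: algebra_simps power2_eq_square)
  then have "2 * ((1 + of_real c) * v) = 0" using * by (simp only: mult.assoc mult_zero_left)
  then have "(1 + of_real c) * v = 0" by (metis mult_eq_0_iff zero_neq_numeral)
  moreover have "(1 + of_real c :: complex) \<noteq> 0"
    using c by (metis add_eq_0_iff of_real_1 of_real_eq_iff of_real_minus order_less_irrefl minus_minus)
  ultimately have "v = 0" by simp
  with * show False by (simp add: slit_root_def)
qed

lemma continuous_q: "continuous_on (cball 0 1) q"
proof -
  have *: "continuous_on (cball 0 1) (\<lambda>v. csqrt (1 - z * v))" if z: "norm z = 1" for z
  proof -
    have "continuous_on (cball 0 1) (\<lambda>v. csqrt (1 - z * v)) \<longleftrightarrow>
       continuous_on (cball 0 1) (csqrt \<circ> (\<lambda>v. 1 - z * v))"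
      by (simp add: o_def)
    also have "\<dots>"
    proof (rule continuous_on_compose)
      show "continuous_on (cball 0 1) (\<lambda>v. 1 - z * v)" by (intro continuous_intros)
      have "0 \<le> Re (1 - z * v)" if "v \<in> cball 0 1" for v
        using complex_Re_le_cmod[of "z * v"] that z by (simp add: norm_mult)
      then have "(\<lambda>v. 1 - z * v) ` cball 0 1 \<subseteq> {w. 0 \<le> Re w}"
        by auto
      moreover have "continuous_on {w. 0 \<le> Re w} csqrt"
        
        unfolding continuous_on_eq_continuous_within
      proof
        fix z :: complex assume z: "z \<in> {w. 0 \<le> Re w}"
        show "continuous (at z within {w. 0 \<le> Re w}) csqrt"
        proof (cases "z = 0")
          case True
          \<comment> \<open>The branch point 0 is the only point of the closed right half-plane on
            the cut; there continuity follows from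
            \<open>norm (csqrt w) = sqrt (norm w)\<close>.\<close>
          have "((\<lambda>w. sqrt (norm w)) \<longlongrightarrow> 0) (at 0 within {w::complex. 0 \<le> Re w})"
            by (auto intro!: tendsto_eq_intros)
          then have "((\<lambda>w. norm (csqrt w)) \<longlongrightarrow> 0) (at 0 within {w::complex. 0 \<le> Re w})"
            by simp
          then show ?thesis
            using True by (simp add: continuous_within tendsto_norm_zero_iff del: norm_csqrt)
        next
          case False
          then have "z \<notin> \<real>\<^sub>\<le>\<^sub>0"
            using z by (auto simp: complex_nonpos_Reals_iff complex_eq_iff)
          then show ?thesis by (rule continuous_within_csqrt)
        qed
      qed
      ultimately show "continuous_on ((\<lambda>v. 1 - z * v) ` cball 0 1) csqrt"
        by (rule continuous_on_subset[rotated])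
    qed
    finally show ?thesis .
  qed
  have "norm (Complex c (sqrt (1 - c\<^sup>2))) = 1"
    using c2 by (simp add: cmod_def)
  then show ?thesis unfolding slit_root_def
    by (intro continuous_on_mult *) auto
qed

lemma continuous_V: "continuous_on (cball 0 1) V"
  unfolding disc_slit_map_def
  using denom_nonzero by (intro continuous_intros continuous_q) auto

lemma V_plus_1: "1 + V v = 2 * (1 + v) / (1 + v + q v)"
  using denom_nonzero[of v] by (simp add: disc_slit_map_def field_simps)

lemma V_m1 [simp]: "V (-1) = -1"
  using V_plus_1[of "-1"] by (simp add: add_eq_0_iff)

lemma V_neq_m1: "v \<noteq> -1 \<Longrightarrow> V v \<noteq> -1"
  using V_plus_1[of v] denom_nonzero[of v] by (auto simp: add_eq_0_iff)

text \<open>The powers of 1 + v + q v in V v and in 1 + V v cancel; what remains is ((1 + v)^2 - (q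
  v)^2) / (4 (1 + v)^2), whose numerator is 2 (1 + c) v.\<close>

lemma koebe_V: "v \<noteq> -1 \<Longrightarrow> koebe (V v) = of_real ((1 + c) / 2) * koebe v"
proof -
  assume v: "v \<noteq> -1"
  then have v1: "1 + v \<noteq> 0" by (auto simp: add_eq_0_iff)
  have V: "V v = ((1 + v)\<^sup>2 - (q v)\<^sup>2) / (1 + v + q v)\<^sup>2"
  proof -
    have "(1 + v)\<^sup>2 - (q v)\<^sup>2 = (1 + v - q v) * (1 + v + q v)"
      by (simp add: algebra_simps power2_eq_square)
    then show ?thesis
      using denom_nonzero[of v] by (simp add: disc_slit_map_def power2_eq_square)
  qed
  have "koebe (V v) = (((1 + v)\<^sup>2 - (q v)\<^sup>2) / (1 + v + q v)\<^sup>2) / (2 * (1 + v) / (1 + v + q v))\<^sup>2"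
    unfolding koebe_def V_plus_1 by (subst V) simp
  also have "\<dots> = ((1 + v)\<^sup>2 - (q v)\<^sup>2) / (4 * (1 + v)\<^sup>2)"
  proof -
    have "a / b\<^sup>2 / (2 * d / b)\<^sup>2 = a / (4 * d\<^sup>2)" if "b \<noteq> 0" for a b d :: complex
      using that by (simp add: power_divide power_mult_distrib)
    then show ?thesis using denom_nonzero[of v] by blast
  qed
  also have "(1 + v)\<^sup>2 - (q v)\<^sup>2 = 2 * (1 + of_real c) * v"
    unfolding q_square by (simp add: algebra_simps power2_eq_square)
  finally have "koebe (V v) = 2 * (1 + of_real c) * v / (4 * (1 + v)\<^sup>2)" .
  also have "\<dots> = of_real ((1 + c) / 2) * koebe v" using v1 by (simp add: koebe_def field_simps)
  finally show ?thesis .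
qed

lemma V_0_iff: "v \<noteq> 0 \<Longrightarrow> V v \<noteq> 0"
proof -
  assume v: "v \<noteq> 0"
  have "(1 + of_real c :: complex) \<noteq> 0"
    using c by (metis add_eq_0_iff of_real_1 of_real_eq_iff of_real_minus order_less_irrefl minus_minus)
  then show ?thesis
    using v koebe_V[of v] by (cases "v = -1") (auto simp: koebe_def add_eq_0_iff)
qed

text \<open>This pins down the branch. The real part is 1 at 0; if it were not positive somewhere,
  it would vanish at some w of the connected disc. The square would then be a nonpositive real,
  which makes \<open>koebe w\<close> real and at least 1 / (2 (1 + c)) > 1/4, impossible inside the
  disc.\<close>

lemma Re_q_pos:
  assumes "norm v < 1"
  shows "0 < Re (q v / (1 + v))"
proof (rule ccontr)
  let ?h = "\<lambda>v. Re (q v / (1 + v))"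
  assume "\<not> 0 < ?h v"
  have cont: "continuous_on (ball 0 1) ?h"
    by (intro continuous_intros continuous_on_subset[OF continuous_q]) (auto simp: add_eq_0_iff)
  have "connected (?h ` ball 0 1)"
    by (intro connected_continuous_image cont) auto
  moreover have "?h v \<in> ?h ` ball 0 1" "?h 0 \<in> ?h ` ball 0 1"
    using assms by (rule_tac imageI, simp)+
  moreover have "?h 0 = 1" by (simp add: slit_root_def)
  ultimately have "{?h v..1} \<subseteq> ?h ` ball 0 1"
    by (metis connected_contains_Icc)
  then have "0 \<in> ?h ` ball 0 1"
    using \<open>\<not> 0 < ?h v\<close> by (simp only: subset_iff atLeastAtMost_iff) auto
  then obtain w where w: "norm w < 1" "?h w = 0" by auto
  then have w1: "1 + w \<noteq> 0" by (auto simp: add_eq_0_iff)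
  define s where "s = Im (q w / (1 + w))"
  have "q w / (1 + w) = \<i> * of_real s" using w by (simp add: s_def complex_eq_iff)
  then have "(q w / (1 + w))\<^sup>2 = - of_real (s\<^sup>2)"
    by (simp add: power_mult_distrib)
  then have "(q w)\<^sup>2 / (1 + w)\<^sup>2 = - of_real (s\<^sup>2)"
    by (simp only: power_divide)
  moreover have "(q w)\<^sup>2 / (1 + w)\<^sup>2 = 1 - of_real (2 * (1 + c)) * koebe w"
  proof -
    have "1 - 2 * of_real c * w + w\<^sup>2 = (1 + w)\<^sup>2 - of_real (2 * (1 + c)) * w"
      by (simp add: algebra_simps power2_eq_square)
    then show ?thesis unfolding q_square koebe_def using w1 by (simp add: diff_divide_distrib)
  qed
  ultimately have "of_real (2 * (1 + c)) * koebe w = of_real (1 + s\<^sup>2)"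
    by (simp add: algebra_simps)
  moreover have "2 * (1 + c) > 0" using c by simp
  ultimately have "koebe w = of_real (1 + s\<^sup>2) / of_real (2 * (1 + c))"
    by (subst nonzero_eq_divide_eq) (simp_all only: of_real_eq_0_iff mult.commute)
  then have "koebe w = of_real ((1 + s\<^sup>2) / (2 * (1 + c)))"
    by (simp only: of_real_divide)
  moreover have "(1 + s\<^sup>2) / (2 * (1 + c)) \<ge> 1/4"
    using c by (auto simp: field_simps intro: add_increasing2)
  ultimately show False using koebe_real_ge_imp_not_ball[of w] w by fastforce
qed

lemma V_via_h:
  assumes "norm v < 1"
  shows "V v = (1 - q v / (1 + v)) / (1 + q v / (1 + v))"
proof -
  have "1 + v \<noteq> 0" using assms by (auto simp: add_eq_0_iff)
  then show ?thesis using denom_nonzero[of v]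
    by (simp add: disc_slit_map_def divide_simps)
qed

text \<open>The Cayley transform (1 - h) / (1 + h) carries the right half-plane into the unit
  disc.\<close>

lemma norm_V_less:
  assumes "norm v < 1"
  shows "norm (V v) < 1"
proof -
  define h where "h = q v / (1 + v)"
  have h: "Re h > 0" using Re_q_pos[OF assms] by (simp add: h_def)
  have "(norm (1 - h))\<^sup>2 < (norm (1 + h))\<^sup>2"
    using h unfolding cmod_power2 by (simp add: power2_eq_square algebra_simps)
  then have "norm (1 - h) < norm (1 + h)"
    by (simp add: power2_less_imp_less)
  moreover have "0 < norm (1 + h)" using calculation by (metis norm_ge_zero order_le_less_trans)
  ultimately show ?thesis
    unfolding V_via_h[OF assms] h_def[symmetric] by (simp add: norm_divide)
qed

lemma norm_V_le:
  assumes "norm v \<le> 1"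
  shows "norm (V v) \<le> 1"
proof -
  have "V ` closure (ball 0 1) \<subseteq> cball 0 1"
    by (rule image_closure_subset) (use continuous_V norm_V_less in \<open>force simp: less_imp_le\<close>)+
  then have "V v \<in> cball 0 1" using assms by (simp add: image_subset_iff)
  then show ?thesis by simp
qed

lemma inj_on_V: "inj_on V (ball 0 1)"
proof (rule inj_onI)
  fix v w assume *: "v \<in> ball 0 1" "w \<in> ball 0 1" "V v = V w"
  then have "v \<noteq> -1" "w \<noteq> -1" by auto
  then have "of_real ((1 + c) / 2) * koebe v = of_real ((1 + c) / 2) * koebe w"
    using koebe_V * by metis
  moreover have "of_real ((1 + c) / 2) \<noteq> (0::complex)"
    using c by (subst of_real_eq_0_iff) simp
  ultimately have "koebe v = koebe w" by (metis mult_left_cancel)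
  then show "v = w" using inj_on_koebe * by (auto simp: inj_on_def)
qed

text \<open>The two factors of \<open>slit_root\<close> have conjugate coefficients, so conjugation
  exchanges them; the principal root commutes with it because a radicand of nonnegative real part is
  0 or off the cut.\<close>

lemma cnj_q:
  assumes "norm v \<le> 1"
  shows "q (cnj v) = cnj (q v)"
proof -
  have *: "cnj (csqrt (1 - z * v)) = csqrt (1 - cnj z * cnj v)" if "norm z = 1" for z
  proof (cases "1 - z * v = 0")
    case True
    then have "1 - cnj z * cnj v = 0"
      by (metis complex_cnj_diff complex_cnj_mult complex_cnj_one complex_cnj_zero)
    with True show ?thesis by simp
  next
    case False
    have "Re (1 - z * v) \<ge> 0"
      using complex_Re_le_cmod[of "z * v"] that assms by (simp add: norm_mult)
    with False have "1 - z * v \<notin> \<real>\<^sub>\<le>\<^sub>0"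
      by (auto simp: complex_nonpos_Reals_iff complex_eq_iff)
    then show ?thesis by (simp add: cnj_csqrt)
  qed
  have "norm (Complex c (sqrt (1 - c\<^sup>2))) = 1"
    using c2 by (simp add: cmod_def)
  then show ?thesis
    using * unfolding slit_root_def by simp
qed

lemma V_cnj: "norm v \<le> 1 \<Longrightarrow> V (cnj v) = cnj (V v)"
  by (simp add: disc_slit_map_def cnj_q)

text \<open>
  The slit is the part of the radius on which the Koebe function is at least \<open>(1 + c) / 8\<close>, which is
  \<open>(1 + c) / 2\<close> times its value at \<open>1\<close>. The base \<open>1\<close> belongs to \<open>radii\<close> but not to \<open>slit\<close>.
\<close>

definition radii :: "real set" where
  "radii = {s. 0 \<le> s \<and> s \<le> 1 \<and> (1 + c) / 8 * (1 + s)\<^sup>2 \<le> s}"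

definition slit :: "complex set" where
  "slit = of_real ` (radii - {1})"

lemma of_real_in_slit_iff: "of_real s \<in> slit \<longleftrightarrow> 0 < s \<and> s < 1 \<and> (1 + c) / 8 \<le> s / (1 + s)\<^sup>2"
proof (cases "0 < s")
  case True
  then show ?thesis
    by (auto simp: slit_def radii_def image_iff pos_le_divide_eq)
next
  case False
  have "(1 + c) / 8 * (1 + s)\<^sup>2 > 0" if "s \<ge> 0" using c that by (intro mult_pos_pos) auto
  with False show ?thesis by (force simp: slit_def radii_def image_iff)
qed

lemma slit_cases:
  assumes "w \<in> slit"
  obtains s where "w = of_real s" "0 < s" "s < 1" "(1 + c) / 8 \<le> s / (1 + s)\<^sup>2"
  using assms of_real_in_slit_iff by (metis (no_types, lifting) imageE slit_def)

lemma one_in_radii: "1 \<in> radii"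
  using c by (simp add: radii_def)

text \<open>s / (1 + s)^2 is increasing on [0, 1], since s (1 + a)^2 - a (1 + s)^2 = (s - a) (1 - a
  s). Thus \<open>radii\<close> is an interval, and connectedness of the slit needs no formula for
  its tip.\<close>

lemma radii_upward:
  assumes "a \<in> radii" "a \<le> s" "s \<le> 1"
  shows "s \<in> radii"
proof -
  have a: "0 \<le> a" "(1 + c) / 8 * (1 + a)\<^sup>2 \<le> a" using assms by (auto simp: radii_def)
  have "a * s \<le> 1 * 1" using a assms by (intro mult_mono) auto
  then have "(s - a) * (1 - a * s) \<ge> 0" using assms by simp
  then have "a * (1 + s)\<^sup>2 \<le> s * (1 + a)\<^sup>2" by (simp add: algebra_simps power2_eq_square)
  moreover have "((1 + c) / 8 * (1 + a)\<^sup>2) * (1 + s)\<^sup>2 \<le> a * (1 + s)\<^sup>2"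
    by (rule mult_right_mono[OF a(2)]) simp
  ultimately have "(1 + a)\<^sup>2 * ((1 + c) / 8 * (1 + s)\<^sup>2) \<le> (1 + a)\<^sup>2 * s"
    by (simp add: mult.commute mult.left_commute)
  moreover have "(1 + a)\<^sup>2 > 0" using a by simp
  ultimately have "(1 + c) / 8 * (1 + s)\<^sup>2 \<le> s" by (simp only: mult_le_cancel_left_pos)
  then show ?thesis using assms a by (simp add: radii_def)
qed

lemma connected_slit: "connected slit" "connected (insert 1 slit)"
proof -
  have *: "connected (radii - {1})" "connected radii"
    unfolding connected_iff_interval using radii_upward by (auto simp: radii_def)
  show "connected slit"
    unfolding slit_def by (intro connected_continuous_image * continuous_intros)
  have "insert 1 slit = of_real ` radii"
    using one_in_radii unfolding slit_def by (auto simp: image_iff)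
  then show "connected (insert 1 slit)"
    by (auto intro!: connected_continuous_image * continuous_intros)
qed

lemma compact_slit: "compact (insert 1 slit)"
proof -
  have "radii = {0..1} \<inter> {s. (1 + c) / 8 * (1 + s)\<^sup>2 \<le> s}" by (auto simp: radii_def)
  moreover have "closed {s. (1 + c) / 8 * (1 + s)\<^sup>2 \<le> s}"
    by (intro closed_Collect_le continuous_intros)
  ultimately have "compact radii" by (simp add: compact_Int_closed)
  moreover have "insert 1 slit = of_real ` radii"
    using one_in_radii unfolding slit_def by (auto simp: image_iff)
  ultimately show ?thesis
    by (auto intro!: compact_continuous_image continuous_intros)
qed

text \<open>The defining inequality is strict at s = 1 because (1 + c) / 2 < 1, and so persists
  slightly to the left. Nonemptiness lets a new slit count as a new component.\<close>

lemma slit_nonempty: "slit \<noteq> {}"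
proof -
  have "continuous (at_left 1) (\<lambda>s::real. s - (1 + c) / 8 * (1 + s)\<^sup>2)"
    by (intro continuous_intros)
  then have "((\<lambda>s::real. s - (1 + c) / 8 * (1 + s)\<^sup>2) \<longlongrightarrow> 1 - (1 + c) / 8 * (1 + 1)\<^sup>2) (at_left 1)"
    by (simp add: continuous_within)
  moreover have "1 - (1 + c) / 8 * (1 + 1)\<^sup>2 > 0" using c by simp
  ultimately have "\<forall>\<^sub>F s in at_left 1. s - (1 + c) / 8 * (1 + s)\<^sup>2 > 0"
    by (rule order_tendstoD)
  moreover have "\<forall>\<^sub>F s in at_left 1. s \<in> {0<..<1::real}"
    by (rule eventually_at_left_real) simp
  ultimately have "\<forall>\<^sub>F s in at_left (1::real). s \<in> radii - {1}"
    by eventually_elim (auto simp: radii_def)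
  then obtain s where "s \<in> radii - {1}" 
    using eventually_happens trivial_limit_at_left_real by blast
  then show ?thesis by (auto simp: slit_def)
qed

lemma slit_subset: "slit \<subseteq> ball 0 1 - {0}"
  by (auto elim!: slit_cases)

lemma koebe_of_real: "koebe (of_real s) = of_real (s / (1 + s)\<^sup>2)"
  by (simp add: koebe_def)

lemma koebe_V_circle:
  assumes "norm v = 1" "v \<noteq> -1"
  shows "koebe (V v) = of_real ((1 + c) / (4 * (1 + Re v)))" "Re v > -1"
proof -
  show "Re v > -1" using koebe_circle[OF assms] by simp
  have "koebe (V v) = of_real ((1 + c) / 2) * of_real (1 / (2 + 2 * Re v))"
    using koebe_V[OF assms(2)] koebe_circle(1)[OF assms] by simp
  also have "\<dots> = of_real ((1 + c) / 2 * (1 / (2 + 2 * Re v)))" by (simp only: of_real_mult)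
  also have "(1 + c) / 2 * (1 / (2 + 2 * Re v)) = (1 + c) / (4 * (1 + Re v))" by simp
  finally show "koebe (V v) = of_real ((1 + c) / (4 * (1 + Re v)))" .
qed

text \<open>The value (1 + c) / (4 (1 + Re v)) is at least 1/4 exactly when Re v \<le> c, and such a
  value is not taken inside the disc.\<close>

lemma norm_V_circle:
  assumes v: "norm v = 1" and r: "Re v \<le> c"
  shows "norm (V v) = 1"
proof (cases "v = -1")
  case False
  note k = koebe_V_circle[OF v False]
  have "(1 + c) / (4 * (1 + Re v)) \<ge> 1/4" using k(2) r by (simp add: field_simps)
  then have "norm (V v) \<ge> 1" using koebe_real_ge_imp_not_ball[OF k(1)] by simp
  with norm_V_le[of v] v show ?thesis by simp
qed simp

text \<open>Now the Koebe value is positive and below 1/4, so the image is on the positive radius;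
  Re v \<le> 1 gives the lower bound (1 + c) / 8 that defines the slit.\<close>

lemma V_circle_slit:
  assumes v: "norm v = 1" and r: "c < Re v"
  shows "V v \<in> slit"
proof -
  have vm: "v \<noteq> -1" using r c by auto
  note k = koebe_V_circle[OF v vm]
  let ?s = "(1 + c) / (4 * (1 + Re v))"
  have "Re v \<le> 1" using complex_Re_le_cmod[of v] v by simp
  then have s: "0 < ?s" "?s < 1/4"
    using k(2) r c by (auto simp: field_simps)
  have s8: "(1 + c) / 8 \<le> ?s"
    using k(2) \<open>Re v \<le> 1\<close> c by (intro divide_left_mono) auto
  note n = koebe_real_ball[OF k(1) s(1,2) norm_V_le]
  have V: "V v = of_real (norm (V v))" "norm (V v) < 1" using n v by auto
  have "koebe (V v) = of_real (norm (V v) / (1 + norm (V v))\<^sup>2)"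
    by (subst V(1), rule koebe_of_real)
  then have "norm (V v) / (1 + norm (V v))\<^sup>2 = ?s" using k(1) by (simp only: of_real_eq_iff)
  moreover from this have "0 < norm (V v) / (1 + norm (V v))\<^sup>2" using s by (simp only:)
  then have "norm (V v) > 0" by (simp add: zero_less_divide_iff)
  ultimately show ?thesis using s s8 V of_real_in_slit_iff[of "norm (V v)"] by simp
qed

text \<open>Points of the slit have Koebe value at least (1 + c) / 8; dividing by the factor (1 + c)
  / 2 would give v a real value of at least 1/4.\<close>

lemma V_ball_not_slit:
  assumes "norm v < 1"
  shows "V v \<notin> slit"
proof
  assume "V v \<in> slit"
  then obtain s where s: "V v = of_real s" "(1 + c) / 8 \<le> s / (1 + s)\<^sup>2" by (auto elim: slit_cases)
  have "of_real ((1 + c) / 2) * koebe v = of_real (s / (1 + s)\<^sup>2)"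
    using koebe_V[of v] assms s koebe_of_real[of s] by force
  moreover have c0: "(1 + c) / 2 > 0" using c by simp
  ultimately have "koebe v = of_real (s / (1 + s)\<^sup>2 / ((1 + c) / 2))"
    by (metis of_real_divide nonzero_mult_div_cancel_left of_real_eq_0_iff less_irrefl)
  moreover have "s / (1 + s)\<^sup>2 / ((1 + c) / 2) \<ge> 1/4"
    using s(2) c0 by (subst pos_le_divide_eq) auto
  ultimately show False using koebe_real_ge_imp_not_ball[of v] assms by fastforce
qed

lemma circle_point:
  assumes "\<bar>x\<bar> \<le> 1" 
  shows "norm (Complex x (sqrt (1 - x\<^sup>2))) = 1"
  using assms by (simp add: cmod_def abs_square_le_1)

lemma V_circle_image: "V ` sphere 0 1 = sphere 0 1 \<union> slit"
proof
  show "V ` sphere 0 1 \<subseteq> sphere 0 1 \<union> slit"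
    using norm_V_circle V_circle_slit by (force simp: not_le)
  show "sphere 0 1 \<union> slit \<subseteq> V ` sphere 0 1"
  proof
    fix w assume w: "w \<in> sphere 0 1 \<union> slit"
    show "w \<in> V ` sphere 0 1"
    proof (cases "w \<in> slit")
      case True
      then obtain s where s: "w = of_real s" "0 < s" "s < 1" "(1 + c) / 8 \<le> s / (1 + s)\<^sup>2"
        by (rule slit_cases)
      define k where "k = s / (1 + s)\<^sup>2"
      have "(1 - s)\<^sup>2 > 0" using s by simp
      then have k4: "k < 1/4" unfolding k_def using s
        by (auto simp: field_simps power2_eq_square)
      have k8: "k \<ge> (1 + c) / 8" "k > 0" using s by (auto simp: k_def)
      \<comment> \<open>The real part for which the value (1 + c) / (4 (1 + x)) of
        \<open>koebe_V_circle\<close> equals k.\<close>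
      define x where "x = (1 + c) / (4 * k) - 1"
      have "(1 + c) * (4 * k) < (1 + c) * 1" using k4 c by (intro mult_strict_left_mono) auto
      then have x: "x > c" "x \<le> 1" using k8 c by (auto simp: x_def field_simps)
      define v where "v = Complex x (sqrt (1 - x\<^sup>2))"
      have v: "norm v = 1" "Re v = x" using circle_point[of x] x c by (auto simp: v_def)
      have vm: "v \<noteq> -1" using v x c by auto
      have "(1 + c) / (4 * (1 + Re v)) = k"
      proof -
        have "4 * (1 + Re v) = (1 + c) / k" using v k8 by (simp add: x_def field_simps)
        then show ?thesis using c by simp
      qed
      then have "koebe (V v) = koebe w"
        using koebe_V_circle(1)[OF v(1) vm] koebe_of_real[of s] s by (simp add: k_def)
      moreover have "norm (V v) < 1" using V_circle_slit[of v] v x slit_subset by auto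
      moreover have "norm w < 1" using s by simp
      ultimately have "V v = w" using inj_on_koebe by (auto simp: inj_on_def)
      then show ?thesis using v by auto
    next
      case False
      then have w1: "norm w = 1" using w by simp
      show ?thesis
      proof (cases "w = -1")
        case True
        then show ?thesis by (intro image_eqI[of _ _ "-1"]) auto
      next
        case wm: False
        have wR: "Re w > -1" "Re w \<le> 1" using koebe_circle[OF w1 wm] complex_Re_le_cmod[of w] w1 by auto
        \<comment> \<open>Solves (1 + c) / (4 (1 + x)) = 1 / (2 + 2 Re w), the Koebe value of
          w.\<close>
        define x where "x = (1 + c) / 2 * (1 + Re w) - 1"
        have "(1 + c) / 2 * (1 + Re w) \<le> (1 + c) / 2 * 2" using wR c by (intro mult_left_mono) auto
        moreover have "(1 + c) / 2 * (1 + Re w) > 0" using wR c by (intro mult_pos_pos) auto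
        ultimately have x: "x \<le> c" "x > -1" by (auto simp: x_def)
        define v where "v = Complex x (sqrt (1 - x\<^sup>2))"
        have v: "norm v = 1" "Re v = x" using circle_point[of x] x c by (auto simp: v_def)
        have vm: "v \<noteq> -1" using v x by auto
        have "(1 + c) / (4 * (1 + Re v)) = 1 / (2 + 2 * Re w)"
        proof -
          have "4 * (1 + Re v) = (1 + c) * (2 + 2 * Re w)" using v by (simp add: x_def algebra_simps)
          then show ?thesis using c by simp
        qed
        then have "koebe (V v) = koebe w"
          using koebe_V_circle(1)[OF v(1) vm] koebe_circle(1)[OF w1 wm] by simp
        then consider "V v = w" | "V v * w = 1"
          using koebe_eq_iff[OF V_neq_m1[OF vm] wm] by auto
        then show ?thesis
        proof cases
          case 1
          then show ?thesis using v by auto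
        next
          case 2
          \<comment> \<open>The Koebe value does not distinguish w from its inverse. In this case V
            v is the conjugate of w, and the conjugate of v is the preimage sought.\<close>
          have "w * cnj w = 1" using w1 by (simp add: complex_norm_square[symmetric])
          with 2 have "V v = cnj w" by (metis mult.commute mult_cancel_left mult_zero_left zero_neq_one)
          then have "V (cnj v) = w" using V_cnj[of v] v by simp
          then show ?thesis using v by (intro image_eqI[of _ _ "cnj v"]) auto
        qed
      qed
    qed
  qed
qed

end

section \<open>Trees in the disc\<close>

text \<open>A component of the union that missed K would lie in Y, hence contain all of Y by
  maximality, and so meet K after all. Thus the components of K map onto those of the union.\<close>

lemma components_attach:
  assumes fin: "finite (components K)" and Y: "connected Y" "Y \<inter> K \<noteq> {}"
  shows "finite (components (K \<union> Y))" "card (components (K \<union> Y)) \<le> card (components K)"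
proof -
  let ?f = "\<lambda>C. connected_component_set (K \<union> Y) (SOME x. x \<in> C)"
  have "components (K \<union> Y) \<subseteq> ?f ` components K"
  proof
    fix D assume D: "D \<in> components (K \<union> Y)"
    have "D \<inter> K \<noteq> {}"
    proof
      assume "D \<inter> K = {}"
      then have "D \<subseteq> Y" "D \<noteq> {}" using D in_components_subset in_components_nonempty by blast+
      then have "Y \<subseteq> D" using components_maximal[OF D Y(1)] by blast
      with Y \<open>D \<inter> K = {}\<close> show False by blast
    qed
    then obtain x where x: "x \<in> D" "x \<in> K" by blast
    define C where "C = connected_component_set K x"
    have C: "C \<in> components K" "x \<in> C" using x by (auto simp: C_def components_def)
    have "C \<subseteq> D"
      using components_maximal[OF D, of C] C x in_components_connected[OF C(1)] in_components_subset[OF C(1)]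
      by blast
    moreover have "(SOME y. y \<in> C) \<in> C" using C(2) by (rule someI)
    ultimately have "D = ?f C" using D
      by (metis connected_component_eq_empty components_iff connected_component_eq subsetD)
    then show "D \<in> ?f ` components K" using C by blast
  qed
  then show "finite (components (K \<union> Y))" "card (components (K \<union> Y)) \<le> card (components K)"
    using fin by (auto intro: finite_surj surj_card_le)
qed

text \<open>F and G may meet, but only outside the union of K and L. In the application they share
  the point of the circle at which the new slit is based.\<close>

lemma components_separated_Un:
  assumes FG: "closed F" "closed G" "K \<subseteq> F" "L \<subseteq> G" "F \<inter> L = {}" "G \<inter> K = {}"
    and L: "connected L" "L \<noteq> {}"
  shows "components (K \<union> L) = insert L (components K)" "L \<notin> components K"
proof -
  have sub: "T \<subseteq> K \<or> T \<subseteq> L" if T: "connected T" "T \<subseteq> K \<union> L" for T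
  proof -
    have "F \<inter> G \<inter> T = {}" "T \<subseteq> F \<union> G" using T(2) FG by blast+
    then have "F \<inter> T = {} \<or> G \<inter> T = {}" using T(1) FG(1,2) unfolding connected_closed by blast
    then show ?thesis using T(2) FG by blast
  qed
  show "L \<notin> components K"
    using L in_components_subset[of L K] FG by blast
  show "components (K \<union> L) = insert L (components K)"
  proof (intro equalityI subsetI)
    fix D assume D: "D \<in> components (K \<union> L)"
    have D': "connected D" "D \<subseteq> K \<union> L" "D \<noteq> {}"
      using D in_components_connected in_components_subset in_components_nonempty by blast+
    from sub[OF D'(1,2)] show "D \<in> insert L (components K)"
    proof
      assume "D \<subseteq> K"
      moreover have "D' = D" if "D \<subseteq> D'" "connected D'" "D' \<subseteq> K" for D'
        using components_maximal[OF D, of D'] that D' by blast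
      ultimately show ?thesis using D' by (auto simp: in_components_maximal)
    next
      assume "D \<subseteq> L"
      then have "L \<subseteq> D" using components_maximal[OF D L(1)] D' by blast
      with \<open>D \<subseteq> L\<close> show ?thesis by auto
    qed
  next
    fix D assume "D \<in> insert L (components K)"
    then consider "D = L" | "D \<in> components K" by auto
    then show "D \<in> components (K \<union> L)"
    proof cases
      case 1
      have "D' = L" if "L \<subseteq> D'" "connected D'" "D' \<subseteq> K \<union> L" for D'
        using sub[OF that(2,3)] that L FG by blast
      then show ?thesis using 1 L by (auto simp: in_components_maximal)
    next
      case 2
      then have D: "connected D" "D \<subseteq> K" "D \<noteq> {}"
        using in_components_connected in_components_subset in_components_nonempty by blast+
      have "D' = D" if "D \<subseteq> D'" "connected D'" "D' \<subseteq> K \<union> L" for D'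
      proof -
        have "D' \<subseteq> K" using sub[OF that(2,3)] that D FG by blast
        then show ?thesis using components_maximal[OF 2 that(2)] that D by blast
      qed
      then show ?thesis using D by (auto simp: in_components_maximal)
    qed
  qed
qed

section \<open>Growth of the image of the circle under composed slit maps\<close>

primrec disc_comp :: "real \<Rightarrow> (nat \<Rightarrow> complex) \<Rightarrow> nat \<Rightarrow> complex \<Rightarrow> complex" where
  "disc_comp c e 0 = id"
| "disc_comp c e (Suc n) = disc_comp c e n \<circ> (\<lambda>v. e n * disc_slit_map c (cnj (e n) * v))"

definition disc_trees :: "real \<Rightarrow> (nat \<Rightarrow> complex) \<Rightarrow> nat \<Rightarrow> complex set" where
  "disc_trees c e n = disc_comp c e n ` sphere 0 1 - sphere 0 1"

context disc_slit
begin

abbreviation "rot e v \<equiv> e * V (cnj e * v)"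

lemma rot_sphere_image:
  assumes e: "norm e = 1"
  shows "(\<lambda>v. rot e v) ` sphere 0 1 = sphere 0 1 \<union> (\<lambda>v. e * v) ` slit"
proof -
  have ee: "e * (cnj e * v) = v" "cnj e * (e * v) = v" for v
  proof -
    have "e * cnj e = 1" using e by (simp add: complex_norm_square[symmetric])
    then show "e * (cnj e * v) = v" "cnj e * (e * v) = v" by (simp_all add: mult.assoc[symmetric] mult.commute[of "cnj e"])
  qed
  have *: "(\<lambda>v. d * v) ` sphere 0 1 = sphere 0 1" if d: "norm d = 1" for d :: complex
  proof (intro equalityI subsetI)
    fix w assume w: "w \<in> sphere (0::complex) 1"
    have "d \<noteq> 0" using d by auto
    then have "w = d * (w / d)" "w / d \<in> sphere 0 1" using w d by (auto simp: norm_divide)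
    then show "w \<in> (\<lambda>v. d * v) ` sphere 0 1" by blast
  qed (use d in \<open>auto simp: norm_mult\<close>)
  have "(\<lambda>v. rot e v) ` sphere 0 1 = (\<lambda>v. e * v) ` V ` ((\<lambda>v. cnj e * v) ` sphere 0 1)"
    by (simp add: image_image)
  also have "\<dots> = (\<lambda>v. e * v) ` (sphere 0 1 \<union> slit)"
    using * e V_circle_image by simp
  also have "\<dots> = sphere 0 1 \<union> (\<lambda>v. e * v) ` slit"
    using *[OF e] by (simp only: image_Un)
  finally show ?thesis .
qed

lemma rot_ball: 
  assumes "norm e = 1" "v \<in> ball 0 1 - {0}"
  shows "rot e v \<in> ball 0 1 - {0} - (\<lambda>v. e * v) ` slit"
proof -
  have "e \<noteq> 0" using assms by auto
  then show ?thesis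
    using norm_V_less[of "cnj e * v"] V_0_iff[of "cnj e * v"] V_ball_not_slit[of "cnj e * v"] assms
    by (auto simp: norm_mult)
qed

lemma rot_cball:
  assumes "norm e = 1" "v \<in> cball 0 1 - {0}"
  shows "rot e v \<in> cball 0 1 - {0}"
proof -
  have "e \<noteq> 0" using assms by auto
  then show ?thesis
    using norm_V_le[of "cnj e * v"] V_0_iff[of "cnj e * v"] assms by (auto simp: norm_mult)
qed

lemma inj_rot:
  assumes "norm e = 1"
  shows "inj_on (\<lambda>v. rot e v) (ball 0 1)"
proof (rule inj_onI)
  fix v w assume *: "v \<in> ball 0 1" "w \<in> ball 0 1" "rot e v = rot e w"
  have "e \<noteq> 0" using assms by auto
  then have "V (cnj e * v) = V (cnj e * w)" using * by simp
  moreover have "cnj e * v \<in> ball 0 1" "cnj e * w \<in> ball 0 1" using * assms by (auto simp: norm_mult)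
  ultimately have "cnj e * v = cnj e * w" using inj_onD[OF inj_on_V] by blast
  then show "v = w" using \<open>e \<noteq> 0\<close> by simp
qed

lemma continuous_rot: "norm e = 1 \<Longrightarrow> continuous_on (cball 0 1) (\<lambda>v. rot e v)"
  by (intro continuous_intros continuous_on_compose2[OF continuous_V]) (auto simp: norm_mult)

context
  fixes e :: "nat \<Rightarrow> complex"
  assumes e: "\<And>n. norm (e n) = 1"
begin

abbreviation "U \<equiv> disc_comp c e"

lemma U_ball: "v \<in> ball 0 1 - {0} \<Longrightarrow> U n v \<in> ball 0 1 - {0}"
proof (induction n arbitrary: v)
  case (Suc n)
  show ?case using Suc.IH[of "rot (e n) v"] rot_ball[OF e[of n] Suc.prems] by simp
qed auto

lemma continuous_U: "continuous_on (cball 0 1 - {0}) (U n)"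
proof (induction n)
  case (Suc n)
  have "continuous_on (cball 0 1 - {0}) (\<lambda>v. U n (rot (e n) v))"
    using rot_cball[OF e[of n]]
    by (intro continuous_on_compose2[OF Suc] continuous_on_subset[OF continuous_rot[OF e[of n]]]) auto
  then show ?case by (simp add: o_def)
qed auto

lemma inj_U: "inj_on (U n) (ball 0 1 - {0})"
proof (induction n)
  case (Suc n)
  have "inj_on (\<lambda>v. rot (e n) v) (ball 0 1 - {0})"
    using inj_rot[OF e[of n]] by (rule inj_on_subset) auto
  moreover have "inj_on (U n) ((\<lambda>v. rot (e n) v) ` (ball 0 1 - {0}))"
    using Suc by (rule inj_on_subset) (meson DiffD1 image_subsetI rot_ball[OF e[of n]])
  ultimately show ?case unfolding disc_comp.simps by (rule comp_inj_on)
qed auto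

lemma eslit_subset: "(\<lambda>v. e n * v) ` slit \<subseteq> ball 0 1 - {0}"
proof -
  have "e n \<noteq> 0" using e[of n] by auto
  then show ?thesis using slit_subset e[of n] by (auto simp: norm_mult subset_iff)
qed

lemma U_Suc_image: "U (Suc n) ` S = U n ` (\<lambda>v. rot (e n) v) ` S"
  by (simp only: disc_comp.simps image_comp)

text \<open>Injectivity holds only inside the disc, so this is proved by induction: the new boundary
  image is the old one together with the image of a slit, the new map sends the punctured disc into
  the complement of that slit, and injectivity of the old composition keeps the two images
  apart.\<close>

lemma U_sphere_ball_disjoint: "U n ` sphere 0 1 \<inter> U n ` (ball 0 1 - {0}) = {}"
proof (induction n)
  case (Suc n)
  have disj: "A1 \<inter> B1 = {}"
    if "A1 = A2 \<union> A3" "B1 \<subseteq> B2" "B2 \<inter> A3 = {}" "B2 \<subseteq> B3" "A2 \<inter> B3 = {}"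
    for A1 A2 A3 B1 B2 B3 :: "complex set"
    using that by blast
  let ?r = "\<lambda>v. rot (e n) v" and ?L = "(\<lambda>v. e n * v) ` slit"
  have "U (Suc n) ` sphere 0 1 = U n ` sphere 0 1 \<union> U n ` ?L"
    unfolding U_Suc_image rot_sphere_image[OF e[of n]] by (rule image_Un)
  moreover have "U (Suc n) ` (ball 0 1 - {0}) \<subseteq> U n ` (ball 0 1 - {0} - ?L)"
    unfolding U_Suc_image by (intro image_mono image_subsetI rot_ball e)
  moreover have "U n ` (ball 0 1 - {0} - ?L) \<inter> U n ` ?L = {}"
  proof -
    have "(ball 0 1 - {0} - ?L) \<inter> ?L = {}" by (rule Diff_disjoint[THEN trans[OF Int_commute]])
    then show ?thesis
      using inj_on_image_Int[OF inj_U[of n] Diff_subset eslit_subset[of n], of ?L] by (metis image_empty)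
  qed
  moreover have "U n ` (ball 0 1 - {0} - ?L) \<subseteq> U n ` (ball 0 1 - {0})"
    by (intro image_mono Diff_subset)
  ultimately show ?case using Suc.IH by (rule disj)
qed auto

lemma disc_trees_Suc: "disc_trees c e (Suc n) = disc_trees c e n \<union> U n ` (\<lambda>v. e n * v) ` slit"
proof -
  have "U (Suc n) ` sphere 0 1 = U n ` sphere 0 1 \<union> U n ` (\<lambda>v. e n * v) ` slit"
    unfolding U_Suc_image rot_sphere_image[OF e[of n]] by (rule image_Un)
  moreover have "U n ` (\<lambda>v. e n * v) ` slit \<subseteq> ball 0 1"
    using eslit_subset[of n] U_ball by blast
  moreover have "ball (0::complex) 1 \<inter> sphere 0 1 = {}" by auto
  ultimately show ?thesis unfolding disc_trees_def by blast
qed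

lemma compact_U_sphere: "compact (U n ` sphere 0 1)"
  by (intro compact_continuous_image continuous_on_subset[OF continuous_U]) auto

text \<open>All depends on the base \<open>U n (e n)\<close> of the new slit image. On the circle,
  it lies outside the older trees, and the closed slit with base is separated from them; inside the
  disc, it is a point of an older tree, to which the slit is attached.\<close>

lemma disc_trees_step:
  assumes fin: "finite (components (disc_trees c e n))"
  shows "finite (components (disc_trees c e (Suc n)))"
    "norm (U n (e n)) = 1 \<Longrightarrow> card (components (disc_trees c e (Suc n))) = Suc (card (components (disc_trees c e n)))"
    "norm (U n (e n)) \<noteq> 1 \<Longrightarrow> card (components (disc_trees c e (Suc n))) \<le> card (components (disc_trees c e n))"
proof -
  define K where "K = disc_trees c e n"
  define L where "L = U n ` (\<lambda>v. e n * v) ` slit"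
  \<comment> \<open>Including the base makes the image of the slit closed, which \<open>L\<close> is
    not.\<close>
  define L1 where "L1 = U n ` (\<lambda>v. e n * v) ` insert 1 slit"
  have KL: "disc_trees c e (Suc n) = K \<union> L" by (simp add: K_def L_def disc_trees_Suc)
  have sub: "(\<lambda>v. e n * v) ` insert 1 slit \<subseteq> cball 0 1 - {0}"
  proof -
    have "e n \<noteq> 0" using e[of n] by auto
    then show ?thesis using slit_subset e[of n] by (auto simp: norm_mult subset_iff intro: less_imp_le)
  qed
  have en: "e n \<in> sphere 0 1" using e by simp
  have contL: "continuous_on ((\<lambda>v. e n * v) ` insert 1 slit) (U n)"
    using continuous_U sub by (rule continuous_on_subset)
  have contL': "continuous_on ((\<lambda>v. e n * v) ` slit) (U n)"
    using contL by (rule continuous_on_subset) auto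
  have L: "connected L" "connected L1" "closed L1"
    unfolding L_def L1_def
    by (intro connected_continuous_image connected_slit contL contL' continuous_intros
        compact_imp_closed compact_continuous_image compact_slit)+
  have L1: "L1 = insert (U n (e n)) L" by (simp add: L1_def L_def)
  have Lne: "L \<noteq> {}" using slit_nonempty by (simp add: L_def)
  have disj: "L \<inter> U n ` sphere 0 1 = {}"
    using U_sphere_ball_disjoint[of n] eslit_subset[of n] unfolding L_def by blast
  have 1: "components (K \<union> L) = insert L (components K)" "L \<notin> components K" if n1: "norm (U n (e n)) = 1"
  proof -
    have "U n (e n) \<notin> K" using n1 by (simp add: K_def disc_trees_def)
    moreover have "L \<inter> K = {}" using disj unfolding K_def disc_trees_def by blast
    ultimately have "L1 \<inter> K = {}" by (simp add: L1)
    moreover have "K \<subseteq> U n ` sphere 0 1" unfolding K_def disc_trees_def by (rule Diff_subset)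
    moreover have "L \<subseteq> L1" unfolding L1 by (rule subset_insertI)
    moreover have "U n ` sphere 0 1 \<inter> L = {}" using disj by (simp add: Int_commute)
    ultimately show "components (K \<union> L) = insert L (components K)" "L \<notin> components K"
      using components_separated_Un[OF compact_imp_closed[OF compact_U_sphere[of n]] L(3) _ _ _ _ L(1) Lne, of K]
      by blast+
  qed
  have 2: "K \<union> L = K \<union> L1" "L1 \<inter> K \<noteq> {}" if n1: "norm (U n (e n)) \<noteq> 1"
  proof -
    have "U n (e n) \<in> K" using n1 en unfolding K_def disc_trees_def by auto
    then show "K \<union> L = K \<union> L1" "L1 \<inter> K \<noteq> {}" by (auto simp: L1)
  qed
  note f = fin[folded K_def]
  show "finite (components (disc_trees c e (Suc n)))"
  proof (cases "norm (U n (e n)) = 1")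
    case True
    then show ?thesis using 1 f by (simp add: KL)
  next
    case False
    then show ?thesis using components_attach(1)[OF f L(2) 2(2)] 2(1) by (simp add: KL)
  qed
  show "card (components (disc_trees c e (Suc n))) = Suc (card (components (disc_trees c e n)))"
    if "norm (U n (e n)) = 1"
    using 1[OF that] f by (simp add: KL K_def[symmetric])
  show "card (components (disc_trees c e (Suc n))) \<le> card (components (disc_trees c e n))"
    if "norm (U n (e n)) \<noteq> 1"
    using components_attach(2)[OF f L(2)] 2[OF that] by (simp add: KL K_def[symmetric])
qed

lemma finite_components_disc_trees: "finite (components (disc_trees c e n))"
proof (induction n)
  case 0
  have "disc_trees c e 0 = {}" by (simp add: disc_trees_def)
  then show ?case by simp
qed (rule disc_trees_step(1))

lemma card_components_disc_trees_less_iff: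
  "card (components (disc_trees c e n)) < card (components (disc_trees c e (Suc n))) \<longleftrightarrow> norm (U n (e n)) = 1"
  using disc_trees_step(2,3)[OF finite_components_disc_trees, of n] by linarith

end

end

section \<open>Survival on the circle for uniform centres\<close>

text \<open>The part of the window beyond R is translated back by R, where it fills the gap
  \<open>{0..<b}\<close>.\<close>

lemma emeasure_lborel_periodic:
  fixes P :: "real \<Rightarrow> bool"
  assumes per: "\<And>x. P (x + R) = P x" and b: "0 \<le> b" "b \<le> R" and [measurable]: "Measurable.pred borel P"
  shows "emeasure lborel {x\<in>{b..<b + R}. P x} = emeasure lborel {x\<in>{0..<R}. P x}"
proof -
  let ?A = "{x\<in>{0..<b}. P x}" and ?B = "{x\<in>{b..<R}. P x}" and ?C = "{x\<in>{R..<b + R}. P x}"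
  have "emeasure lborel ?C = emeasure (distr lborel borel ((+) R)) ?C"
    by (simp add: lborel_distr_plus)
  also have "\<dots> = emeasure lborel ((+) R -` ?C)"
    by (subst emeasure_distr) auto
  also have "(+) R -` ?C = ?A"
    using per by (auto simp: add.commute)
  finally have "emeasure lborel ?C = emeasure lborel ?A" .
  moreover have "{x\<in>{b..<b + R}. P x} = ?B \<union> ?C" using b by auto
  moreover have "emeasure lborel (?B \<union> ?C) = emeasure lborel ?B + emeasure lborel ?C"
    by (intro plus_emeasure[symmetric]) auto
  moreover have "{x\<in>{0..<R}. P x} = ?B \<union> ?A" using b by auto
  moreover have "emeasure lborel (?B \<union> ?A) = emeasure lborel ?B + emeasure lborel ?A"
    by (intro plus_emeasure[symmetric]) auto
  ultimately show ?thesis by simp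
qed

text \<open>1 - cos t = 2 sin^2 (t / 2), and sin u is at most u in absolute value. With a = \<delta>
  this puts the arc of half-angle 2 \<delta> inside the arc that is mapped into the slit.\<close>

lemma cos_greater_quadratic:
  fixes t a :: real
  assumes "\<bar>t\<bar> < 2 * a"
  shows "1 - 2 * a\<^sup>2 < cos t"
proof -
  have "(sin (t / 2))\<^sup>2 \<le> (t / 2)\<^sup>2"
    using abs_sin_x_le_abs_x[of "t / 2"] unfolding abs_le_square_iff .
  also have "(t / 2)\<^sup>2 < a\<^sup>2"
    using assms abs_le_square_iff[of a "t / 2"] by (simp add: not_le[symmetric])
  finally show ?thesis using cos_double_sin[of "t / 2"] by simp
qed

abbreviation unif :: "real \<Rightarrow> real measure" where
  "unif R \<equiv> uniform_measure lborel {0..<R}"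

lemma prob_space_unif: "R > 0 \<Longrightarrow> prob_space (unif R)"
  by (rule prob_space_uniform_measure) auto

text \<open>Modulo the period, the complementary set contains an arc of length 4 a N around N times
  the argument of y, a share 2 a / \<pi> of the circumference; by periodicity the position of y does
  not matter.\<close>

lemma emeasure_unif_Re_le:
  assumes N: "N > 0" and a: "0 < a" "a < 1" and y: "norm y = 1"
  shows "emeasure (unif (2 * pi * N)) {x. Re (cnj (cis (x / N)) * y) \<le> 1 - 2 * a\<^sup>2} \<le> ennreal (1 - 2 * a / pi)"
proof -
  define R where "R = 2 * pi * N"
  have R: "R > 0" using N by (simp add: R_def)
  \<comment> \<open>The extra turn places \<eta> in [\<pi>, 3 \<pi>], so that the window of length R
    centred at N \<eta> starts at a point b between 0 and R.\<close>
  define \<eta> where "\<eta> = Arg y + 2 * pi"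
  have \<eta>: "pi \<le> \<eta>" "\<eta> \<le> 3 * pi" using Arg_bounded[of y] by (auto simp: \<eta>_def)
  have y_eq: "y = cis \<eta>"
    using y cis_Arg[of y] cis_mult[of "Arg y" "2 * pi"] by (force simp: \<eta>_def sgn_eq)
  let ?P = "\<lambda>x. 1 - 2 * a\<^sup>2 < cos (\<eta> - x / N)"
  have Re: "Re (cnj (cis (x / N)) * y) = cos (\<eta> - x / N)" for x
    unfolding y_eq cis_cnj cis_mult by simp
  have per: "?P (x + R) = ?P x" for x
  proof -
    have "\<eta> - (x + R) / N = (\<eta> - x / N) - 2 * pi" using N by (simp add: R_def field_simps)
    then have "cos (\<eta> - (x + R) / N) = cos (\<eta> - x / N)"
      by (simp only:) (subst cos_diff, simp)
    then show ?thesis by simp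
  qed
  define b where "b = N * \<eta> - pi * N"
  have "N * \<eta> \<le> N * (3 * pi)" "N * pi \<le> N * \<eta>" using \<eta> N by (intro mult_left_mono; simp)+
  then have b: "0 \<le> b" "b \<le> R" by (auto simp: b_def R_def algebra_simps)
  have "{N * \<eta> - 2 * a * N<..<N * \<eta> + 2 * a * N} \<subseteq> {x\<in>{b..<b + R}. ?P x}"
  proof
    fix x assume x: "x \<in> {N * \<eta> - 2 * a * N<..<N * \<eta> + 2 * a * N}"
    have "2 * a * N \<le> pi * N" using a pi_ge_two N by (intro mult_right_mono) auto
    moreover have "\<bar>\<eta> - x / N\<bar> < 2 * a"
      using x N by (auto simp: abs_less_iff field_simps)
    ultimately show "x \<in> {x\<in>{b..<b + R}. ?P x}"
      using x cos_greater_quadratic[of "\<eta> - x / N" a] by (auto simp: b_def R_def algebra_simps)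
  qed
  then have "emeasure lborel {N * \<eta> - 2 * a * N<..<N * \<eta> + 2 * a * N} \<le> emeasure lborel {x\<in>{b..<b + R}. ?P x}"
    by (rule emeasure_mono) simp
  also have "\<dots> = emeasure lborel {x\<in>{0..<R}. ?P x}"
    by (rule emeasure_lborel_periodic[where P = ?P, OF per b]) simp
  finally have ge: "ennreal (4 * a * N) \<le> emeasure lborel {x\<in>{0..<R}. ?P x}"
    using a N by (simp add: algebra_simps)
  have "{0..<R} - {x\<in>{0..<R}. ?P x} = {0..<R} \<inter> {x. Re (cnj (cis (x / N)) * y) \<le> 1 - 2 * a\<^sup>2}"
    unfolding Re by auto
  moreover have "emeasure lborel ({0..<R} - {x\<in>{0..<R}. ?P x}) = emeasure lborel {0..<R} - emeasure lborel {x\<in>{0..<R}. ?P x}"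
  proof (rule emeasure_Diff)
    have "emeasure lborel {x\<in>{0..<R}. ?P x} \<le> emeasure lborel {0..<R}" by (intro emeasure_mono) auto
    then show "emeasure lborel {x\<in>{0..<R}. ?P x} \<noteq> \<infinity>" using R by (auto simp: top_unique)
  qed auto
  moreover have "\<dots> \<le> ennreal R - ennreal (4 * a * N)"
  proof -
    have "emeasure lborel {0..<R} = ennreal R" using R by simp
    then show ?thesis using ge by (simp only:) (rule ennreal_mono_minus)
  qed
  moreover have "ennreal R - ennreal (4 * a * N) = ennreal (R - 4 * a * N)"
    using a N by (intro ennreal_minus) auto
  ultimately have "emeasure lborel ({0..<R} \<inter> {x. Re (cnj (cis (x / N)) * y) \<le> 1 - 2 * a\<^sup>2}) \<le> ennreal (R - 4 * a * N)"
    by simp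
  then have "emeasure (unif R) {x. Re (cnj (cis (x / N)) * y) \<le> 1 - 2 * a\<^sup>2} \<le> ennreal (R - 4 * a * N) / emeasure lborel {0..<R}"
    unfolding Re by (subst emeasure_uniform_measure) (auto intro: divide_right_mono_ennreal)
  also have "\<dots> = ennreal ((R - 4 * a * N) / R)"
  proof -
    have "4 * a * N \<le> 2 * pi * N" using a pi_ge_two N by (intro mult_right_mono) auto
    then show ?thesis using R by (simp add: divide_ennreal R_def)
  qed
  also have "(R - 4 * a * N) / R = 1 - 2 * a / pi" using N by (simp add: R_def field_simps)
  finally show ?thesis by (simp add: R_def)
qed

lemma borel_measurable_csqrt [measurable]: "csqrt \<in> borel_measurable borel"
  unfolding borel_measurable_complex_iff by simp

lemma borel_measurable_disc_slit_map [measurable]: "disc_slit_map c \<in> borel_measurable borel"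
  unfolding disc_slit_map_def[abs_def] slit_root_def[abs_def] by measurable

lemma borel_measurable_cis [measurable]: "cis \<in> borel_measurable borel"
  unfolding borel_measurable_complex_iff by simp

lemma borel_measurable_disc_comp:
  assumes e [measurable]: "\<And>j. j < n \<Longrightarrow> (\<lambda>w. e w j) \<in> borel_measurable M" and y: "y \<in> borel_measurable M"
  shows "(\<lambda>w. disc_comp c (e w) n (y w)) \<in> borel_measurable M"
  using assms
proof (induction n arbitrary: y)
  case (Suc n)
  have [measurable]: "(\<lambda>w. e w n) \<in> borel_measurable M" "y \<in> borel_measurable M" using Suc.prems by auto
  have [measurable]: "cnj \<in> borel_measurable borel"
    by (intro borel_measurable_continuous_onI continuous_intros)
  have "(\<lambda>w. disc_comp c (e w) n (e w n * disc_slit_map c (cnj (e w n) * y w))) \<in> borel_measurable M"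
    by (rule Suc.IH) (use Suc.prems in auto)
  then show ?case by simp
qed simp

lemma disc_comp_cong: "(\<And>j. j < n \<Longrightarrow> e j = e' j) \<Longrightarrow> disc_comp c e n = disc_comp c e' n"
  by (induction n) auto

section \<open>Following a point of the circle through independent uniform centres\<close>

context disc_slit
begin

text \<open>The map with the newest centre acts first. If the real part exceeds c, the point moves
  into a slit inside the disc, and the remaining maps never bring it back; otherwise it stays on the
  circle and faces n maps.\<close>

lemma disc_comp_on_circle_Suc:
  assumes e: "\<And>n. norm (e n) = 1" and y: "norm y = 1"
  shows "norm (disc_comp c e (Suc n) y) = 1 \<longleftrightarrow>
     Re (cnj (e n) * y) \<le> c \<and> norm (disc_comp c e n (rot (e n) y)) = 1"
    and "Re (cnj (e n) * y) \<le> c \<Longrightarrow> norm (rot (e n) y) = 1"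
proof -
  have n1: "norm (cnj (e n) * y) = 1" using e y by (simp add: norm_mult)
  have ball: "disc_comp c e n v \<in> ball 0 1 - {0}" if "v \<in> (\<lambda>v. e n * v) ` slit" for v
    using U_ball[OF e] eslit_subset[OF e] that by (meson subsetD)
  have "norm (disc_comp c e n (rot (e n) y)) \<noteq> 1" if "\<not> Re (cnj (e n) * y) \<le> c"
  proof -
    have "V (cnj (e n) * y) \<in> slit" using V_circle_slit[OF n1] that by simp
    from ball[OF imageI[OF this]] show ?thesis by simp
  qed
  then show "norm (disc_comp c e (Suc n) y) = 1 \<longleftrightarrow>
     Re (cnj (e n) * y) \<le> c \<and> norm (disc_comp c e n (rot (e n) y)) = 1"
    by auto
  show "Re (cnj (e n) * y) \<le> c \<Longrightarrow> norm (rot (e n) y) = 1"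
    using norm_V_circle[OF n1] e by (simp add: norm_mult)
qed

end

lemma borel_measurable_cis_component:
  assumes "j < n"
  shows "(\<lambda>x. cis (x j / N)) \<in> borel_measurable (PiM {..<n} (\<lambda>_. unif R))"
proof -
  have [measurable]: "(\<lambda>x. x j) \<in> borel_measurable (PiM {..<n} (\<lambda>_. unif R))"
    using assms measurable_component_singleton[of j "{..<n}" "\<lambda>_. unif R"] by (simp cong: measurable_cong_sets)
  show ?thesis by measurable
qed

text \<open>The induction generalises over y: given the centre that acts first, survival is the same
  event for n maps at another point of the circle, and the bound does not depend on which
  point.\<close>

lemma emeasure_PiM_unif_on_circle:
  assumes N: "N > 0" and a: "0 < a" "a < 1" and y: "norm y = 1"
  defines "R \<equiv> 2 * pi * N"
  shows "emeasure (PiM {..<n} (\<lambda>_. unif R))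
       {x \<in> space (PiM {..<n} (\<lambda>_. unif R)). norm (disc_comp (1 - 2 * a\<^sup>2) (\<lambda>j. cis (x j / N)) n y) = 1}
     \<le> ennreal ((1 - 2 * a / pi) ^ n)"
  using y
proof (induction n arbitrary: y)
  case 0
  then show ?case by (simp add: PiM_empty)
next
  case (Suc n)
  define c where "c = 1 - 2 * a\<^sup>2"
  have "0 < a\<^sup>2" "a\<^sup>2 < 1" using a by (auto simp: power_less_one_iff)
  then interpret disc_slit c by unfold_locales (auto simp: c_def)
  have R: "R > 0" using N by (simp add: R_def)
  interpret u: prob_space "unif R" using R by (rule prob_space_unif)
  interpret product_sigma_finite "\<lambda>_::nat. unif R" by unfold_locales
  define q where "q = 1 - 2 * a / pi"
  have q: "0 \<le> q" using a pi_ge_two by (auto simp: q_def field_simps)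
  define S where "S n y = {x \<in> space (PiM {..<n} (\<lambda>_. unif R)). norm (disc_comp c (\<lambda>j. cis (x j / N)) n y) = 1}"
    for n y
  have S [measurable]: "S n y \<in> sets (PiM {..<n} (\<lambda>_. unif R))" for n y
  proof -
    have "(\<lambda>x. disc_comp c (\<lambda>j. cis (x j / N)) n y) \<in> borel_measurable (PiM {..<n} (\<lambda>_. unif R))"
    proof (rule borel_measurable_disc_comp)
    qed (simp_all add: borel_measurable_cis_component)
    then show ?thesis unfolding S_def by measurable
  qed
  let ?A = "{t. Re (cnj (cis (t / N)) * y) \<le> c}"
  \<comment> \<open>t is the centre of the map acting first, which is coordinate n; the other
    coordinates are integrated out before it.\<close>
  have inner: "(\<integral>\<^sup>+ x. indicator (S (Suc n) y) (x(n := t)) \<partial>PiM {..<n} (\<lambda>_. unif R)) \<le> ennreal (q ^ n) * indicator ?A t" for t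
  proof -
    have *: "disc_comp c (\<lambda>j. cis ((x(n := t)) j / N)) n = disc_comp c (\<lambda>j. cis (x j / N)) n" for x
      by (rule disc_comp_cong) simp
    have "indicator (S (Suc n) y) (x(n := t)) = (indicator ?A t * indicator (S n (rot (cis (t / N)) y)) x :: ennreal)"
      if "x \<in> space (PiM {..<n} (\<lambda>_. unif R))" for x
    proof -
      have "x(n := t) \<in> space (PiM {..<Suc n} (\<lambda>_. unif R))"
        using that by (auto simp: space_PiM PiE_iff extensional_def)
      then show ?thesis
        using disc_comp_on_circle_Suc(1)[of "\<lambda>j. cis ((x(n := t)) j / N)" y n] Suc.prems that
        unfolding * by (auto simp: S_def indicator_def simp del: disc_comp.simps)
    qed
    then have "(\<integral>\<^sup>+ x. indicator (S (Suc n) y) (x(n := t)) \<partial>PiM {..<n} (\<lambda>_. unif R)) =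
      (\<integral>\<^sup>+ x. indicator ?A t * indicator (S n (rot (cis (t / N)) y)) x \<partial>PiM {..<n} (\<lambda>_. unif R))"
      by (rule nn_integral_cong)
    also have "\<dots> = indicator ?A t * emeasure (PiM {..<n} (\<lambda>_. unif R)) (S n (rot (cis (t / N)) y))"
      by (simp add: nn_integral_cmult_indicator)
    also have "\<dots> \<le> indicator ?A t * ennreal (q ^ n)"
    proof (cases "t \<in> ?A")
      case True
      then have "norm (rot (cis (t / N)) y) = 1"
        using disc_comp_on_circle_Suc(2)[of "\<lambda>_. cis (t / N)" y] Suc.prems by simp
      then show ?thesis using Suc.IH unfolding S_def c_def q_def by (intro mult_left_mono) auto
    qed simp
    finally show ?thesis by (simp add: mult.commute)
  qed
  have "emeasure (PiM {..<Suc n} (\<lambda>_. unif R)) (S (Suc n) y) = (\<integral>\<^sup>+ x. indicator (S (Suc n) y) x \<partial>PiM {..<Suc n} (\<lambda>_. unif R))"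
    by simp
  also have "\<dots> = (\<integral>\<^sup>+ t. (\<integral>\<^sup>+ x. indicator (S (Suc n) y) (x(n := t)) \<partial>PiM {..<n} (\<lambda>_. unif R)) \<partial>unif R)"
    unfolding lessThan_Suc by (rule product_nn_integral_insert_rev) (auto simp: lessThan_Suc[symmetric])
  also have "\<dots> \<le> (\<integral>\<^sup>+ t. ennreal (q ^ n) * indicator ?A t \<partial>unif R)"
    by (rule nn_integral_mono) (rule inner)
  also have "\<dots> = ennreal (q ^ n) * emeasure (unif R) ?A"
  proof -
    have [measurable]: "cnj \<in> borel_measurable borel"
      by (intro borel_measurable_continuous_onI continuous_intros)
    have "?A \<in> sets borel" by measurable
    then show ?thesis by (simp add: nn_integral_cmult_indicator)
  qed
  also have "\<dots> \<le> ennreal (q ^ n) * ennreal q"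
    using emeasure_unif_Re_le[OF N a Suc.prems] unfolding c_def q_def R_def by (rule mult_left_mono) simp
  also have "\<dots> = ennreal (q ^ Suc n)" using q by (simp add: ennreal_mult[symmetric] mult.commute)
  finally show ?case by (simp add: S_def c_def q_def)
qed

lemma sets_birth:
  "{x \<in> space (PiM {..<Suc n} (\<lambda>_. unif R)). norm (disc_comp c (\<lambda>j. cis (x j / N)) n (cis (x n / N))) = 1}
     \<in> sets (PiM {..<Suc n} (\<lambda>_. unif R))"
proof -
  have "(\<lambda>x. disc_comp c (\<lambda>j. cis (x j / N)) n (cis (x n / N))) \<in> borel_measurable (PiM {..<Suc n} (\<lambda>_. unif R))"
    by (rule borel_measurable_disc_comp) (simp_all add: borel_measurable_cis_component)
  then show ?thesis by measurable
qed

text \<open>Coordinate n is now the starting point and the earlier ones are centres. The survival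
  bound holds for each fixed starting point, so it is kept by averaging over it.\<close>

lemma emeasure_PiM_unif_birth:
  assumes N: "N > 0" and a: "0 < a" "a < 1"
  defines "R \<equiv> 2 * pi * N"
  shows "emeasure (PiM {..<Suc n} (\<lambda>_. unif R))
       {x \<in> space (PiM {..<Suc n} (\<lambda>_. unif R)).
          norm (disc_comp (1 - 2 * a\<^sup>2) (\<lambda>j. cis (x j / N)) n (cis (x n / N))) = 1}
     \<le> ennreal ((1 - 2 * a / pi) ^ n)"
proof -
  define c where "c = 1 - 2 * a\<^sup>2"
  have R: "R > 0" using N by (simp add: R_def)
  interpret u: prob_space "unif R" using R by (rule prob_space_unif)
  interpret product_sigma_finite "\<lambda>_::nat. unif R" by unfold_locales
  let ?S = "{x \<in> space (PiM {..<Suc n} (\<lambda>_. unif R)). norm (disc_comp c (\<lambda>j. cis (x j / N)) n (cis (x n / N))) = 1}"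
  have S: "?S \<in> sets (PiM {..<Suc n} (\<lambda>_. unif R))" by (rule sets_birth)
  have "emeasure (PiM {..<Suc n} (\<lambda>_. unif R)) ?S = (\<integral>\<^sup>+ x. indicator ?S x \<partial>PiM {..<Suc n} (\<lambda>_. unif R))"
    using S by (simp only: nn_integral_indicator)
  also have "\<dots> = (\<integral>\<^sup>+ t. (\<integral>\<^sup>+ x. indicator ?S (x(n := t)) \<partial>PiM {..<n} (\<lambda>_. unif R)) \<partial>unif R)"
    unfolding lessThan_Suc
    by (rule product_nn_integral_insert_rev) (use S in \<open>auto simp: lessThan_Suc[symmetric]\<close>)
  also have "\<dots> \<le> (\<integral>\<^sup>+ t. ennreal ((1 - 2 * a / pi) ^ n) \<partial>unif R)"
  proof (rule nn_integral_mono)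
    fix t
    let ?T = "{x \<in> space (PiM {..<n} (\<lambda>_. unif R)). norm (disc_comp c (\<lambda>j. cis (x j / N)) n (cis (t / N))) = 1}"
    have *: "disc_comp c (\<lambda>j. cis ((x(n := t)) j / N)) n = disc_comp c (\<lambda>j. cis (x j / N)) n" for x
      by (rule disc_comp_cong) simp
    have "(\<integral>\<^sup>+ x. indicator ?S (x(n := t)) \<partial>PiM {..<n} (\<lambda>_. unif R)) = (\<integral>\<^sup>+ x. indicator ?T x \<partial>PiM {..<n} (\<lambda>_. unif R))"
    proof (rule nn_integral_cong)
      fix x assume x: "x \<in> space (PiM {..<n} (\<lambda>_. unif R))"
      then have "x(n := t) \<in> space (PiM {..<Suc n} (\<lambda>_. unif R))"
        by (auto simp: space_PiM PiE_iff extensional_def)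
      with x show "indicator ?S (x(n := t)) = (indicator ?T x :: ennreal)"
        using * by (auto simp: indicator_def)
    qed
    also have "\<dots> \<le> emeasure (PiM {..<n} (\<lambda>_. unif R)) ?T"
    proof -
      have "(\<lambda>x. disc_comp c (\<lambda>j. cis (x j / N)) n (cis (t / N))) \<in> borel_measurable (PiM {..<n} (\<lambda>_. unif R))"
        by (rule borel_measurable_disc_comp) (simp_all add: borel_measurable_cis_component)
      then show ?thesis by simp
    qed
    also have "\<dots> \<le> ennreal ((1 - 2 * a / pi) ^ n)"
      using emeasure_PiM_unif_on_circle[OF N a, of "cis (t / N)" n] by (simp add: c_def R_def)
    finally show "(\<integral>\<^sup>+ x. indicator ?S (x(n := t)) \<partial>PiM {..<n} (\<lambda>_. unif R)) \<le> ennreal ((1 - 2 * a / pi) ^ n)" .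
  qed
  also have "\<dots> = ennreal ((1 - 2 * a / pi) ^ n)" by (simp add: u.emeasure_space_1[simplified])
  finally show ?thesis by (simp add: c_def)
qed

section \<open>The cylinder in disc coordinates\<close>

definition cyl_coord :: "real \<Rightarrow> complex \<Rightarrow> complex" where
  "cyl_coord N z = exp (\<i> * z / of_real N)"

lemma norm_cyl_coord: "norm (cyl_coord N z) = exp (- Im z / N)"
  by (simp add: cyl_coord_def)

lemma cyl_coord_nonzero [simp]: "cyl_coord N z \<noteq> 0"
  by (simp add: cyl_coord_def)

lemma cyl_to_disc_conv: "cyl_to_disc N z = inverse (cyl_coord N z)"
  by (simp add: cyl_to_disc_def cyl_coord_def exp_minus)

lemma cyl_coord_add: "cyl_coord N (z + w) = cyl_coord N z * cyl_coord N w"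
  by (simp add: cyl_coord_def exp_add[symmetric] distrib_left add_divide_distrib)

lemma cyl_coord_of_real: "cyl_coord N (of_real x) = cis (x / N)"
  by (simp add: cyl_coord_def cis_conv_exp)

lemma connected_components_of_top_of_set:
  "connected_components_of (top_of_set S) = components S"
proof -
  have "connected_component_of (top_of_set S) x y \<longleftrightarrow> connected_component S x y" for x y
    by (simp add: connected_component_of_def connected_component_def connectedin_subtopology conj_ac)
  then have "connected_component_of (top_of_set S) = connected_component S" by blast
  then show ?thesis by (simp add: connected_components_of_def components_def)
qed

locale cyl_slit =
  fixes N lam :: real
  assumes N: "N > 0" and lam: "lam > 0"
begin

lemma cyl_coord_cyl_mod: "cyl_coord N (cyl_mod N z) = cyl_coord N z"
proof -
  define k where "k = \<lfloor>Re z / (2 * pi * N)\<rfloor>"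
  have "z = cyl_mod N z + of_real (2 * pi * N * of_int k)"
    using N by (simp add: complex_eq_iff cyl_mod_def rmod_def k_def)
  moreover have "cyl_coord N (of_real (2 * pi * N * of_int k)) = 1"
  proof -
    have "2 * pi * N * of_int k / N = 2 * pi * of_int k" using N by simp
    then show ?thesis unfolding cyl_coord_of_real by (simp only: cis_multiple_2pi Ints_of_int)
  qed
  ultimately show ?thesis by (metis cyl_coord_add mult.right_neutral)
qed

lemma cyl_mod_in_closed_cyl: "0 \<le> Im z \<Longrightarrow> cyl_mod N z \<in> closed_cyl N"
  using cyl_mod_image[OF N] by blast

lemma cyl_mod_id: "z \<in> closed_cyl N \<Longrightarrow> cyl_mod N z = z"
  using N by (intro complex_eqI) (auto simp: cyl_mod_def closed_cyl_def rmod_idem)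

lemma inj_cyl_coord: "inj_on (cyl_coord N) (closed_cyl N)"
proof (rule inj_onI)
  fix z w assume z: "z \<in> closed_cyl N" and w: "w \<in> closed_cyl N" and eq: "cyl_coord N z = cyl_coord N w"
  have "\<bar>Re z - Re w\<bar> < 2 * pi * N" using z w by (auto simp: closed_cyl_def)
  then have "\<bar>Re z / N - Re w / N\<bar> < 2 * pi"
    unfolding diff_divide_distrib[symmetric] using N by (simp add: abs_divide pos_divide_less_eq)
  then have "\<i> * z / of_real N = \<i> * w / of_real N"
    using eq unfolding cyl_coord_def by (rule_tac exp_complex_eqI) simp_all
  then show "z = w" using N by simp
qed

lemma cyl_coord_in_iff:
  "cyl_coord N z \<in> cball 0 1 - {0} \<longleftrightarrow> 0 \<le> Im z"
  "cyl_coord N z \<in> ball 0 1 - {0} \<longleftrightarrow> 0 < Im z"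
  "cyl_coord N z \<in> sphere 0 1 \<longleftrightarrow> Im z = 0"
  using N by (auto simp: norm_cyl_coord zero_le_divide_iff zero_less_divide_iff)

lemma cyl_coord_surj:
  assumes "v \<in> cball 0 1 - {0}"
  obtains z where "z \<in> closed_cyl N" "cyl_coord N z = v"
proof -
  define z where "z = - \<i> * of_real N * Ln v"
  have z: "cyl_coord N z = v" using assms N by (simp add: cyl_coord_def z_def)
  then have "0 \<le> Im z" using assms cyl_coord_in_iff(1)[of z] by simp
  then show ?thesis using that[OF cyl_mod_in_closed_cyl[of z]] z cyl_coord_cyl_mod[of z] by simp
qed

lemma closed_cyl_cases: 
  "z \<in> open_cyl N \<longleftrightarrow> z \<in> closed_cyl N \<and> 0 < Im z"
  "z \<in> cyl_boundary N \<longleftrightarrow> z \<in> closed_cyl N \<and> Im z = 0"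
  by (auto simp: open_cyl_def closed_cyl_def cyl_boundary_def)

lemma cyl_coord_image:
  "cyl_coord N ` closed_cyl N = cball 0 1 - {0}"
  "cyl_coord N ` open_cyl N = ball 0 1 - {0}"
  "cyl_coord N ` cyl_boundary N = sphere 0 1"
proof -
  have b: "ball 0 1 - {0} \<subseteq> cball 0 1 - {0::complex}" "sphere 0 1 \<subseteq> cball 0 1 - {0::complex}" by auto
  have *: "cyl_coord N ` {z \<in> closed_cyl N. P (Im z)} = A"
    if A1: "\<And>z. cyl_coord N z \<in> A \<longleftrightarrow> P (Im z)" and A2: "A \<subseteq> cball 0 1 - {0}" for P A
  proof (intro equalityI subsetI)
    fix v assume v: "v \<in> A"
    then obtain z where z: "z \<in> closed_cyl N" "cyl_coord N z = v" using A2 cyl_coord_surj by blast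
    with v A1[of z] show "v \<in> cyl_coord N ` {z \<in> closed_cyl N. P (Im z)}" by auto
  qed (use A1 in auto)
  have "closed_cyl N = {z \<in> closed_cyl N. 0 \<le> Im z}" by (auto simp: closed_cyl_def)
  then show "cyl_coord N ` closed_cyl N = cball 0 1 - {0}"
    using *[of "cball 0 1 - {0}" "\<lambda>y. 0 \<le> y", OF cyl_coord_in_iff(1)] by simp
  have "open_cyl N = {z \<in> closed_cyl N. 0 < Im z}" using closed_cyl_cases by auto
  then show "cyl_coord N ` open_cyl N = ball 0 1 - {0}"
    using *[of "ball 0 1 - {0}" "\<lambda>y. 0 < y", OF cyl_coord_in_iff(2) b(1)] by simp
  have "cyl_boundary N = {z \<in> closed_cyl N. Im z = 0}" using closed_cyl_cases by auto
  then show "cyl_coord N ` cyl_boundary N = sphere 0 1"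
    using *[of "sphere 0 1" "\<lambda>y. y = 0", OF cyl_coord_in_iff(3) b(2)] by simp
qed

lemma topspace_cylinder: "topspace (cylinder N) = closed_cyl N"
  using quotient_map_cyl_mod[OF N] cyl_mod_image[OF N] by (simp add: quotient_map_def)

text \<open>The exponential is a covering of the punctured plane, hence open. The half-plane is the
  full preimage of the punctured closed disc, so restricting to it commutes with taking
  images.\<close>

lemma open_map_cyl_coord: "open_map (top_of_set {z. 0 \<le> Im z}) (top_of_set (cball 0 1 - {0})) (cyl_coord N)"
  unfolding open_map_def
proof (intro allI impI)
  fix T assume "openin (top_of_set {z. 0 \<le> Im z}) T"
  then obtain W where W: "open W" "T = {z. 0 \<le> Im z} \<inter> W" by (auto simp: openin_open)
  define L where "L = (\<lambda>z::complex. (\<i> / of_real N) * z)"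
  have "open (L ` W)"
  proof -
    have "L ` W = (\<lambda>w. - \<i> * of_real N * w) -` W"
      using N by (force simp: L_def image_iff)
    then show ?thesis using W(1) by (auto intro!: open_vimage continuous_intros)
  qed
  then have "openin (top_of_set (- {0})) (exp ` L ` W)"
    by (intro covering_space_open_map[OF covering_space_exp_punctured_plane]) auto
  then have "open (exp ` L ` W)" by (rule openin_open_trans) auto
  moreover have "exp ` L ` W = cyl_coord N ` W"
    unfolding image_image L_def cyl_coord_def by simp
  ultimately have "open (cyl_coord N ` W)" by simp
  moreover have "cyl_coord N ` T = (cball 0 1 - {0}) \<inter> cyl_coord N ` W"
  proof -
    define D where "D = cball 0 1 - {0::complex}"
    have "cyl_coord N z \<in> D \<longleftrightarrow> z \<in> {z. 0 \<le> Im z}" for z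
      using cyl_coord_in_iff(1)[of z] by (simp add: D_def)
    then show ?thesis unfolding W(2) D_def[symmetric] by blast
  qed
  ultimately show "openin (top_of_set (cball 0 1 - {0})) (cyl_coord N ` T)"
    by (auto simp: openin_open)
qed

text \<open>On the half-plane the coordinate is an open continuous surjection, hence a quotient map;
  it factors through the quotient map \<open>cyl_mod N\<close>, and it is injective on
  representatives.\<close>

lemma homeomorphic_map_cyl_coord:
  "homeomorphic_map (cylinder N) (top_of_set (cball 0 1 - {0})) (cyl_coord N)"
proof -
  have comp: "cyl_coord N \<circ> cyl_mod N = cyl_coord N" using cyl_coord_cyl_mod by auto
  have cont: "continuous_map (top_of_set {z. 0 \<le> Im z}) (top_of_set (cball 0 1 - {0})) (cyl_coord N)"
  proof -
    have "continuous_on {z. 0 \<le> Im z} (cyl_coord N)"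
      unfolding cyl_coord_def[abs_def] using N by (intro continuous_intros) auto
    moreover have "cyl_coord N ` {z. 0 \<le> Im z} \<subseteq> cball 0 1 - {0}"
      by (intro image_subsetI) (simp only: cyl_coord_in_iff mem_Collect_eq)
    ultimately show ?thesis by (simp add: image_subset_iff_funcset)
  qed
  have surj: "cyl_coord N ` {z. 0 \<le> Im z} = cball 0 1 - {0}"
  proof (intro equalityI subsetI)
    fix v :: complex assume v: "v \<in> cball 0 1 - {0}"
    then obtain z where z: "cyl_coord N z = v" using cyl_coord_surj by blast
    with v cyl_coord_in_iff(1)[of z] show "v \<in> cyl_coord N ` {z. 0 \<le> Im z}" by auto
  qed (use cyl_coord_in_iff(1) in \<open>auto simp del: mem_cball\<close>)
  have "quotient_map (top_of_set {z. 0 \<le> Im z}) (top_of_set (cball 0 1 - {0})) (cyl_coord N)"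
    using cont open_map_cyl_coord surj by (intro continuous_open_imp_quotient_map) auto
  then have "quotient_map (top_of_set {z. 0 \<le> Im z}) (top_of_set (cball 0 1 - {0})) (cyl_coord N \<circ> cyl_mod N)"
    by (simp add: comp)
  then have "quotient_map (cylinder N) (top_of_set (cball 0 1 - {0})) (cyl_coord N)"
    using quotient_map_compose_eq[OF quotient_map_cyl_mod[OF N]] by blast
  then show ?thesis by (simp add: homeomorphic_map_def topspace_cylinder inj_cyl_coord)
qed

lemma Hausdorff_cylinder: "Hausdorff_space (cylinder N)"
proof -
  have "Hausdorff_space (top_of_set (cball 0 1 - {0::complex}))"
    by (rule Hausdorff_space_subtopology) (rule Hausdorff_space_euclidean)
  then show ?thesis
    using homeomorphic_Hausdorff_space[OF homeomorphic_map_imp_homeomorphic_space[OF homeomorphic_map_cyl_coord]]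
    by (rule iffD2[rotated])
qed

text \<open>Serves the uniqueness of the limit that defines boundary values: shifting z slightly
  upwards shows that the open cylinder accumulates there.\<close>

lemma nontrivial_atin_open_cyl:
  assumes z: "z \<in> closed_cyl N"
  shows "atin_within (cylinder N) z (open_cyl N) \<noteq> bot"
proof
  assume "atin_within (cylinder N) z (open_cyl N) = bot"
  then have "eventually (\<lambda>_. False) (atin_within (cylinder N) z (open_cyl N))"
    by (simp only: eventually_bot)
  then have "\<exists>T. openin (cylinder N) T \<and> z \<in> T \<and> (\<forall>x\<in>T. x \<in> open_cyl N \<and> x \<noteq> z \<longrightarrow> False)"
    using z by (simp only: eventually_atin_within topspace_cylinder simp_thms)
  then obtain T where T: "openin (cylinder N) T" "z \<in> T" "\<And>x. x \<in> T \<Longrightarrow> x \<in> open_cyl N \<Longrightarrow> x = z"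
    by blast
  then have "openin (top_of_set {z. 0 \<le> Im z}) {z \<in> {z. 0 \<le> Im z}. cyl_mod N z \<in> T}"
    by (simp add: openin_cylinder)
  then obtain W where W: "open W" "{z \<in> {z. 0 \<le> Im z}. cyl_mod N z \<in> T} = {z. 0 \<le> Im z} \<inter> W"
    unfolding openin_open by blast
  have W2: "cyl_mod N y \<in> T \<longleftrightarrow> y \<in> W" if "0 \<le> Im y" for y
    using W(2) that by blast
  have "z \<in> W" using W2[of z] T(2) cyl_mod_id[OF z] z by (simp add: closed_cyl_def)
  then obtain e where e: "e > 0" "ball z e \<subseteq> W" using W(1) open_contains_ball by blast
  define x where "x = z + \<i> * of_real (e / 2)"
  have "x \<in> W" using e by (auto simp: x_def dist_norm norm_mult)
  moreover have x: "x \<in> open_cyl N" "x \<in> closed_cyl N" using z e by (auto simp: x_def closed_cyl_def open_cyl_def)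
  ultimately have "x \<in> T" using W2[of x] cyl_mod_id[OF x(2)] by (simp add: closed_cyl_def)
  with T(3) x have "x = z" by blast
  then show False using e by (simp add: x_def)
qed

section \<open>The slit maps of the cylinder in the disc coordinate\<close>

abbreviation "\<delta> \<equiv> slit_delta N lam"
abbreviation "c \<equiv> 1 - 2 * \<delta>\<^sup>2"

lemma slit_delta_bounds: "0 < \<delta>" "\<delta> < 1"
proof -
  have "exp (lam / N) > 1" using lam N by simp
  moreover from this have "2 / (exp (lam / N) + 1) < 1" "2 / (exp (lam / N) + 1) > 0"
  proof -
    assume *: "exp (lam / N) > 1"
    then have "exp (lam / N) + 1 > 0" by linarith
    with * show "2 / (exp (lam / N) + 1) < 1" "2 / (exp (lam / N) + 1) > 0"
      by (simp_all add: pos_divide_less_eq)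
  qed
  ultimately show "0 < \<delta>" "\<delta> < 1" unfolding slit_delta_def by linarith+
qed

sublocale disc_slit "1 - 2 * (slit_delta N lam)\<^sup>2"
proof
  have "0 < \<delta>\<^sup>2" "\<delta>\<^sup>2 < 1" using slit_delta_bounds by (auto simp: power_less_one_iff)
  then show "-1 < c" "c < 1" by auto
qed

text \<open>The chain of conformal maps is followed step by step: 1 / v in the exterior disc, i (1 -
  v) / (1 + v) in the half-plane, i h after the half-plane slit map, and finally 1 / V v.\<close>

lemma open_slit_map:
  assumes z: "z \<in> open_cyl N"
  shows "open_slit_map N lam z \<in> open_cyl N" "cyl_coord N (open_slit_map N lam z) = V (cyl_coord N z)"
proof -
  define v where "v = cyl_coord N z"
  have "v \<in> ball 0 1 - {0}" using z cyl_coord_image(2) by (simp add: v_def set_eq_iff image_iff) metis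
  then have v: "norm v < 1" "v \<noteq> 0" by auto
  then have v1: "1 + v \<noteq> 0" by (auto simp: add_eq_0_iff)
  define h where "h = q v / (1 + v)"
  have Re_h: "0 < Re h" using Re_q_pos[OF v(1)] by (simp add: h_def)
  have h1: "1 + h \<noteq> 0" using Re_h by (auto simp: complex_eq_iff)
  have V: "V v = (1 - h) / (1 + h)" using V_via_h[OF v(1)] by (simp add: h_def)
  have V0: "V v \<noteq> 0" using V_0_iff v by blast
  \<comment> \<open>This keeps i h away from i, the one point of the half-plane missed by
    \<open>disc_to_half\<close>.\<close>
  then have h2: "1 - h \<noteq> 0" using V by auto
  have disc: "disc_to_half (inverse v) = \<i> * (1 - v) / (1 + v)"
  proof -
    have "inverse v + 1 \<noteq> 0" using v v1 by (simp add: field_simps)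
    then show ?thesis using v v1 by (simp add: disc_to_half_def divide_simps)
  qed
  have "(\<i> * (1 - v) / (1 + v))\<^sup>2 * (1 - (of_real \<delta>)\<^sup>2) - (of_real \<delta>)\<^sup>2 = - (h\<^sup>2)"
  proof -
    have "(\<i> * (1 - v) / (1 + v))\<^sup>2 = - ((1 - v)\<^sup>2 / (1 + v)\<^sup>2)"
      by (simp add: power_divide power_mult_distrib)
    moreover have "h\<^sup>2 = (1 - 2 * of_real c * v + v\<^sup>2) / (1 + v)\<^sup>2"
      by (simp add: h_def power_divide q_square)
    moreover have "- (A / B) * (1 - D) - D = - (C / B)"
      if "B \<noteq> 0" "C = A * (1 - D) + D * B" for A B C D :: complex
      unfolding that(2) using that(1) by (simp add: add_divide_distrib)
    \<comment> \<open>This identity is the reason for the value 1 - 2 \<delta>^2 of c.\<close>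
    moreover have "1 - 2 * of_real c * v + v\<^sup>2 = (1 - v)\<^sup>2 * (1 - (of_real \<delta>)\<^sup>2) + (of_real \<delta>)\<^sup>2 * (1 + v)\<^sup>2"
      by (simp add: algebra_simps power2_eq_square)
    ultimately show ?thesis using v1 by simp
  qed
  \<comment> \<open>Positivity of the real part of h makes h the principal root of h^2, which
    matches the branch of \<open>upper_sqrt\<close>.\<close>
  then have half: "half_slit \<delta> (disc_to_half (inverse v)) = \<i> * h"
    using Re_h by (simp add: disc half_slit_def upper_sqrt_def csqrt_square)
  have inj: "inj_on disc_to_half ext_disc"
  proof (rule inj_onI)
    fix x y assume *: "x \<in> ext_disc" "y \<in> ext_disc" "disc_to_half x = disc_to_half y"
    have "x \<noteq> -1" "y \<noteq> -1" using * by (auto simp: ext_disc_def)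
    then have "x + 1 \<noteq> 0" "y + 1 \<noteq> 0" by (auto simp: add_eq_0_iff2)
    then have "(x - 1) * (y + 1) = (y - 1) * (x + 1)" using * by (simp add: disc_to_half_def frac_eq_eq)
    then show "x = y" by (simp add: algebra_simps)
  qed
  have inv: "inv_into ext_disc disc_to_half (\<i> * h) = inverse (V v)"
  proof (rule inv_into_f_eq[OF inj])
    show "inverse (V v) \<in> ext_disc"
      using norm_V_less[OF v(1)] V0 by (simp add: ext_disc_def norm_inverse one_less_inverse)
    have "(1 + h) / (1 - h) - 1 = 2 * h / (1 - h)" "(1 + h) / (1 - h) + 1 = 2 / (1 - h)"
      using h2 by (simp_all add: field_simps)
    then show "disc_to_half (inverse (V v)) = \<i> * h"
      using h2 unfolding V disc_to_half_def inverse_divide by simp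
  qed
  have "V v \<in> cyl_coord N ` open_cyl N"
    unfolding cyl_coord_image(2) using norm_V_less[OF v(1)] V0 by simp
  then obtain z' where z': "z' \<in> open_cyl N" "cyl_coord N z' = V v" by auto
  have "inj_on (cyl_to_disc N) (open_cyl N)"
    using inj_cyl_coord closed_cyl_cases(1) by (auto simp: inj_on_def cyl_to_disc_conv)
  then have "inv_into (open_cyl N) (cyl_to_disc N) (inverse (V v)) = z'"
    using z' by (intro inv_into_f_eq) (auto simp: cyl_to_disc_conv)
  then have "open_slit_map N lam z = z'"
    using half inv by (simp add: open_slit_map_def cyl_to_disc_conv v_def)
  with z' show "open_slit_map N lam z \<in> open_cyl N" "cyl_coord N (open_slit_map N lam z) = V (cyl_coord N z)"
    by (simp_all add: v_def)
qed

text \<open>The disc map is continuous up to the circle, and the coordinate is a homeomorphism, so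
  the limit can be read off in the disc.\<close>

lemma limitin_open_slit_map:
  assumes z: "z \<in> closed_cyl N" and l: "l \<in> closed_cyl N" "cyl_coord N l = V (cyl_coord N z)"
  shows "limitin (cylinder N) (open_slit_map N lam) l (atin_within (cylinder N) z (open_cyl N))"
  unfolding limitin_def
proof (intro conjI allI impI)
  show "l \<in> topspace (cylinder N)" using l by (simp add: topspace_cylinder)
  fix U assume U: "openin (cylinder N) U \<and> l \<in> U"
  let ?D = "top_of_set (cball 0 1 - {0::complex})"
  have "openin ?D (cyl_coord N ` U)"
    using homeomorphic_imp_open_map[OF homeomorphic_map_cyl_coord] U by (simp add: open_map_def)
  moreover have "continuous_map (cylinder N) ?D (V \<circ> cyl_coord N)"
  proof (rule continuous_map_compose[OF homeomorphic_imp_continuous_map[OF homeomorphic_map_cyl_coord]])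
    have "continuous_on (cball 0 1 - {0}) V" using continuous_V by (rule continuous_on_subset) auto
    moreover have "V \<in> cball 0 1 - {0} \<rightarrow> cball 0 1 - {0}" using norm_V_le V_0_iff by auto
    ultimately show "continuous_map ?D ?D V" by simp
  qed
  ultimately have T: "openin (cylinder N) {x \<in> closed_cyl N. V (cyl_coord N x) \<in> cyl_coord N ` U}"
    using openin_continuous_map_preimage by (fastforce simp: topspace_cylinder)
  have "z \<in> {x \<in> closed_cyl N. V (cyl_coord N x) \<in> cyl_coord N ` U}"
    using z l U by (auto intro: rev_image_eqI)
  moreover have "open_slit_map N lam x \<in> U"
    if x: "x \<in> open_cyl N" "V (cyl_coord N x) \<in> cyl_coord N ` U" for x
  proof -
    obtain u where u: "u \<in> U" "V (cyl_coord N x) = cyl_coord N u" using x by auto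
    have "u \<in> closed_cyl N" using u U openin_subset topspace_cylinder by blast
    moreover have "open_slit_map N lam x \<in> closed_cyl N" using open_slit_map(1)[OF x(1)] closed_cyl_cases by blast
    moreover have "cyl_coord N (open_slit_map N lam x) = cyl_coord N u" using open_slit_map(2)[OF x(1)] u by simp
    ultimately show ?thesis using inj_onD[OF inj_cyl_coord] u by blast
  qed
  ultimately show "\<forall>\<^sub>F x in atin_within (cylinder N) z (open_cyl N). open_slit_map N lam x \<in> U"
    unfolding eventually_atin_within using T by blast
qed

text \<open>On the boundary the extended disc map supplies a limit, and the Hausdorff property makes
  it the one chosen by \<open>THE\<close>.\<close>

lemma slit_map:
  assumes z: "z \<in> closed_cyl N"
  shows "slit_map N lam z \<in> closed_cyl N" "cyl_coord N (slit_map N lam z) = V (cyl_coord N z)"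
proof -
  have "slit_map N lam z \<in> closed_cyl N \<and> cyl_coord N (slit_map N lam z) = V (cyl_coord N z)"
  proof (cases "0 < Im z")
    case True
    then have "z \<in> open_cyl N" using z closed_cyl_cases by blast
    with True show ?thesis using open_slit_map closed_cyl_cases by (auto simp: slit_map_def)
  next
    case False
    have "cyl_coord N z \<in> cball 0 1 - {0}" using cyl_coord_image(1) z by blast
    then have "V (cyl_coord N z) \<in> cball 0 1 - {0}" using norm_V_le V_0_iff by auto
    then obtain l where l: "l \<in> closed_cyl N" "cyl_coord N l = V (cyl_coord N z)" by (rule cyl_coord_surj)
    note lim = limitin_open_slit_map[OF z l]
    have "slit_map N lam z = (THE l. limitin (cylinder N) (open_slit_map N lam) l
        (atin_within (cylinder N) z (open_cyl N)))"
      using False by (simp only: slit_map_def if_False)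
    also have "\<dots> = l"
      by (rule the_equality, rule lim)
        (rule limitin_Hausdorff_unique[OF _ lim nontrivial_atin_open_cyl[OF z] Hausdorff_cylinder])
    finally have "slit_map N lam z = l" .
    with l show ?thesis by simp
  qed
  then show "slit_map N lam z \<in> closed_cyl N" "cyl_coord N (slit_map N lam z) = V (cyl_coord N z)" by auto
qed

lemma slit_map_at:
  assumes z: "z \<in> closed_cyl N"
  shows "slit_map_at N lam x z \<in> closed_cyl N"
    "cyl_coord N (slit_map_at N lam x z) = cis (x / N) * V (cnj (cis (x / N)) * cyl_coord N z)"
proof -
  have "0 \<le> Im (z - of_real x)" using z by (simp add: closed_cyl_def)
  note w = cyl_mod_in_closed_cyl[OF this]
  have "0 \<le> Im (of_real x + slit_map N lam (cyl_mod N (z - of_real x)))"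
    using slit_map(1)[OF w] by (simp add: closed_cyl_def)
  then show "slit_map_at N lam x z \<in> closed_cyl N"
    unfolding slit_map_at_def by (rule cyl_mod_in_closed_cyl)
  have "cyl_coord N (z - of_real x) = cyl_coord N z * cyl_coord N (of_real (- x))"
    using cyl_coord_add[of N z "of_real (- x)"] by simp
  then have "cyl_coord N (z - of_real x) = cnj (cis (x / N)) * cyl_coord N z"
    unfolding cyl_coord_of_real by (simp add: cis_cnj mult.commute)
  then show "cyl_coord N (slit_map_at N lam x z) = cis (x / N) * V (cnj (cis (x / N)) * cyl_coord N z)"
    unfolding slit_map_at_def cyl_coord_cyl_mod cyl_coord_add cyl_coord_of_real slit_map(2)[OF w] by simp
qed

lemma slit_comp:
  assumes "z \<in> closed_cyl N"
  shows "slit_comp N lam x n z \<in> closed_cyl N"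
    "cyl_coord N (slit_comp N lam x n z) = disc_comp c (\<lambda>j. cis (x j / N)) n (cyl_coord N z)"
proof -
  have "slit_comp N lam x n z \<in> closed_cyl N \<and>
    cyl_coord N (slit_comp N lam x n z) = disc_comp c (\<lambda>j. cis (x j / N)) n (cyl_coord N z)"
    using assms
  proof (induction n arbitrary: z)
    case (Suc n)
    show ?case using Suc.IH[OF slit_map_at(1)[OF Suc.prems]] slit_map_at(2)[OF Suc.prems] by simp
  qed simp
  then show "slit_comp N lam x n z \<in> closed_cyl N"
    "cyl_coord N (slit_comp N lam x n z) = disc_comp c (\<lambda>j. cis (x j / N)) n (cyl_coord N z)" by auto
qed

text \<open>The homeomorphism takes the boundary to the circle, hence the trees bijectively to the
  components of \<open>disc_trees\<close>.\<close>

lemma card_trees: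
  "card (trees N lam t x s) = card (components (disc_trees c (\<lambda>j. cis (x j / N)) (card {j. t j \<le> s})))"
proof -
  define n where "n = card {j. t j \<le> s}"
  define T where "T = slit_comp N lam x n ` cyl_boundary N - cyl_boundary N"
  have bd: "cyl_boundary N \<subseteq> closed_cyl N" using closed_cyl_cases by blast
  have im: "slit_comp N lam x n ` cyl_boundary N \<subseteq> closed_cyl N" using slit_comp(1) bd by blast
  then have T: "T \<subseteq> closed_cyl N" by (auto simp: T_def)
  have "cyl_coord N ` T = cyl_coord N ` (slit_comp N lam x n ` cyl_boundary N) - cyl_coord N ` cyl_boundary N"
    unfolding T_def by (rule inj_on_image_set_diff[OF inj_cyl_coord]) (use im bd in auto)
  also have "cyl_coord N ` (slit_comp N lam x n ` cyl_boundary N) =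
      disc_comp c (\<lambda>j. cis (x j / N)) n ` (cyl_coord N ` cyl_boundary N)"
    unfolding image_image using slit_comp(2) bd by (intro image_cong) auto
  finally have FT: "cyl_coord N ` T = disc_trees c (\<lambda>j. cis (x j / N)) n"
    by (simp add: disc_trees_def cyl_coord_image(3))
  have "cyl_coord N ` T \<subseteq> cball 0 1 - {0}" using T cyl_coord_image(1) by blast
  then have sub: "subtopology (top_of_set (cball 0 1 - {0})) (cyl_coord N ` T) = top_of_set (cyl_coord N ` T)"
    by (simp add: subtopology_subtopology Int_absorb1)
  have "homeomorphic_map (subtopology (cylinder N) T)
      (subtopology (top_of_set (cball 0 1 - {0})) (cyl_coord N ` T)) (cyl_coord N)"
    by (rule homeomorphic_map_subtopologies[OF homeomorphic_map_cyl_coord])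
      (use T \<open>cyl_coord N ` T \<subseteq> cball 0 1 - {0}\<close> in \<open>simp add: topspace_cylinder Int_absorb1 del: Int_Diff\<close>)
  then have "connected_components_of (top_of_set (cyl_coord N ` T)) =
      (image (cyl_coord N)) ` connected_components_of (subtopology (cylinder N) T)"
    unfolding sub by (rule homeomorphic_map_connected_components_of)
  then have "components (cyl_coord N ` T) =
      (image (cyl_coord N)) ` connected_components_of (subtopology (cylinder N) T)"
    by (simp only: connected_components_of_top_of_set)
  moreover have "inj_on (image (cyl_coord N)) (connected_components_of (subtopology (cylinder N) T))"
  proof (rule inj_on_subset[OF inj_on_image_Pow[OF inj_cyl_coord]])
    show "connected_components_of (subtopology (cylinder N) T) \<subseteq> Pow (closed_cyl N)"
      using connected_components_of_subset[of _ "subtopology (cylinder N) T"] T by (fastforce simp: topspace_cylinder)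
  qed
  ultimately have "card (components (cyl_coord N ` T)) = card (connected_components_of (subtopology (cylinder N) T))"
    by (simp add: card_image)
  then show ?thesis
    unfolding trees_def chl_map_def n_def[symmetric] T_def[symmetric] FT by simp
qed

lemma card_trees_less_iff:
  fixes x :: "nat \<Rightarrow> real" and n :: nat
  defines "C \<equiv> (\<lambda>k. card (components (disc_trees c (\<lambda>j. cis (x j / N)) k)))"
  shows "C n < C (Suc n) \<longleftrightarrow> norm (disc_comp c (\<lambda>j. cis (x j / N)) n (cis (x n / N))) = 1"
  unfolding C_def by (rule card_components_disc_trees_less_iff) simp

end

section \<open>Arrivals in time slots\<close>

definition slot :: "real \<Rightarrow> nat \<Rightarrow> real set" where
  "slot h k = {real k * h..<real (Suc k) * h}"

text \<open>K is the set of occupied slots, each holding a single point. The number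
  \<open>card (K \<inter> {..<k})\<close> is the rank of slot k in K, counted from 0; it stands for
  the index of the point there, so a condition on the i-th mark becomes one on counts in fixed
  rectangles.\<close>

definition slot_pattern :: "real \<Rightarrow> nat \<Rightarrow> nat set \<Rightarrow> (nat \<Rightarrow> real set) \<Rightarrow> (nat \<Rightarrow> real) \<Rightarrow> (nat \<Rightarrow> real) \<Rightarrow> bool" where
  "slot_pattern h L K E t x \<longleftrightarrow>
     (\<forall>k<L. if k \<in> K then \<exists>j. {j. t j \<in> slot h k} = {j} \<and> x j \<in> E (card (K \<inter> {..<k}))
             else {j. t j \<in> slot h k} = {})"

lemma rank_less:
  assumes "finite K" "k \<in> (K :: nat set)"
  shows "k < k' \<Longrightarrow> card (K \<inter> {..<k}) < card (K \<inter> {..<k'})" "card (K \<inter> {..<k}) < card K"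
proof -
  have "K \<inter> {..<k} \<subset> K \<inter> {..<k'}" if "k < k'"
  proof (rule psubsetI)
    show "K \<inter> {..<k} \<subseteq> K \<inter> {..<k'}" using that by auto
    have "k \<in> K \<inter> {..<k'}" "k \<notin> K \<inter> {..<k}" using assms that by simp_all
    then show "K \<inter> {..<k} \<noteq> K \<inter> {..<k'}" by blast
  qed
  then show "k < k' \<Longrightarrow> card (K \<inter> {..<k}) < card (K \<inter> {..<k'})"
    using assms(1) by (simp add: psubset_card_mono)
  have "K \<inter> {..<k} \<subset> K"
  proof (rule psubsetI)
    have "k \<in> K" "k \<notin> K \<inter> {..<k}" using assms by simp_all
    then show "K \<inter> {..<k} \<noteq> K" by blast
  qed simp
  then show "card (K \<inter> {..<k}) < card K" using assms(1) by (simp add: psubset_card_mono)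
qed

lemma slot_disjoint: "k \<noteq> k' \<Longrightarrow> h > 0 \<Longrightarrow> slot h k \<inter> slot h k' = {}"
proof (induction k k' rule: linorder_wlog)
  case (le k k')
  then have "real (Suc k) * h \<le> real k' * h" by (intro mult_right_mono) auto
  then show ?case by (auto simp: slot_def)
qed auto

lemma slot_cover:
  assumes "h > 0" "0 \<le> s" "s < real L * h"
  obtains k where "k < L" "s \<in> slot h k"
proof
  define k where "k = nat \<lfloor>s / h\<rfloor>"
  have "real k \<le> s / h" "s / h < real k + 1" using assms by (auto simp: k_def)
  then show "s \<in> slot h k" using assms by (auto simp: slot_def field_simps)
  then have "real k * h \<le> s" by (simp add: slot_def)
  then have "real k * h < real L * h" using assms(3) by (rule le_less_trans)
  then show "k < L" using assms by simp
qed

context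
  fixes t x :: "nat \<Rightarrow> real" and h :: real and L :: nat and K :: "nat set" and E
  assumes t: "strict_mono t" "\<And>j. 0 \<le> t j" and h: "h > 0" and K: "K \<subseteq> {..<L}"
    and pat: "slot_pattern h L K E t x"
begin

text \<open>An occupied slot holds one point, and every earlier point sits in an earlier occupied
  slot, so the index of the point in slot k is the rank of k in K.\<close>

lemma slot_pattern_index:
  obtains J where "\<And>k. k \<in> K \<Longrightarrow> {j. t j \<in> slot h k} = {J k}" "\<And>k. k \<in> K \<Longrightarrow> J k = card (K \<inter> {..<k})"
    "{j. t j < real L * h} = J ` K" "inj_on J K" "\<And>k. k \<in> K \<Longrightarrow> x (J k) \<in> E (J k)"
proof -
  define J where "J k = (THE j. {j. t j \<in> slot h k} = {j})" for k
  have J: "{j. t j \<in> slot h k} = {J k} \<and> x (J k) \<in> E (card (K \<inter> {..<k}))" if "k \<in> K" for k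
  proof -
    obtain j where j: "{j. t j \<in> slot h k} = {j}" "x j \<in> E (card (K \<inter> {..<k}))"
    proof -
      note \<open>k \<in> K\<close>
      have "k < L" using \<open>k \<in> K\<close> K by auto
      then have "if k \<in> K then \<exists>j. {j. t j \<in> slot h k} = {j} \<and> x j \<in> E (card (K \<inter> {..<k}))
             else {j. t j \<in> slot h k} = {}" using pat by (simp add: slot_pattern_def)
      with \<open>k \<in> K\<close> show thesis using that by (simp only: if_True) blast
    qed
    have "J k = j" unfolding J_def using j(1) by (intro the_equality) auto
    with j show ?thesis by simp
  qed
  have Jk: "t (J k) \<in> slot h k" if "k \<in> K" for k using J[OF that] by auto
  have ex: "\<exists>k\<in>K. j = J k \<and> t j \<in> slot h k" if tj: "t j < real L * h" for j
  proof -
    obtain k where k: "k < L" "t j \<in> slot h k" using slot_cover[OF h t(2) tj] .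
    moreover from k have "k \<in> K"
      using pat by (auto simp: slot_pattern_def split: if_splits)
    ultimately have "k \<in> K" by simp
    with J[OF this] k show ?thesis by auto
  qed
  have lt: "t (J k) < real L * h" if "k \<in> K" for k
  proof -
    have "real (Suc k) * h \<le> real L * h" using K that h by (intro mult_right_mono) (auto simp: Suc_le_eq)
    then show ?thesis using Jk[OF that] by (simp add: slot_def)
  qed
  have inj: "inj_on J K"
  proof (rule inj_onI)
    fix k k' assume "k \<in> K" "k' \<in> K" "J k = J k'"
    then have "t (J k) \<in> slot h k \<inter> slot h k'" using Jk by (metis IntI)
    then show "k = k'" using slot_disjoint[OF _ h] by blast
  qed
  have rank: "J k = card (K \<inter> {..<k})" if k: "k \<in> K" for k
  proof -
    have "{..<J k} = J ` (K \<inter> {..<k})"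
    proof (intro equalityI subsetI)
      fix j assume "j \<in> {..<J k}"
      then have "t j < t (J k)" using t(1) by (simp add: strict_mono_less)
      then obtain k' where k': "k' \<in> K" "j = J k'" "t j \<in> slot h k'" using ex[of j] lt[OF k] by auto
      have "\<not> k < k'"
      proof
        assume "k < k'"
        then have "real (Suc k) * h \<le> real k' * h" using h by (intro mult_right_mono) auto
        then show False using k'(3) Jk[OF k] \<open>t j < t (J k)\<close> by (simp add: slot_def)
      qed
      moreover have "k' \<noteq> k" using k'(2) \<open>t j < t (J k)\<close> by auto
      ultimately show "j \<in> J ` (K \<inter> {..<k})" using k' by auto
    next
      fix j assume "j \<in> J ` (K \<inter> {..<k})"
      then obtain k' where k': "k' \<in> K" "k' < k" "j = J k'" by auto
      have "real (Suc k') * h \<le> real k * h" using h k' by (intro mult_right_mono) auto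
      then have "t j < t (J k)" using Jk[OF k'(1)] Jk[OF k] k'(3) by (simp add: slot_def)
      then show "j \<in> {..<J k}" using t(1) by (simp add: strict_mono_less)
    qed
    then have "card {..<J k} = card (K \<inter> {..<k})"
      using inj by (metis card_image inj_on_subset inf_le1)
    then show ?thesis by simp
  qed
  show ?thesis
  proof (rule that[of J])
    show "{j. t j < real L * h} = J ` K" using ex lt by blast
    show "x (J k) \<in> E (J k)" if "k \<in> K" for k using J[OF that] rank[OF that] by simp
  qed (use J rank inj in blast)+
qed

text \<open>Ranks being indices, the pattern restricts the marks only through the first
  \<open>card K\<close> points; the third conclusion uses this to exchange the mark sets.\<close>

lemma slot_pattern_imp:
  shows "card {j. t j < real L * h} = card K" "\<And>i. i < card K \<Longrightarrow> x i \<in> E i"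
    "(\<And>i. i < card K \<Longrightarrow> x i \<in> E' i) \<Longrightarrow> slot_pattern h L K E' t x"
proof -
  obtain J where J: "\<And>k. k \<in> K \<Longrightarrow> {j. t j \<in> slot h k} = {J k}" "\<And>k. k \<in> K \<Longrightarrow> J k = card (K \<inter> {..<k})"
    "{j. t j < real L * h} = J ` K" "inj_on J K" "\<And>k. k \<in> K \<Longrightarrow> x (J k) \<in> E (J k)"
    using slot_pattern_index by blast
  show card: "card {j. t j < real L * h} = card K" using J(3,4) by (simp add: card_image)
  have fin: "finite K" using K finite_subset by blast
  have lt: "J k < card K" if "k \<in> K" for k
    unfolding J(2)[OF that] using rank_less(2)[OF fin that] .
  have "J ` K = {..<card K}"
    using lt J(4) by (intro card_subset_eq) (auto simp: card_image)
  then show "x i \<in> E i" if "i < card K" for i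
    using that J(5) by (metis imageE lessThan_iff)
  assume E': "\<And>i. i < card K \<Longrightarrow> x i \<in> E' i"
  show "slot_pattern h L K E' t x"
    unfolding slot_pattern_def
  proof (intro allI impI)
    fix k assume "k < L"
    with pat have *: "if k \<in> K then \<exists>j. {j. t j \<in> slot h k} = {j} \<and> x j \<in> E (card (K \<inter> {..<k}))
             else {j. t j \<in> slot h k} = {}" by (simp add: slot_pattern_def)
    show "if k \<in> K then \<exists>j. {j. t j \<in> slot h k} = {j} \<and> x j \<in> E' (card (K \<inter> {..<k}))
             else {j. t j \<in> slot h k} = {}"
    proof (cases "k \<in> K")
      case True
      then show ?thesis using J(1)[OF True] E'[OF lt[OF True]] J(2)[OF True] by auto
    qed (use * in simp)
  qed
qed

end

lemma slot_pattern_unique: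
  assumes "slot_pattern h L K E t x" "slot_pattern h L K' E' t x" "K \<subseteq> {..<L}" "K' \<subseteq> {..<L}"
  shows "K = K'"
proof -
  have "k \<in> K \<longleftrightarrow> {j. t j \<in> slot h k} \<noteq> {}" "k \<in> K' \<longleftrightarrow> {j. t j \<in> slot h k} \<noteq> {}" if "k < L" for k
    using assms(1,2) that unfolding slot_pattern_def by (metis insert_not_empty)+
  then show ?thesis using assms(3,4) by (metis lessThan_iff set_eqI subsetD)
qed

lemma prod_double: "(\<Prod>i<2 * L. f i) = (\<Prod>k<L. f (2 * k) * f (Suc (2 * k)) :: real)"
  by (induction L) (auto simp: mult.assoc)

lemma prod_rank:
  fixes f :: "nat \<Rightarrow> real" and K :: "nat set"
  assumes "finite K"
  shows "(\<Prod>k\<in>K. f (card (K \<inter> {..<k}))) = (\<Prod>i<card K. f i)"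
proof (rule prod.reindex_bij_betw)
  have "inj_on (\<lambda>k. card (K \<inter> {..<k})) K"
  proof (rule inj_onI)
    fix k k' assume "k \<in> K" "k' \<in> K" "card (K \<inter> {..<k}) = card (K \<inter> {..<k'})"
    then show "k = k'" using rank_less(1)[of K k k'] rank_less(1)[of K k' k] assms by (cases k k' rule: linorder_cases) auto
  qed
  moreover have "(\<lambda>k. card (K \<inter> {..<k})) ` K = {..<card K}"
    using assms calculation by (intro card_subset_eq) (auto simp: card_image rank_less)
  ultimately show "bij_betw (\<lambda>k. card (K \<inter> {..<k})) K {..<card K}" by (simp add: bij_betw_def)
qed

section \<open>The marks of a Poisson process\<close>

locale arrivals =
  fixes R :: real and M :: "'w measure" and t x :: "nat \<Rightarrow> 'w \<Rightarrow> real"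
  assumes R: "R > 0"
    and ppp: "poisson_point_process M (restrict_space lborel ({0..} \<times> {0..<R})) (\<lambda>j w. (t j w, x j w))"
    and order: "AE w in M. 0 < t 0 w \<and> strict_mono (\<lambda>j. t j w)"
begin

sublocale prob_space M
  using ppp by (simp add: poisson_point_process_def)

abbreviation "strip \<equiv> restrict_space lborel ({0..} \<times> {0..<R})"

lemma point_measurable: "(\<lambda>w. (t j w, x j w)) \<in> measurable M strip"
  using ppp by (simp add: poisson_point_process_def)

lemma point_range:
  assumes "w \<in> space M"
  shows "0 \<le> t j w" "0 \<le> x j w" "x j w < R"
  using measurable_space[OF point_measurable assms, of j] by (auto simp: space_restrict_space)

lemma measurable_points [measurable]: "t j \<in> borel_measurable M" "x j \<in> borel_measurable M"
proof -
  have "(\<lambda>w. (t j w, x j w)) \<in> measurable M lborel"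
    using point_measurable[of j] by (rule measurable_restrict_space2_iff[THEN iffD1, THEN conjunct1])
  then have *: "(\<lambda>w. (t j w, x j w)) \<in> borel_measurable M" by simp
  from measurable_compose[OF * borel_measurable_continuous_onI[OF continuous_on_fst[OF continuous_on_id]]]
  show "t j \<in> borel_measurable M" by simp
  from measurable_compose[OF * borel_measurable_continuous_onI[OF continuous_on_snd[OF continuous_on_id]]]
  show "x j \<in> borel_measurable M" by simp
qed

lemma rectangle:
  fixes I :: "real set"
  assumes "I \<in> sets borel" "I \<subseteq> {0..}" "F \<in> sets borel" "F \<subseteq> {0..<R}" "emeasure lborel I < \<infinity>"
  shows "I \<times> F \<in> sets strip" "emeasure strip (I \<times> F) < \<infinity>"
    "measure strip (I \<times> F) = measure lborel I * measure lborel F"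
proof -
  have sub: "I \<times> F \<subseteq> {0..} \<times> {0..<R}" using assms by auto
  have s: "I \<times> F \<in> sets (borel :: (real \<times> real) measure)"
    using assms by (simp add: borel_prod[symmetric])
  have d: "{0..} \<times> {0..<R} \<in> sets (borel :: (real \<times> real) measure)"
    by (simp add: borel_prod[symmetric])
  show st: "I \<times> F \<in> sets strip"
    using s d sub by (auto simp: sets_restrict_space_iff)
  have F: "emeasure lborel F < \<infinity>"
  proof -
    have "emeasure lborel F \<le> emeasure lborel {0..<R}" using assms by (intro emeasure_mono) auto
    also have "\<dots> < \<infinity>" using R by simp
    finally show ?thesis .
  qed
  have "emeasure strip (I \<times> F) = emeasure lborel (I \<times> F)"
    using s d sub by (intro emeasure_restrict_space) auto
  also have "\<dots> = emeasure lborel I * emeasure lborel F"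
    unfolding lborel_prod[symmetric] using assms by (intro lborel.emeasure_pair_measure_Times) auto
  finally have e: "emeasure strip (I \<times> F) = emeasure lborel I * emeasure lborel F" .
  then show "emeasure strip (I \<times> F) < \<infinity>" using F assms(5) by (simp add: ennreal_mult_less_top)
  show "measure strip (I \<times> F) = measure lborel I * measure lborel F"
    unfolding measure_def e by (simp add: enn2real_mult)
qed

section \<open>Counts of points in sets of finite intensity\<close>

definition points_in :: "(real \<times> real) set \<Rightarrow> 'w \<Rightarrow> nat set" where
  "points_in B w = {j. (t j w, x j w) \<in> B}"

lemma pred_points_in [measurable]: "B \<in> sets strip \<Longrightarrow> Measurable.pred M (\<lambda>w. j \<in> points_in B w)"
proof -
  assume "B \<in> sets strip"
  then have "(\<lambda>w. (t j w, x j w)) -` B \<inter> space M \<in> events"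
    by (rule measurable_sets[OF point_measurable])
  moreover have "(\<lambda>w. (t j w, x j w)) -` B \<inter> space M = {w \<in> space M. j \<in> points_in B w}"
    by (auto simp: points_in_def)
  ultimately show ?thesis by (simp add: pred_def)
qed

lemma measurable_finite_points [measurable]:
  assumes "B \<in> sets strip"
  shows "Measurable.pred M (\<lambda>w. finite (points_in B w))"
proof -
  have [measurable]: "Measurable.pred M (\<lambda>w. j \<in> points_in B w)" for j
    by (rule pred_points_in[OF assms])
  have "finite (points_in B w) \<longleftrightarrow> (\<exists>m. \<forall>j. j \<in> points_in B w \<longrightarrow> j < m)" for w
    unfolding finite_nat_set_iff_bounded by blast
  then show ?thesis by simp
qed

lemma indep_counts:
  assumes "\<And>i. i < n \<Longrightarrow> B i \<in> sets strip \<and> emeasure strip (B i) < \<infinity>" "disjoint_family_on B {..<n}"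
  shows "indep_vars (\<lambda>_. count_space UNIV) (\<lambda>i w. card (points_in (B i) w)) {..<n::nat}"
proof -
  note all = conjunct2[OF conjunct2[OF conjunct2[OF ppp[unfolded poisson_point_process_def]]]]
  from all[THEN spec, THEN spec, THEN mp, of n B] assms show ?thesis by (simp add: points_in_def)
qed

lemma measurable_card_points:
  assumes B: "B \<in> sets strip" "emeasure strip B < \<infinity>"
  shows "(\<lambda>w. card (points_in B w)) \<in> measurable M (count_space UNIV)"
proof -
  have "indep_vars (\<lambda>_. count_space UNIV) (\<lambda>i w. card (points_in B w)) {..<1::nat}"
    by (rule indep_counts) (use B in \<open>auto simp: disjoint_family_on_def\<close>)
  then show ?thesis by (simp add: indep_vars_def)
qed

lemma prob_card_points:
  assumes B: "B \<in> sets strip" "emeasure strip B < \<infinity>"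
  shows "prob {w \<in> space M. finite (points_in B w) \<and> card (points_in B w) = k} =
    measure strip B ^ k / fact k * exp (- measure strip B)"
  using ppp B by (simp add: poisson_point_process_def points_in_def)

text \<open>The probabilities of the finite counts are Poisson weights with sum 1, which leaves none
  for an infinite set. \<open>card\<close> alone would not detect such a set, being 0 there.\<close>

lemma AE_finite_points:
  assumes B: "B \<in> sets strip" "emeasure strip B < \<infinity>"
  shows "AE w in M. finite (points_in B w)"
proof -
  let ?m = "measure strip B"
  let ?S = "\<lambda>k. {w \<in> space M. finite (points_in B w) \<and> card (points_in B w) = k}"
  have S: "range ?S \<subseteq> sets M" 
    using measurable_card_points[OF B] B by auto
  have "(\<lambda>k. prob (?S k)) sums prob (\<Union>k. ?S k)"
    by (rule finite_measure_UNION[OF S]) (auto simp: disjoint_family_on_def)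
  moreover have "(\<lambda>k. exp (- ?m) * (?m ^ k / fact k)) sums (exp (- ?m) * exp ?m)"
    using exp_converges[of ?m] by (intro sums_mult) (simp add: divide_inverse mult.commute)
  then have "(\<lambda>k. prob (?S k)) sums 1"
    unfolding prob_card_points[OF B] by (simp add: exp_add[symmetric] mult.commute)
  ultimately have "prob (\<Union>k. ?S k) = 1" using sums_unique2 by blast
  moreover have "(\<Union>k. ?S k) = {w \<in> space M. finite (points_in B w)}" by auto
  ultimately have "prob {w \<in> space M. finite (points_in B w)} = 1" by simp
  then show ?thesis using B(1) by (subst (asm) prob_Collect_eq_1) auto
qed

definition good :: "'w \<Rightarrow> bool" where
  "good w \<longleftrightarrow> w \<in> space M \<and> 0 < t 0 w \<and> strict_mono (\<lambda>j. t j w) \<and> (\<forall>T. finite {j. t j w \<le> T})"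

lemma AE_good: "AE w in M. good w"
proof -
  have "AE w in M. finite {j. t j w \<le> real T}" for T
  proof -
    have r: "{0..real T} \<times> {0..<R} \<in> sets strip" "emeasure strip ({0..real T} \<times> {0..<R}) < \<infinity>"
      by (rule rectangle; simp)+
    have "AE w in M. finite (points_in ({0..real T} \<times> {0..<R}) w)"
      by (rule AE_finite_points[OF r])
    then show ?thesis
    proof (rule AE_mp[OF _ AE_I2], intro impI)
      fix w assume w: "w \<in> space M" "finite (points_in ({0..real T} \<times> {0..<R}) w)"
      have "{j. t j w \<le> real T} = points_in ({0..real T} \<times> {0..<R}) w"
        using point_range[OF w(1)] by (auto simp: points_in_def)
      with w show "finite {j. t j w \<le> real T}" by simp
    qed
  qed
  then have "AE w in M. \<forall>T::nat. finite {j. t j w \<le> real T}" by (simp add: AE_all_countable)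
  with order AE_space show ?thesis
  proof eventually_elim
    case (elim w)
    have "finite {j. t j w \<le> T}" for T
    proof -
      obtain n where "T \<le> real n" using real_arch_simple by blast
      then have "{j. t j w \<le> T} \<subseteq> {j. t j w \<le> real n}" by auto
      with elim show ?thesis using finite_subset by blast
    qed
    with elim show ?case by (simp add: good_def)
  qed
qed

lemma prob_counts:
  fixes n :: nat
  assumes B: "\<And>i. i < n \<Longrightarrow> B i \<in> sets strip" "\<And>i. i < n \<Longrightarrow> emeasure strip (B i) < \<infinity>"
    and disj: "disjoint_family_on B {..<n}" and n: "n > 0"
  shows "{w \<in> space M. \<forall>i<n. card (points_in (B i) w) = k i} \<in> events"
    "prob {w \<in> space M. \<forall>i<n. card (points_in (B i) w) = k i} =
      (\<Prod>i<n. measure strip (B i) ^ k i / fact (k i) * exp (- measure strip (B i)))"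
proof -
  let ?X = "\<lambda>i w. card (points_in (B i) w)"
  have ind: "indep_vars (\<lambda>_. count_space UNIV) ?X {..<n}"
    using B disj by (intro indep_counts) auto
  have eq: "{w \<in> space M. \<forall>i<n. card (points_in (B i) w) = k i} = (\<Inter>i\<in>{..<n}. ?X i -` {k i} \<inter> space M)"
    using n by auto
  have X: "?X i -` {k i} \<inter> space M \<in> events" if "i < n" for i
    using measurable_sets[OF measurable_card_points[OF B(1)[OF that] B(2)[OF that]], of "{k i}"] by simp
  show "{w \<in> space M. \<forall>i<n. card (points_in (B i) w) = k i} \<in> events"
    unfolding eq using X n by (intro sets.finite_INT) auto
  have "prob (\<Inter>i\<in>{..<n}. ?X i -` {k i} \<inter> space M) = (\<Prod>i<n. prob (?X i -` {k i} \<inter> space M))"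
    using n by (intro indep_varsD[OF ind]) auto
  also have "\<dots> = (\<Prod>i<n. measure strip (B i) ^ k i / fact (k i) * exp (- measure strip (B i)))"
  proof (intro prod.cong refl)
    fix i assume "i \<in> {..<n}"
    then have i: "i < n" by simp
    note Bi = B(1)[OF i] B(2)[OF i]
    \<comment> \<open>The law of a count includes finiteness of the set, the independence statement
      does not; the two events agree almost surely.\<close>
    have "prob (?X i -` {k i} \<inter> space M) = prob {w \<in> space M. finite (points_in (B i) w) \<and> card (points_in (B i) w) = k i}"
    proof (rule finite_measure_eq_AE)
      show "AE w in M. (w \<in> ?X i -` {k i} \<inter> space M) = (w \<in> {w \<in> space M. finite (points_in (B i) w) \<and> card (points_in (B i) w) = k i})"
        using AE_finite_points[OF Bi] by eventually_elim auto
      show "{w \<in> space M. finite (points_in (B i) w) \<and> card (points_in (B i) w) = k i} \<in> events"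
        using measurable_card_points[OF Bi] Bi(1) by auto
    qed (rule X[OF i])
    then show "prob (?X i -` {k i} \<inter> space M) = measure strip (B i) ^ k i / fact (k i) * exp (- measure strip (B i))"
      unfolding prob_card_points[OF Bi] .
  qed
  finally show "prob {w \<in> space M. \<forall>i<n. card (points_in (B i) w) = k i} =
      (\<Prod>i<n. measure strip (B i) ^ k i / fact (k i) * exp (- measure strip (B i)))"
    unfolding eq .
qed

end

lemma all_less_double: "(\<forall>i<2 * L. P i) \<longleftrightarrow> (\<forall>k<L. P (2 * k) \<and> P (Suc (2 * k)))"
proof (intro iffI allI impI)
  fix i assume *: "\<forall>k<L. P (2 * k) \<and> P (Suc (2 * k))" and i: "i < 2 * L"
  then have "P (2 * (i div 2))" "P (Suc (2 * (i div 2)))" by auto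
  then show "P i" by (cases "even i") (auto elim!: evenE oddE)
qed auto

context arrivals
begin

text \<open>With the empty mark set off K, the even cell is empty and the odd cell is the whole
  slot, so the same counts also express that an unoccupied slot holds no point.\<close>

definition slot_mark :: "nat set \<Rightarrow> (nat \<Rightarrow> real set) \<Rightarrow> nat \<Rightarrow> real set" where
  "slot_mark K E k = (if k \<in> K then E (card (K \<inter> {..<k})) else {})"

text \<open>
  Slot \<open>k\<close> is split into the cell \<open>2 k\<close> of the points with the prescribed mark and the cell \<open>2 k + 1\<close>
  of all other points.
\<close>

definition cell :: "real \<Rightarrow> nat set \<Rightarrow> (nat \<Rightarrow> real set) \<Rightarrow> nat \<Rightarrow> (real \<times> real) set" where
  "cell h K E i = slot h (i div 2) \<times>
     (if even i then slot_mark K E (i div 2) else {0..<R} - slot_mark K E (i div 2))"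

definition pattern_event :: "real \<Rightarrow> nat \<Rightarrow> (nat \<Rightarrow> real set) \<Rightarrow> nat set \<Rightarrow> 'w set" where
  "pattern_event h L E K =
     {w \<in> space M. \<forall>i<2 * L. card (points_in (cell h K E i) w) = of_bool (even i \<and> i div 2 \<in> K)}"

text \<open>On a good outcome every slot holds finitely many points, so a count of 0 really means an
  empty set.\<close>

lemma good_pattern_event:
  assumes w: "good w"
  shows "w \<in> pattern_event h L E K \<longleftrightarrow> slot_pattern h L K E (\<lambda>j. t j w) (\<lambda>j. x j w)"
proof -
  have sp: "w \<in> space M" using w by (simp add: good_def)
  have "card (points_in (cell h K E (2 * k)) w) = of_bool (k \<in> K) \<and> card (points_in (cell h K E (Suc (2 * k))) w) = 0 \<longleftrightarrow>
     (if k \<in> K then \<exists>j. {j. t j w \<in> slot h k} = {j} \<and> x j w \<in> E (card (K \<inter> {..<k}))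
             else {j. t j w \<in> slot h k} = {})" for k
  proof -
    define A where "A = {j. t j w \<in> slot h k}"
    define X where "X = slot_mark K E k"
    have "A \<subseteq> {j. t j w \<le> real (Suc k) * h}" by (auto simp: A_def slot_def)
    then have fin: "finite A" using w finite_subset unfolding good_def by blast
    have p1: "points_in (cell h K E (2 * k)) w = {j \<in> A. x j w \<in> X}"
      by (auto simp: points_in_def cell_def A_def X_def)
    have p2: "points_in (cell h K E (Suc (2 * k))) w = {j \<in> A. x j w \<notin> X}"
      using point_range[OF sp] by (auto simp: points_in_def cell_def A_def X_def)
    have z: "card {j \<in> A. x j w \<notin> X} = 0 \<longleftrightarrow> {j \<in> A. x j w \<notin> X} = {}" using fin by simp
    show ?thesis
    proof (cases "k \<in> K")
      case True
      have "(\<exists>j. {j \<in> A. x j w \<in> X} = {j}) \<and> {j \<in> A. x j w \<notin> X} = {} \<longleftrightarrow> (\<exists>j. A = {j} \<and> x j w \<in> X)"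
        by (safe; blast?)
      then show ?thesis using True unfolding p1 p2 z A_def[symmetric]
        by (simp add: card_1_singleton_iff X_def slot_mark_def)
    next
      case False
      then have "X = {}" by (simp add: X_def slot_mark_def)
      then show ?thesis using False fin unfolding p1 p2 A_def[symmetric] by simp
    qed
  qed
  then show ?thesis using sp unfolding pattern_event_def slot_pattern_def
    by (simp add: all_less_double)
qed

context
  fixes E :: "nat \<Rightarrow> real set" and h :: real
  assumes E: "\<And>i. E i \<in> sets borel" "\<And>i. E i \<subseteq> {0..<R}" and h: "h > 0"
begin

lemma slot_mark: "slot_mark K E k \<in> sets borel" "slot_mark K E k \<subseteq> {0..<R}"
  using E by (auto simp: slot_mark_def)

lemma slot_facts: "slot h k \<in> sets borel" "slot h k \<subseteq> {0..}" "emeasure lborel (slot h k) < \<infinity>"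
  "measure lborel (slot h k) = h"
proof -
  have "real k * h \<ge> 0" using h by simp
  then show "slot h k \<subseteq> {0..}" unfolding slot_def using order_trans by fastforce
  show "slot h k \<in> sets borel" "emeasure lborel (slot h k) < \<infinity>" "measure lborel (slot h k) = h"
    using h by (auto simp: slot_def distrib_right)
qed

lemma measure_complement_in_strip: "F \<in> sets borel \<Longrightarrow> F \<subseteq> {0..<R} \<Longrightarrow> measure lborel ({0..<R} - F) = R - measure lborel F"
  using R by (subst measure_Diff) auto

lemma cell:
  "cell h K E i \<in> sets strip" "emeasure strip (cell h K E i) < \<infinity>"
  "measure strip (cell h K E (2 * k)) = h * measure lborel (slot_mark K E k)"
  "measure strip (cell h K E (Suc (2 * k))) = h * (R - measure lborel (slot_mark K E k))"
proof -
  have "(if even i then slot_mark K E (i div 2) else {0..<R} - slot_mark K E (i div 2)) \<in> sets borel"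
    "(if even i then slot_mark K E (i div 2) else {0..<R} - slot_mark K E (i div 2)) \<subseteq> {0..<R}"
    using slot_mark by auto
  from rectangle(1,2)[OF slot_facts(1,2) this slot_facts(3)]
  show "cell h K E i \<in> sets strip" "emeasure strip (cell h K E i) < \<infinity>"
    unfolding cell_def by auto
  show "measure strip (cell h K E (2 * k)) = h * measure lborel (slot_mark K E k)"
    using rectangle(3)[OF slot_facts(1,2) slot_mark slot_facts(3)] by (simp add: cell_def slot_facts)
  have "{0..<R} - slot_mark K E k \<in> sets borel" "{0..<R} - slot_mark K E k \<subseteq> {0..<R}" using slot_mark by auto
  from rectangle(3)[OF slot_facts(1,2) this slot_facts(3)]
  show "measure strip (cell h K E (Suc (2 * k))) = h * (R - measure lborel (slot_mark K E k))"
    by (simp add: cell_def slot_facts measure_complement_in_strip slot_mark)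
qed

lemma disjoint_cells: "disjoint_family_on (cell h K E) S"
proof -
  have "cell h K E i \<inter> cell h K E i' = {}" if "i \<noteq> i'" for i i'
  proof (cases "i div 2 = i' div 2")
    case True
    then have "even i \<noteq> even i'" using that by (metis even_two_times_div_two odd_two_times_div_two_succ)
    then show ?thesis using True by (auto simp: cell_def)
  next
    case False
    then show ?thesis using slot_disjoint[OF False h] by (auto simp: cell_def)
  qed
  then show ?thesis by (auto simp: disjoint_family_on_def)
qed

text \<open>The two cells of a slot together contribute exp (- R h), and an occupied slot one
  further factor, h times the length of its mark set. Ranking turns the product over K into one over
  indices.\<close>

lemma prob_pattern_event:
  assumes K: "K \<subseteq> {..<L}" and L: "L > 0"
  shows "pattern_event h L E K \<in> events"
    "prob (pattern_event h L E K) = exp (- R * h * L) * h ^ card K * (\<Prod>i<card K. measure lborel (E i))"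
proof -
  have L2: "2 * L > 0" using L by simp
  show "pattern_event h L E K \<in> events"
    unfolding pattern_event_def by (rule prob_counts(1)[OF cell(1) cell(2) disjoint_cells L2])
  let ?m = "\<lambda>k. measure lborel (slot_mark K E k)"
  have fin: "finite K" using K finite_subset by blast
  have "prob (pattern_event h L E K) = (\<Prod>i<2 * L. measure strip (cell h K E i) ^ of_bool (even i \<and> i div 2 \<in> K) /
      fact (of_bool (even i \<and> i div 2 \<in> K)) * exp (- measure strip (cell h K E i)))"
    unfolding pattern_event_def by (rule prob_counts(2)[OF cell(1) cell(2) disjoint_cells L2])
  also have "\<dots> = (\<Prod>k<L. exp (- R * h) * (if k \<in> K then h * measure lborel (E (card (K \<inter> {..<k}))) else 1))"
    unfolding prod_double
  proof (intro prod.cong refl)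
    fix k
    have "exp (- (h * ?m k)) * exp (- (h * (R - ?m k))) = exp (- R * h)"
      by (simp add: exp_add[symmetric] algebra_simps)
    note * = this
    show "measure strip (cell h K E (2 * k)) ^ of_bool (even (2 * k) \<and> 2 * k div 2 \<in> K) /
      fact (of_bool (even (2 * k) \<and> 2 * k div 2 \<in> K)) * exp (- measure strip (cell h K E (2 * k))) *
      (measure strip (cell h K E (Suc (2 * k))) ^ of_bool (even (Suc (2 * k)) \<and> Suc (2 * k) div 2 \<in> K) /
      fact (of_bool (even (Suc (2 * k)) \<and> Suc (2 * k) div 2 \<in> K)) * exp (- measure strip (cell h K E (Suc (2 * k))))) =
      exp (- R * h) * (if k \<in> K then h * measure lborel (E (card (K \<inter> {..<k}))) else 1)"
      unfolding cell(3,4) *[symmetric] by (cases "k \<in> K") (simp_all add: slot_mark_def mult_ac)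
  qed
  also have "\<dots> = exp (- R * h) ^ L * (\<Prod>k<L. if k \<in> K then h * measure lborel (E (card (K \<inter> {..<k}))) else 1)"
    by (simp add: prod.distrib)
  also have "(\<Prod>k<L. if k \<in> K then h * measure lborel (E (card (K \<inter> {..<k}))) else 1) =
      (\<Prod>k\<in>K. h * measure lborel (E (card (K \<inter> {..<k}))))"
    using K by (intro prod.mono_neutral_cong_right) auto
  also have "\<dots> = h ^ card K * (\<Prod>k\<in>K. measure lborel (E (card (K \<inter> {..<k}))))"
    by (simp add: prod.distrib)
  also have "(\<Prod>k\<in>K. measure lborel (E (card (K \<inter> {..<k})))) = (\<Prod>i<card K. measure lborel (E i))"
    by (rule prod_rank[OF fin])
  also have "exp (- R * h) ^ L = exp (- R * h * L)" by (simp add: exp_of_nat_mult[symmetric] mult_ac)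
  finally show "prob (pattern_event h L E K) = exp (- R * h * L) * h ^ card K * (\<Prod>i<card K. measure lborel (E i))"
    by simp
qed

end


section \<open>The number of arrivals before a time, jointly with their marks\<close>

definition arrivals_before :: "real \<Rightarrow> 'w \<Rightarrow> nat" where
  "arrivals_before T w = card {j. t j w < T}"

lemma arrivals_before_eq:
  "w \<in> space M \<Longrightarrow> arrivals_before T w = card (points_in ({0..<T} \<times> {0..<R}) w)"
  using point_range[of w] unfolding arrivals_before_def points_in_def
  by (intro arg_cong[of _ _ card]) auto

lemma window:
  assumes "T > 0"
  shows "{0..<T} \<times> {0..<R} \<in> sets strip" "emeasure strip ({0..<T} \<times> {0..<R}) < \<infinity>"
    "measure strip ({0..<T} \<times> {0..<R}) = T * R"
proof -
  have "{0..<T} \<subseteq> {0..}" by auto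
  then show "{0..<T} \<times> {0..<R} \<in> sets strip" "emeasure strip ({0..<T} \<times> {0..<R}) < \<infinity>"
    "measure strip ({0..<T} \<times> {0..<R}) = T * R"
    using rectangle[of "{0..<T}" "{0..<R}"] assms R by simp_all
qed

lemma measurable_arrivals_before [measurable]:
  assumes "T > 0"
  shows "arrivals_before T \<in> measurable M (count_space UNIV)"
  using measurable_card_points[OF window(1,2)[OF assms]]
  by (subst measurable_cong[OF arrivals_before_eq])

lemma prob_arrivals_before:
  assumes T: "T > 0"
  shows "prob {w \<in> space M. arrivals_before T w = n} = exp (- R * T) * (R * T) ^ n / fact n"
proof -
  have "prob {w \<in> space M. \<forall>i<1::nat. card (points_in ({0..<T} \<times> {0..<R}) w) = n} =
      (\<Prod>i<1::nat. (T * R) ^ n / fact n * exp (- (T * R)))"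
    using prob_counts(2)[of 1 "\<lambda>_. {0..<T} \<times> {0..<R}" "\<lambda>_. n"] window[OF T]
    by (simp add: disjoint_family_on_def)
  moreover have "{w \<in> space M. \<forall>i<1::nat. card (points_in ({0..<T} \<times> {0..<R}) w) = n} = {w \<in> space M. arrivals_before T w = n}"
    using arrivals_before_eq by auto
  ultimately show ?thesis by (simp add: mult.commute)
qed

text \<open>Supplies a measurable set of full probability inside the good outcomes, which can be
  intersected with other events.\<close>

lemma good_event: "\<exists>G\<in>events. prob G = 1 \<and> (\<forall>w\<in>G. good w)"
proof -
  obtain S where S: "S \<subseteq> {w \<in> space M. good w}" "S \<in> events" "prob S = 1"
    using AE_E_prob[OF AE_good] .
  then show ?thesis by blast
qed

definition marked_event :: "real \<Rightarrow> nat \<Rightarrow> (nat \<Rightarrow> real set) \<Rightarrow> 'w set" where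
  "marked_event T n E = {w \<in> space M. arrivals_before T w = n \<and> (\<forall>i<n. x i w \<in> E i)}"

lemma marked_event_sets [measurable]:
  assumes T: "T > 0" and [measurable]: "\<And>i. E i \<in> sets borel"
  shows "marked_event T n E \<in> events"
proof -
  note [measurable] = measurable_arrivals_before[OF T]
  show ?thesis unfolding marked_event_def by measurable
qed

text \<open>
  The error in the upper bound is the probability that two of the \<open>n\<close> arrivals share a slot; it is read
  off from the same count with unrestricted marks.
\<close>

lemma marked_event_squeeze:
  fixes T :: real and L n :: nat
  assumes T: "T > 0" and E: "\<And>i. E i \<in> sets borel" "\<And>i. E i \<subseteq> {0..<R}" and L: "L > 0"
  defines "a \<equiv> real (L choose n) * (T / L) ^ n * exp (- R * T)"
  shows "a * (\<Prod>i<n. measure lborel (E i)) \<le> prob (marked_event T n E)"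
    "prob (marked_event T n E) \<le> a * (\<Prod>i<n. measure lborel (E i)) +
      (exp (- R * T) * (R * T) ^ n / fact n - a * R ^ n)"
proof -
  define h where "h = T / L"
  have h: "h > 0" using T L by (simp add: h_def)
  have hL: "real L * h = T" using L by (simp add: h_def)
  obtain G where G0: "G \<in> events" "prob G = 1" "\<forall>w\<in>G. good w" using good_event by blast
  then have G: "G \<in> events" "prob G = 1" "\<And>w. w \<in> G \<Longrightarrow> good w" by blast+
  define \<K> where "\<K> = {K. K \<subseteq> {..<L} \<and> card K = n}"
  have fin: "finite \<K>" by (rule finite_subset[of _ "Pow {..<L}"]) (auto simp: \<K>_def)
  have card: "card \<K> = L choose n" using n_subsets[of "{..<L}" n] by (simp add: \<K>_def)
  define D where "D E = (\<Union>K\<in>\<K>. pattern_event h L E K \<inter> G)" for E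
  have D: "prob (D F) = a * (\<Prod>i<n. measure lborel (F i))" "D F \<in> events"
    if F: "\<And>i. F i \<in> sets borel" "\<And>i. F i \<subseteq> {0..<R}" for F
  proof -
    note pe = prob_pattern_event[OF F h _ L]
    have ev: "pattern_event h L F K \<inter> G \<in> events" if "K \<in> \<K>" for K
      using pe(1)[of K] G that by (auto simp: \<K>_def)
    have disj: "disjoint_family_on (\<lambda>K. pattern_event h L F K \<inter> G) \<K>"
    proof -
      have "K = K'" if "K \<in> \<K>" "K' \<in> \<K>" "w \<in> pattern_event h L F K \<inter> G" "w \<in> pattern_event h L F K' \<inter> G" for K K' w
      proof -
        have g: "good w" using that G(3) by blast
        have "slot_pattern h L K F (\<lambda>j. t j w) (\<lambda>j. x j w)" "slot_pattern h L K' F (\<lambda>j. t j w) (\<lambda>j. x j w)"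
          using that good_pattern_event[OF g] by blast+
        then show ?thesis by (rule slot_pattern_unique) (use that in \<open>auto simp: \<K>_def\<close>)
      qed
      then show ?thesis unfolding disjoint_family_on_def by blast
    qed
    have "prob (D F) = (\<Sum>K\<in>\<K>. prob (pattern_event h L F K \<inter> G))"
      unfolding D_def using ev disj fin by (intro finite_measure_finite_Union) auto
    also have "\<dots> = (\<Sum>K\<in>\<K>. exp (- R * h * L) * h ^ n * (\<Prod>i<n. measure lborel (F i)))"
    proof (intro sum.cong refl)
      fix K assume K: "K \<in> \<K>"
      then have "pattern_event h L F K \<in> events" using pe(1) by (auto simp: \<K>_def)
      then have "prob (pattern_event h L F K \<inter> G) = prob (pattern_event h L F K)"
        using G(1) AE_prob_1[OF G(2)] by (intro finite_measure_eq_AE) auto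
      then show "prob (pattern_event h L F K \<inter> G) = exp (- R * h * L) * h ^ n * (\<Prod>i<n. measure lborel (F i))"
        using pe(2)[of K] K by (auto simp: \<K>_def)
    qed
    also have "\<dots> = a * (\<Prod>i<n. measure lborel (F i))"
      using L by (simp add: card a_def h_def mult_ac)
    finally show "prob (D F) = a * (\<Prod>i<n. measure lborel (F i))" .
    show "D F \<in> events" unfolding D_def using ev fin by (intro sets.finite_UN) auto
  qed
  \<comment> \<open>Unrestricted marks: up to a null set, \<open>D W\<close> is the event that
    exactly n points arrive before T, in n different slots.\<close>
  define W where "W = (\<lambda>_::nat. {0..<R})"
  have W: "\<And>i. W i \<in> sets borel" "\<And>i. W i \<subseteq> {0..<R}" by (auto simp: W_def)
  have sub: "D F \<subseteq> marked_event T n F" if F: "\<And>i. F i \<in> sets borel" "\<And>i. F i \<subseteq> {0..<R}" for F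
  proof
    fix w assume "w \<in> D F"
    then obtain K where K: "K \<subseteq> {..<L}" "card K = n" "w \<in> pattern_event h L F K" "w \<in> G" by (auto simp: D_def \<K>_def)
    have g: "good w" by (rule G(3)[OF K(4)])
    have pat: "slot_pattern h L K F (\<lambda>j. t j w) (\<lambda>j. x j w)"
      using K(3) good_pattern_event[OF g] by blast
    have w: "w \<in> space M" "strict_mono (\<lambda>j. t j w)" using g by (auto simp: good_def)
    note s = slot_pattern_imp(1,2)[OF w(2) point_range(1)[OF w(1)] h K(1) pat]
    then show "w \<in> marked_event T n F"
      using w(1) K(2) by (simp add: marked_event_def arrivals_before_def hL)
  qed
  \<comment> \<open>When the slots are distinct, the marks alone decide between \<open>D W\<close>
    and \<open>D E\<close>, so nothing but \<open>marked_event T n W - D W\<close> is lost in the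
    upper bound.\<close>
  have sub2: "marked_event T n E \<inter> D W \<subseteq> D E"
  proof
    fix w assume w: "w \<in> marked_event T n E \<inter> D W"
    then obtain K where K: "K \<subseteq> {..<L}" "card K = n" "w \<in> pattern_event h L W K" "w \<in> G" by (auto simp: D_def \<K>_def)
    have g: "good w" by (rule G(3)[OF K(4)])
    have pat: "slot_pattern h L K W (\<lambda>j. t j w) (\<lambda>j. x j w)"
      using K(3) good_pattern_event[OF g] by blast
    have w': "w \<in> space M" "strict_mono (\<lambda>j. t j w)" using g by (auto simp: good_def)
    have "slot_pattern h L K E (\<lambda>j. t j w) (\<lambda>j. x j w)"
      by (rule slot_pattern_imp(3)[OF w'(2) point_range(1)[OF w'(1)] h K(1) pat])
        (use w K(2) in \<open>auto simp: marked_event_def\<close>)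
    then have "w \<in> pattern_event h L E K" using good_pattern_event[OF g] by blast
    then show "w \<in> D E" using K by (auto simp: D_def \<K>_def)
  qed
  note ev = marked_event_sets[OF T]
  have "D E \<subseteq> marked_event T n E" by (rule sub[OF E])
  then show "a * (\<Prod>i<n. measure lborel (E i)) \<le> prob (marked_event T n E)"
    unfolding D(1)[OF E, symmetric] by (rule finite_measure_mono) (rule ev[OF E(1)])
  have "marked_event T n E \<subseteq> {w \<in> space M. arrivals_before T w = n}"
    by (auto simp: marked_event_def)
  moreover have all: "marked_event T n W = {w \<in> space M. arrivals_before T w = n}"
    using point_range by (auto simp: marked_event_def W_def)
  ultimately have "marked_event T n E \<subseteq> marked_event T n W" by (simp only:)
  with sub2 have "marked_event T n E \<subseteq> D E \<union> (marked_event T n W - D W)" by blast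
  then have "prob (marked_event T n E) \<le> prob (D E \<union> (marked_event T n W - D W))"
    using D(2)[OF E] D(2)[OF W] ev[OF W(1)] by (intro finite_measure_mono) auto
  also have "\<dots> \<le> prob (D E) + prob (marked_event T n W - D W)"
    using D(2)[OF E] D(2)[OF W] ev[OF W(1)] by (intro measure_Un_le) auto
  also have "prob (marked_event T n W - D W) = prob (marked_event T n W) - prob (D W)"
    using D(2)[OF W] ev[OF W(1)] sub[OF W] by (intro finite_measure_Diff) auto
  finally show "prob (marked_event T n E) \<le> a * (\<Prod>i<n. measure lborel (E i)) +
      (exp (- R * T) * (R * T) ^ n / fact n - a * R ^ n)"
    unfolding D(1)[OF E] D(1)[OF W] all prob_arrivals_before[OF T] using R by (simp add: W_def)
qed

text \<open>Almost all n-tuples of slots have distinct entries, and each set of n slots is counted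
  n! times among them. Writing the number of slots as n + m keeps it at least n.\<close>

lemma choose_slots_limit:
  "(\<lambda>m. real ((n + m) choose n) * (T / real (n + m)) ^ n) \<longlonglongrightarrow> T ^ n / fact n"
proof -
  have "(\<lambda>m. (real ((n + m) choose m) / real (m ^ n)) * (T ^ n * (real m / real (n + m)) ^ n)) \<longlonglongrightarrow> (1 / fact n) * (T ^ n * 1 ^ n)"
    by (intro tendsto_mult tendsto_const tendsto_power fact_binomial_limit) real_asymp
  then have "(\<lambda>m. (real ((n + m) choose m) / real (m ^ n)) * (T ^ n * (real m / real (n + m)) ^ n)) \<longlonglongrightarrow> T ^ n / fact n"
    by simp
  then show ?thesis
  proof (rule Lim_transform_eventually)
    show "\<forall>\<^sub>F m in sequentially. (real ((n + m) choose m) / real (m ^ n)) * (T ^ n * (real m / real (n + m)) ^ n) =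
        real ((n + m) choose n) * (T / real (n + m)) ^ n"
      using eventually_gt_at_top[of 0]
    proof eventually_elim
      case (elim m)
      have "(n + m) choose m = (n + m) choose n" by (metis add_diff_cancel_right' binomial_symmetric le_add2)
      with elim show ?case by (simp add: power_divide)
    qed
  qed
qed

text \<open>Both bounds have the same limit as the slots shrink, because the error tends to exp (- R
  T) ((R T)^n - T^n R^n) / n! = 0.\<close>

lemma prob_marked_event:
  assumes T: "T > 0" and E: "\<And>i. E i \<in> sets borel" "\<And>i. E i \<subseteq> {0..<R}"
  shows "prob (marked_event T n E) = exp (- R * T) * T ^ n / fact n * (\<Prod>i<n. measure lborel (E i))"
proof -
  let ?p = "\<Prod>i<n. measure lborel (E i)"
  define a where "a m = real ((n + m) choose n) * (T / real (n + m)) ^ n * exp (- R * T)" for m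
  have a: "a \<longlonglongrightarrow> T ^ n / fact n * exp (- R * T)"
    unfolding a_def[abs_def] by (intro tendsto_mult choose_slots_limit tendsto_const)
  have "T ^ n / fact n * exp (- R * T) * ?p \<le> prob (marked_event T n E)"
  proof (rule LIMSEQ_le_const2[OF tendsto_mult_right[OF a]])
    show "\<exists>N. \<forall>m\<ge>N. a m * ?p \<le> prob (marked_event T n E)"
      \<comment> \<open>Starting at m = 1 guarantees at least one slot even for n = 0.\<close>
      using marked_event_squeeze(1)[OF T E, of "n + _" n] unfolding a_def by (intro exI[of _ 1] allI impI) auto
  qed
  moreover have "prob (marked_event T n E) \<le> T ^ n / fact n * exp (- R * T) * ?p +
      (exp (- R * T) * (R * T) ^ n / fact n - T ^ n / fact n * exp (- R * T) * R ^ n)"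
  proof (rule LIMSEQ_le_const[OF tendsto_add[OF tendsto_mult_right[OF a] tendsto_diff[OF tendsto_const tendsto_mult_right[OF a]]]])
    show "\<exists>N. \<forall>m\<ge>N. prob (marked_event T n E) \<le> a m * ?p + (exp (- R * T) * (R * T) ^ n / fact n - a m * R ^ n)"
      using marked_event_squeeze(2)[OF T E, of "n + _" n] unfolding a_def by (intro exI[of _ 1] allI impI) auto
  qed
  moreover have "exp (- R * T) * (R * T) ^ n / fact n - T ^ n / fact n * exp (- R * T) * R ^ n = 0"
    by (simp add: power_mult_distrib)
  ultimately show ?thesis by (simp add: mult_ac)
qed

end

section \<open>Uniform marks, independent of having few arrivals\<close>

context arrivals
begin

lemma prob_arrivals_less:
  assumes T: "T > 0"
  shows "prob {w \<in> space M. arrivals_before T w < k} = (\<Sum>m<k. exp (- R * T) * (R * T) ^ m / fact m)"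
proof -
  note [measurable] = measurable_arrivals_before[OF T]
  have "{w \<in> space M. arrivals_before T w < k} = (\<Union>m<k. {w \<in> space M. arrivals_before T w = m})" by auto
  also have "prob \<dots> = (\<Sum>m<k. prob {w \<in> space M. arrivals_before T w = m})"
    by (intro finite_measure_finite_Union) (auto simp: disjoint_family_on_def)
  finally show ?thesis by (simp add: prob_arrivals_before[OF T])
qed

lemma prob_arrivals_less_limit: "(\<lambda>j. prob {w \<in> space M. arrivals_before (real (Suc j)) w < k}) \<longlonglongrightarrow> 0"
proof -
  have "filterlim (\<lambda>j. R * real (Suc j)) at_top sequentially"
    using R by real_asymp
  from filterlim_compose[OF tendsto_power_div_exp_0 this]
  have "(\<lambda>j. (R * real (Suc j)) ^ m / exp (R * real (Suc j)) / fact m) \<longlonglongrightarrow> 0" for m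
    by (intro tendsto_divide_zero)
  moreover have "(R * s) ^ m / exp (R * s) / fact m = exp (- R * s) * (R * s) ^ m / fact m" for s m
    by (simp add: exp_minus divide_inverse mult_ac)
  ultimately have "(\<lambda>j. \<Sum>m<k. exp (- R * real (Suc j)) * (R * real (Suc j)) ^ m / fact m) \<longlonglongrightarrow> 0"
    by (intro tendsto_null_sum) simp
  then show ?thesis by (subst prob_arrivals_less) auto
qed

lemma prob_split:
  fixes n :: nat
  assumes T: "T > 0" and B: "B \<in> events"
  shows "prob {w \<in> B. arrivals_before T w < n} + prob {w \<in> B. n \<le> arrivals_before T w} = prob B"
    "{w \<in> B. arrivals_before T w < n} \<in> events"
proof -
  note [measurable] = measurable_arrivals_before[OF T]
  have 1: "{w \<in> B. arrivals_before T w < n} = B \<inter> {w \<in> space M. arrivals_before T w < n}"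
    and 2: "{w \<in> B. n \<le> arrivals_before T w} = B \<inter> {w \<in> space M. n \<le> arrivals_before T w}"
    using sets.sets_into_space[OF B] by auto
  show ev: "{w \<in> B. arrivals_before T w < n} \<in> events" unfolding 1 using B by measurable
  have ev2: "{w \<in> B. n \<le> arrivals_before T w} \<in> events" unfolding 2 using B by measurable
  have "prob ({w \<in> B. arrivals_before T w < n} \<union> {w \<in> B. n \<le> arrivals_before T w}) =
     prob {w \<in> B. arrivals_before T w < n} + prob {w \<in> B. n \<le> arrivals_before T w}"
    by (intro finite_measure_Union ev ev2) auto
  moreover have "{w \<in> B. arrivals_before T w < n} \<union> {w \<in> B. n \<le> arrivals_before T w} = B" by auto
  ultimately show "prob {w \<in> B. arrivals_before T w < n} + prob {w \<in> B. n \<le> arrivals_before T w} = prob B" by simp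
qed

context
  fixes n :: nat and E :: "nat \<Rightarrow> real set"
  assumes E: "\<And>i. E i \<in> sets borel" "\<And>i. E i \<subseteq> {0..<R}"
begin

abbreviation "all_marked \<equiv> {w \<in> space M. \<forall>i<n. x i w \<in> E i}"
abbreviation "mark_mass \<equiv> (\<Prod>i<n. measure lborel (E i) / R)"

lemma all_marked_sets [measurable]: "all_marked \<in> events"
proof -
  note [measurable] = E(1)
  show ?thesis by measurable
qed

text \<open>For every total n + m of arrivals before T the first n marks contribute the same factor;
  countable additivity sums over m.\<close>

lemma prob_marked_ge:
  assumes T: "T > 0"
  shows "prob {w \<in> all_marked. n \<le> arrivals_before T w} = mark_mass * prob {w \<in> space M. n \<le> arrivals_before T w}"
proof -
  note [measurable] = measurable_arrivals_before[OF T] all_marked_sets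
  have eq: "prob {w \<in> all_marked. arrivals_before T w = n + m} = mark_mass * prob {w \<in> space M. arrivals_before T w = n + m}" for m
  proof -
    \<comment> \<open>The marks of the m further arrivals are left free and contribute R^m, so that
      only the normalised mass of the first n mark sets remains.\<close>
    define F where "F i = (if i < n then E i else {0..<R})" for i
    have F: "\<And>i. F i \<in> sets borel" "\<And>i. F i \<subseteq> {0..<R}" using E by (auto simp: F_def)
    have "{w \<in> all_marked. arrivals_before T w = n + m} = marked_event T (n + m) F"
      using point_range by (auto simp: marked_event_def F_def)
    then have "prob {w \<in> all_marked. arrivals_before T w = n + m} =
        exp (- R * T) * T ^ (n + m) / fact (n + m) * (\<Prod>i<n + m. measure lborel (F i))"
      by (simp only: prob_marked_event[OF T F])
    also have "(\<Prod>i<n + m. measure lborel (F i)) = (\<Prod>i<n. measure lborel (F i)) * (\<Prod>i=n..<n + m. measure lborel (F i))"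
      by (subst prod.union_disjoint[symmetric]) (auto simp: ivl_disj_un intro!: prod.cong)
    also have "(\<Prod>i=n..<n + m. measure lborel (F i)) = R ^ m" using R by (simp add: F_def)
    also have "(\<Prod>i<n. measure lborel (F i)) = (\<Prod>i<n. measure lborel (E i))" by (simp add: F_def)
    also have "\<dots> = mark_mass * R ^ n" using R by (simp add: prod_dividef)
    finally show ?thesis unfolding prob_arrivals_before[OF T]
      by (simp add: power_add power_mult_distrib mult_ac)
  qed
  have s: "(\<lambda>m. prob {w \<in> B. arrivals_before T w = n + m}) sums prob {w \<in> B. n \<le> arrivals_before T w}"
    if [measurable]: "B \<in> events" for B
  proof -
    have "{w \<in> B. arrivals_before T w = k} \<in> events" for k
    proof -
      have "{w \<in> B. arrivals_before T w = k} = B \<inter> {w \<in> space M. arrivals_before T w = k}"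
        using sets.sets_into_space[OF that] by auto
      also have "\<dots> \<in> events" by measurable
      finally show ?thesis .
    qed
    then have "(\<lambda>m. prob {w \<in> B. arrivals_before T w = n + m}) sums prob (\<Union>m. {w \<in> B. arrivals_before T w = n + m})"
      by (intro finite_measure_UNION) (auto simp: disjoint_family_on_def)
    also have "(\<Union>m. {w \<in> B. arrivals_before T w = n + m}) = {w \<in> B. n \<le> arrivals_before T w}"
      by (auto simp: le_iff_add)
    finally show ?thesis .
  qed
  have "(\<lambda>m. mark_mass * prob {w \<in> space M. arrivals_before T w = n + m}) sums (mark_mass * prob {w \<in> space M. n \<le> arrivals_before T w})"
    by (intro sums_mult s) simp
  then show ?thesis using s[OF all_marked_sets] sums_unique2 unfolding eq by blast
qed

text \<open>As T tends to infinity, fewer than n arrivals become improbable, so the factor found on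
  the complementary event is the unconditional probability.\<close>

lemma prob_marks: "prob all_marked = mark_mass"
proof -
  let ?l = "\<lambda>j. prob {w \<in> space M. arrivals_before (real (Suc j)) w < n}"
  let ?m = "\<lambda>j. prob {w \<in> all_marked. arrivals_before (real (Suc j)) w < n}"
  have eq: "prob all_marked = ?m j + mark_mass * (1 - ?l j)" for j
  proof -
    have T: "real (Suc j) > 0" by simp
    have gen: "P = a + p' * (1 - l)" if "a + b = P" "l + g = 1" "b = p' * g" for P a b l g p' :: real
    proof -
      have "g = 1 - l" using that(2) by simp
      with that show ?thesis by simp
    qed
    show ?thesis
      by (rule gen[OF prob_split(1)[OF T all_marked_sets] prob_split(1)[OF T sets.top, unfolded prob_space] prob_marked_ge[OF T]])
  qed
  have "?m \<longlonglongrightarrow> 0"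
  proof (rule tendsto_sandwich[OF _ _ tendsto_const prob_arrivals_less_limit[of n]])
    show "\<forall>\<^sub>F j in sequentially. ?m j \<le> ?l j"
      using prob_split(2)[OF _ sets.top] by (intro always_eventually allI finite_measure_mono) auto
  qed auto
  then have "(\<lambda>j. ?m j + mark_mass * (1 - ?l j)) \<longlonglongrightarrow> 0 + mark_mass * (1 - 0)"
    by (intro tendsto_intros prob_arrivals_less_limit)
  then have "(\<lambda>j. prob all_marked) \<longlonglongrightarrow> mark_mass" unfolding eq[symmetric] by simp
  then show ?thesis by (simp add: LIMSEQ_const_iff)
qed

text \<open>With few arrivals, some of the first n marks belong to points after T, which the counts
  before T do not see. The formula is therefore obtained by subtracting
  \<open>prob_marked_ge\<close> from the unconditional law.\<close>

lemma prob_marks_arrivals_less: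
  assumes T: "T > 0"
  shows "prob {w \<in> all_marked. arrivals_before T w < n} = mark_mass * prob {w \<in> space M. arrivals_before T w < n}"
proof -
  have gen: "a = P * l" if "a + b = P" "l + g = 1" "b = P * g" for P a b l g :: real
  proof -
    have "g = 1 - l" using that(2) by simp
    with that show ?thesis by (simp add: algebra_simps)
  qed
  show ?thesis
    by (rule gen[OF prob_split(1)[OF T all_marked_sets, unfolded prob_marks] prob_split(1)[OF T sets.top, unfolded prob_space]
        prob_marked_ge[OF T]])
qed

end

text \<open>Boxes determine a measure on the product space, so the conditional law of the first n
  marks given few arrivals is identified on boxes and then applied to S.\<close>

lemma law_of_marks:
  assumes T: "T > 0" and S: "S \<in> sets (PiM {..<n} (\<lambda>_. unif R))"
  shows "emeasure M {w \<in> space M. arrivals_before T w < n \<and> (\<lambda>i\<in>{..<n}. x i w) \<in> S} =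
     ennreal (prob {w \<in> space M. arrivals_before T w < n}) * emeasure (PiM {..<n} (\<lambda>_. unif R)) S"
proof -
  let ?U = "PiM {..<n} (\<lambda>_. unif R)" and ?C = "{w \<in> space M. arrivals_before T w < n}"
  let ?X = "\<lambda>w. \<lambda>i\<in>{..<n}. x i w"
  note [measurable] = measurable_arrivals_before[OF T]
  interpret u: prob_space "unif R" using R by (rule prob_space_unif)
  interpret product_sigma_finite "\<lambda>_::nat. unif R" by unfold_locales
  have C: "?C \<in> events" by measurable
  have X: "?X \<in> measurable M ?U"
    by (rule measurable_restrict) simp
  have eq: "{w \<in> space M. arrivals_before T w < n \<and> ?X w \<in> S} = ?C \<inter> (?X -` S \<inter> space M)" by auto
  have XS: "?X -` S \<inter> space M \<in> events" using X S by (rule measurable_sets)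
  show ?thesis
  proof (cases "prob ?C = 0")
    case True
    \<comment> \<open>Conditioning is not possible on a null event; this covers n = 0, where the
      event is empty.\<close>
    then have "emeasure M ?C = 0" by (simp add: emeasure_eq_measure)
    then have "emeasure M (?C \<inter> (?X -` S \<inter> space M)) = 0"
      using C XS by (metis Int_lower1 emeasure_mono le_zero_eq)
    then show ?thesis using True eq by simp
  next
    case False
    then have pos: "prob ?C > 0" by (simp add: measure_nonneg less_le)
    define Q where "Q = uniform_measure M ?C"
    have XQ: "?X \<in> measurable Q ?U" using X by (simp add: Q_def)
    have QX: "emeasure (distr Q ?U ?X) B = emeasure M (?C \<inter> (?X -` B \<inter> space M)) / emeasure M ?C"
      if B: "B \<in> sets ?U" for B
      using XQ X C B measurable_sets[OF X B] by (simp add: emeasure_distr) (simp add: Q_def)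
    have "distr Q ?U ?X = ?U"
    proof (rule PiM_eqI)
      fix F :: "nat \<Rightarrow> real set" assume F: "\<And>i. i \<in> {..<n} \<Longrightarrow> F i \<in> sets (unif R)"
      define E where "E i = (if i < n then F i \<inter> {0..<R} else {})" for i
      have E: "\<And>i. E i \<in> sets borel" "\<And>i. E i \<subseteq> {0..<R}" using F by (auto simp: E_def)
      have m: "Pi\<^sub>E {..<n} F \<in> sets ?U" using F by (intro sets_PiM_I_finite) auto
      have "?C \<inter> (?X -` Pi\<^sub>E {..<n} F \<inter> space M) = {w \<in> {w \<in> space M. \<forall>i<n. x i w \<in> E i}. arrivals_before T w < n}"
        using point_range by (auto simp: E_def PiE_iff)
      then have "emeasure M (?C \<inter> (?X -` Pi\<^sub>E {..<n} F \<inter> space M)) = ennreal ((\<Prod>i<n. measure lborel (E i) / R) * prob ?C)"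
        using prob_marks_arrivals_less[OF E T, of n] by (simp add: emeasure_eq_measure)
      then have "emeasure (distr Q ?U ?X) (Pi\<^sub>E {..<n} F) = ennreal ((\<Prod>i<n. measure lborel (E i) / R) * prob ?C) / ennreal (prob ?C)"
        unfolding QX[OF m] by (simp add: emeasure_eq_measure)
      also have "\<dots> = ennreal (\<Prod>i<n. measure lborel (E i) / R)"
        using pos R by (subst divide_ennreal) (auto intro!: prod_nonneg mult_nonneg_nonneg)
      also have "\<dots> = (\<Prod>i<n. ennreal (measure lborel (E i) / R))"
        using R by (intro prod_ennreal[symmetric]) auto
      also have "\<dots> = (\<Prod>i<n. emeasure (unif R) (F i))"
      proof (intro prod.cong refl)
        fix i assume i: "i \<in> {..<n}"
        have Ei: "E i = {0..<R} \<inter> F i" using i by (auto simp: E_def)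
        have "emeasure lborel (E i) \<le> emeasure lborel {0..<R}" using E by (intro emeasure_mono) auto
        then have "emeasure lborel (E i) \<noteq> \<infinity>" using R by (auto simp: top_unique)
        then have "emeasure lborel (E i) = ennreal (measure lborel (E i))" by (simp add: emeasure_eq_ennreal_measure)
        then show "ennreal (measure lborel (E i) / R) = emeasure (unif R) (F i)"
          using R F[OF i] by (simp add: Ei divide_ennreal)
      qed
      finally show "emeasure (distr Q ?U ?X) (Pi\<^sub>E {..<n} F) = (\<Prod>i\<in>{..<n}. emeasure (unif R) (F i))" .
    qed auto
    then have "emeasure ?U S = emeasure M (?C \<inter> (?X -` S \<inter> space M)) / emeasure M ?C"
      using QX[OF S] by simp
    moreover have "a = b * (a / b)" if "b = ennreal (prob ?C)" for a b :: ennreal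
    proof -
      have "b \<noteq> 0" "b \<noteq> \<top>" using pos that by auto
      then have "a * b / b = a" by (rule mult_divide_eq_ennreal)
      then show ?thesis by (simp only: ennreal_times_divide mult.commute[of b a])
    qed
    ultimately show ?thesis unfolding eq using emeasure_eq_measure[of ?C] by (simp only:)
  qed
qed

end

section \<open>The completion time\<close>

text \<open>Sums the probabilities of at most n arrivals, weighted by q^n. The series is the Cauchy
  product of the exponential series at y q, scaled by exp (- y), with the geometric series.\<close>

lemma poisson_geometric_sums:
  fixes y q :: real
  assumes q: "0 \<le> q" "q < 1"
  shows "(\<lambda>n. (\<Sum>m\<le>n. exp (- y) * y ^ m / fact m) * q ^ n) sums (exp (- y * (1 - q)) / (1 - q))"
proof -
  let ?a = "\<lambda>m. exp (- y) * ((y * q) ^ m / fact m)" and ?b = "\<lambda>k. q ^ k"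
  have a: "?a sums (exp (- y) * exp (y * q))"
    using exp_converges[of "y * q"] by (intro sums_mult) (simp add: divide_inverse mult.commute)
  have b: "?b sums (1 / (1 - q))" using q by (intro geometric_sums) simp
  have "summable (\<lambda>m. norm (?a m))"
  proof -
    have "summable (\<lambda>m. exp (- y) * norm ((y * q) ^ m /\<^sub>R fact m))"
      by (intro summable_mult summable_norm_exp)
    then show ?thesis by (simp add: norm_mult divide_inverse abs_mult mult_ac)
  qed
  moreover have "summable (\<lambda>k. norm (?b k))" using q by (simp add: summable_geometric)
  ultimately have "(\<lambda>n. \<Sum>i\<le>n. ?a i * ?b (n - i)) sums ((\<Sum>k. ?a k) * (\<Sum>k. ?b k))"
    by (rule Cauchy_product_sums)
  also have "(\<lambda>n. \<Sum>i\<le>n. ?a i * ?b (n - i)) = (\<lambda>n. (\<Sum>m\<le>n. exp (- y) * y ^ m / fact m) * q ^ n)"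
  proof
    fix n
    have *: "?a i * ?b (n - i) = exp (- y) * y ^ i / fact i * q ^ n" if "i \<le> n" for i
      using that by (simp add: power_mult_distrib flip: power_add)
    show "(\<Sum>i\<le>n. ?a i * ?b (n - i)) = (\<Sum>m\<le>n. exp (- y) * y ^ m / fact m) * q ^ n"
      unfolding sum_distrib_right by (intro sum.cong refl *) simp
  qed
  also have "(\<Sum>k. ?a k) * (\<Sum>k. ?b k) = exp (- y * (1 - q)) / (1 - q)"
    unfolding sums_unique[OF a, symmetric] sums_unique[OF b, symmetric]
    by (simp add: exp_add[symmetric] right_diff_distrib add.commute)
  finally show ?thesis .
qed

section \<open>Births of trees and the expected time of the last one\<close>

locale chl = cyl_slit N lam + arrivals "2 * pi * N" M t x
  for N lam :: real and M :: "'w measure" and t x :: "nat \<Rightarrow> 'w \<Rightarrow> real"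
begin

definition births :: "'w \<Rightarrow> nat set" where
  "births w = {n. norm (disc_comp c (\<lambda>j. cis (x j w / N)) n (cis (x n w / N))) = 1}"

lemma pred_births [measurable]: "Measurable.pred M (\<lambda>w. n \<in> births w)"
proof -
  have "(\<lambda>w. disc_comp c (\<lambda>j. cis (x j w / N)) n (cis (x n w / N))) \<in> borel_measurable M"
    by (rule borel_measurable_disc_comp) measurable
  then show ?thesis unfolding births_def mem_Collect_eq by measurable
qed

text \<open>Strictly increasing arrival times add one particle at a time, so the number of trees
  jumps at an arrival exactly when that particle starts a tree.\<close>

lemma good_tree_birth_times:
  assumes w: "good w"
  shows "tree_birth_times N lam (\<lambda>j. t j w) (\<lambda>j. x j w) = (\<lambda>n. t n w) ` births w"
proof -
  have sm: "strict_mono (\<lambda>j. t j w)" and fin: "\<And>T. finite {j. t j w \<le> T}" and pos: "0 < t 0 w"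
    using w by (auto simp: good_def)
  have tpos: "0 < t n w" for n
    using pos sm by (metis less_le_trans le0 strict_mono_less_eq)
  define C where "C k = card (components (disc_trees c (\<lambda>j. cis (x j w / N)) k))" for k
  have C: "C n < C (Suc n) \<longleftrightarrow> n \<in> births w" for n
    using card_trees_less_iff[of "\<lambda>j. x j w" n] by (simp add: C_def births_def)
  have trees: "card (trees N lam (\<lambda>j. t j w) (\<lambda>j. x j w) s) = C (card {j. t j w \<le> s})" for s
    unfolding C_def by (rule card_trees)
  \<comment> \<open>Only finitely many points lie before s, so every r close enough to s from the
    left exceeds all of them.\<close>
  have left: "\<forall>\<^sub>F r in at_left s. {j. t j w \<le> r} = {j. t j w < s}" if "0 < s" for s
  proof -
    have "finite {j. t j w < s}" by (rule finite_subset[OF _ fin[of s]]) auto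
    moreover have "\<forall>\<^sub>F r in at_left s. t j w < r" if "j \<in> {j. t j w < s}" for j
      using that eventually_at_left_real[of "t j w" s] by (auto elim: eventually_mono)
    ultimately have "\<forall>\<^sub>F r in at_left s. \<forall>j\<in>{j. t j w < s}. t j w < r"
      by (intro eventually_ball_finite) auto
    moreover have "\<forall>\<^sub>F r in at_left s. r < s"
      using eventually_at_left_real[of 0 s] that by (auto elim: eventually_mono)
    ultimately show ?thesis by eventually_elim force
  qed
  have iff: "s \<in> tree_birth_times N lam (\<lambda>j. t j w) (\<lambda>j. x j w) \<longleftrightarrow>
      0 < s \<and> C (card {j. t j w < s}) < C (card {j. t j w \<le> s})" for s
  proof (cases "0 < s")
    case True
    have "(\<forall>\<^sub>F r in at_left s. C (card {j. t j w \<le> r}) < C (card {j. t j w \<le> s})) \<longleftrightarrow>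
      (\<forall>\<^sub>F r in at_left s. C (card {j. t j w < s}) < C (card {j. t j w \<le> s}))"
    proof (rule eventually_subst)
      show "\<forall>\<^sub>F r in at_left s. (C (card {j. t j w \<le> r}) < C (card {j. t j w \<le> s})) =
          (C (card {j. t j w < s}) < C (card {j. t j w \<le> s}))"
        using left[OF True] by eventually_elim simp
    qed
    then show ?thesis using True by (simp add: tree_birth_times_def trees)
  qed (simp add: tree_birth_times_def)
  show ?thesis
  proof (intro equalityI subsetI)
    fix s assume s: "s \<in> tree_birth_times N lam (\<lambda>j. t j w) (\<lambda>j. x j w)"
    then have ne: "{j. t j w < s} \<noteq> {j. t j w \<le> s}" using iff by auto
    have "\<exists>n. t n w = s"
    proof (rule ccontr)
      assume "\<nexists>n. t n w = s"
      then have "t n w < s \<longleftrightarrow> t n w \<le> s" for n by (auto simp: less_le)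
      with ne show False by simp
    qed
    then obtain n where n: "s = t n w" by blast
    have "{j. t j w < s} = {..<n}" "{j. t j w \<le> s} = {..n}"
      unfolding n by (auto simp: strict_mono_less[OF sm] strict_mono_less_eq[OF sm])
    then show "s \<in> (\<lambda>n. t n w) ` births w" using s iff C n by auto
  next
    fix s assume "s \<in> (\<lambda>n. t n w) ` births w"
    then obtain n where n: "s = t n w" "n \<in> births w" by auto
    have "{j. t j w < s} = {..<n}" "{j. t j w \<le> s} = {..n}"
      unfolding n by (auto simp: strict_mono_less[OF sm] strict_mono_less_eq[OF sm])
    then show "s \<in> tree_birth_times N lam (\<lambda>j. t j w) (\<lambda>j. x j w)" using iff C n tpos by simp
  qed
qed

text \<open>Other particles contribute 0, the least value, so this is a countable supremum of
  measurable functions.\<close>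

definition last_birth :: "'w \<Rightarrow> ennreal" where
  "last_birth w = (SUP n. ennreal (t n w) * indicator (births w) n)"

lemma good_tree_completion_time:
  assumes "good w"
  shows "tree_completion_time N lam (\<lambda>j. t j w) (\<lambda>j. x j w) = last_birth w"
  unfolding tree_completion_time_def good_tree_birth_times[OF assms] last_birth_def
proof (rule antisym)
  show "(SUP s\<in>(\<lambda>n. t n w) ` births w. ennreal s) \<le> (SUP n. ennreal (t n w) * indicator (births w) n)"
  proof (rule SUP_least)
    fix s assume "s \<in> (\<lambda>n. t n w) ` births w"
    then obtain n where "s = t n w" "n \<in> births w" by auto
    then show "ennreal s \<le> (SUP n. ennreal (t n w) * indicator (births w) n)"
      by (intro SUP_upper2[of n]) auto
  qed
  show "(SUP n. ennreal (t n w) * indicator (births w) n) \<le> (SUP s\<in>(\<lambda>n. t n w) ` births w. ennreal s)"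
  proof (rule SUP_least)
    fix n
    show "ennreal (t n w) * indicator (births w) n \<le> (SUP s\<in>(\<lambda>n. t n w) ` births w. ennreal s)"
      by (cases "n \<in> births w") (auto intro!: SUP_upper2[of "t n w"])
  qed
qed

lemma measurable_last_birth [measurable]: "last_birth \<in> borel_measurable M"
proof -
  have "(\<lambda>w. indicator (births w) n :: ennreal) \<in> borel_measurable M" for n
    unfolding indicator_def by measurable
  then show ?thesis unfolding last_birth_def[abs_def] by measurable
qed

text \<open>If the point with index n arrives after T, at most n points arrive before T. By
  \<open>law_of_marks\<close> this is independent of the n + 1 marks that decide whether it starts a
  tree.\<close>

lemma emeasure_late_birth:
  assumes T: "T > 0"
  shows "emeasure M {w \<in> space M. T < t n w \<and> n \<in> births w} \<le>
    ennreal ((\<Sum>m\<le>n. exp (- (2 * pi * N * T)) * (2 * pi * N * T) ^ m / fact m) * (1 - 2 * \<delta> / pi) ^ n)"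
proof -
  let ?R = "2 * pi * N"
  define S where "S = {x \<in> space (PiM {..<Suc n} (\<lambda>_. unif ?R)). norm (disc_comp c (\<lambda>j. cis (x j / N)) n (cis (x n / N))) = 1}"
  have S: "S \<in> sets (PiM {..<Suc n} (\<lambda>_. unif ?R))" unfolding S_def by (rule sets_birth)
  have S': "(\<lambda>i\<in>{..<Suc n}. x i w) \<in> S \<longleftrightarrow> n \<in> births w" for w
  proof -
    have "disc_comp c (\<lambda>j. cis ((\<lambda>i\<in>{..<Suc n}. x i w) j / N)) n = disc_comp c (\<lambda>j. cis (x j w / N)) n"
      by (rule disc_comp_cong) simp
    then show ?thesis by (simp add: S_def births_def space_PiM)
  qed
  note [measurable] = measurable_arrivals_before[OF T]
  have "emeasure M {w \<in> space M. T < t n w \<and> n \<in> births w} \<le>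
    emeasure M {w \<in> space M. arrivals_before T w < Suc n \<and> n \<in> births w}"
  proof (rule emeasure_mono_AE)
    show "AE w in M. w \<in> {w \<in> space M. T < t n w \<and> n \<in> births w} \<longrightarrow>
        w \<in> {w \<in> space M. arrivals_before T w < Suc n \<and> n \<in> births w}"
      using AE_good
    proof eventually_elim
      case (elim w)
      have "arrivals_before T w < Suc n" if "T < t n w"
      proof -
        have sm: "strict_mono (\<lambda>j. t j w)" using elim by (simp add: good_def)
        have "j < n" if "t j w < T" for j
        proof -
          have "t j w < t n w" using that \<open>T < t n w\<close> by (rule less_trans)
          then show ?thesis by (simp add: strict_mono_less[OF sm])
        qed
        then have "{j. t j w < T} \<subseteq> {..<n}" by auto
        then have "card {j. t j w < T} \<le> card {..<n}" by (intro card_mono) auto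
        then show ?thesis by (simp add: arrivals_before_def)
      qed
      then show ?case by auto
    qed
  qed measurable
  also have "\<dots> = ennreal (prob {w \<in> space M. arrivals_before T w < Suc n}) * emeasure (PiM {..<Suc n} (\<lambda>_. unif ?R)) S"
    using law_of_marks[OF T S] unfolding S' .
  also have "\<dots> \<le> ennreal (prob {w \<in> space M. arrivals_before T w < Suc n}) * ennreal ((1 - 2 * \<delta> / pi) ^ n)"
    unfolding S_def using emeasure_PiM_unif_birth[OF N slit_delta_bounds] by (rule mult_left_mono) simp
  also have "\<dots> = ennreal (prob {w \<in> space M. arrivals_before T w < Suc n} * (1 - 2 * \<delta> / pi) ^ n)"
    by (simp add: ennreal_mult' measure_nonneg)
  also have "prob {w \<in> space M. arrivals_before T w < Suc n} = (\<Sum>m\<le>n. exp (- (?R * T)) * (?R * T) ^ m / fact m)"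
    using prob_arrivals_less[OF T, of "Suc n"] unfolding lessThan_Suc_atMost by simp
  finally show ?thesis .
qed


text \<open>The rate 2 \<pi> N (1 - q), as 1 - q = 2 \<delta> / \<pi>.\<close>

definition decay :: real where
  "decay = 4 * N * \<delta>"

lemma decay_pos: "0 < decay"
  using N slit_delta_bounds by (simp add: decay_def)

lemma suminf_late_birth:
  assumes T: "T > 0"
  shows "(\<Sum>n. emeasure M {w \<in> space M. T < t n w \<and> n \<in> births w}) \<le>
    ennreal (2 * pi * N / decay * exp (- decay * T))"
proof -
  define q where "q = 1 - 2 * \<delta> / pi"
  have "2 * \<delta> < pi" using slit_delta_bounds pi_ge_two by linarith
  then have q: "0 \<le> q" "q < 1" using slit_delta_bounds by (auto simp: q_def field_simps)
  let ?f = "\<lambda>n. (\<Sum>m\<le>n. exp (- (2 * pi * N * T)) * (2 * pi * N * T) ^ m / fact m) * q ^ n"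
  have sums: "?f sums (exp (- (2 * pi * N * T) * (1 - q)) / (1 - q))"
    by (rule poisson_geometric_sums[OF q])
  have nonneg: "0 \<le> ?f n" for n
    using q N T by (intro mult_nonneg_nonneg sum_nonneg) auto
  have "(\<Sum>n. emeasure M {w \<in> space M. T < t n w \<and> n \<in> births w}) \<le> (\<Sum>n. ennreal (?f n))"
    unfolding q_def by (intro suminf_le emeasure_late_birth[OF T]) auto
  also have "\<dots> = ennreal (exp (- (2 * pi * N * T) * (1 - q)) / (1 - q))"
    using suminf_ennreal_eq[OF nonneg sums] .
  also have "exp (- (2 * pi * N * T) * (1 - q)) / (1 - q) = 2 * pi * N / decay * exp (- decay * T)"
  proof -
    have "- (2 * pi * N * T) * (1 - q) = - decay * T" by (simp add: q_def decay_def)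
    moreover have "2 * pi * N / decay = 1 / (1 - q)" using N by (simp add: q_def decay_def)
    ultimately show ?thesis by simp
  qed
  finally show ?thesis .
qed

text \<open>The tail is integrated with a union bound: the excess of the supremum over T is at most
  the sum of the excesses of all births, and Tonelli exchanges this sum with the integral over s
  \<ge> T of \<open>suminf_late_birth\<close>.\<close>

lemma nn_integral_last_birth:
  assumes T: "T > 0"
  shows "(\<integral>\<^sup>+ w. last_birth w \<partial>M) \<le> ennreal (T + 2 * pi * N / decay\<^sup>2 * exp (- decay * T))"
proof -
  let ?I = "\<lambda>n s w. indicator {T..} s * indicator {w \<in> space M. s < t n w \<and> n \<in> births w} w :: ennreal"
  \<comment> \<open>A birth after T satisfies t_n = T + (t_n - T), where the excess is the length of
    the set of s \<ge> T with s < t_n.\<close>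
  have pw: "last_birth w \<le> ennreal T + (\<Sum>n. \<integral>\<^sup>+ s. ?I n s w \<partial>lborel)" if w: "w \<in> space M" for w
    unfolding last_birth_def
  proof (rule SUP_least)
    fix n
    have "ennreal (t n w) * indicator (births w) n \<le> ennreal T + (\<integral>\<^sup>+ s. ?I n s w \<partial>lborel)"
    proof (cases "n \<in> births w \<and> T < t n w")
      case True
      have "(\<integral>\<^sup>+ s. ?I n s w \<partial>lborel) = (\<integral>\<^sup>+ s. indicator {T..<t n w} s \<partial>lborel)"
        using True w by (intro nn_integral_cong) (auto simp: indicator_def)
      also have "\<dots> = ennreal (t n w - T)" using True by simp
      finally show ?thesis using True T by (simp add: ennreal_plus[symmetric] del: ennreal_plus)
    next
      case False
      then show ?thesis by (auto simp: indicator_def not_less intro: ennreal_leI add_increasing2)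
    qed
    also have "(\<integral>\<^sup>+ s. ?I n s w \<partial>lborel) \<le> (\<Sum>n. \<integral>\<^sup>+ s. ?I n s w \<partial>lborel)"
      using sum_le_suminf[of "\<lambda>n. \<integral>\<^sup>+ s. ?I n s w \<partial>lborel" "{n}"] by simp
    finally show "ennreal (t n w) * indicator (births w) n \<le> ennreal T + (\<Sum>n. \<integral>\<^sup>+ s. ?I n s w \<partial>lborel)"
      by (simp add: add_left_mono)
  qed
  have meas [measurable]: "(\<lambda>(w, s). ?I n s w) \<in> borel_measurable (M \<Otimes>\<^sub>M lborel)" for n
  proof -
    have "(\<lambda>(w, s). ?I n s w) = (\<lambda>p. indicator {T..} (snd p) * indicator {p \<in> space (M \<Otimes>\<^sub>M lborel). snd p < t n (fst p) \<and> n \<in> births (fst p)} p)"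
      by (auto simp: fun_eq_iff indicator_def space_pair_measure)
    also have "\<dots> \<in> borel_measurable (M \<Otimes>\<^sub>M lborel)" by measurable
    finally show ?thesis .
  qed
  interpret pair_sigma_finite M lborel ..
  have meas1: "(\<lambda>w. \<integral>\<^sup>+ s. ?I n s w \<partial>lborel) \<in> borel_measurable M" for n
    using lborel.borel_measurable_nn_integral[OF meas[of n]] by simp
  have meas2: "(\<lambda>s. emeasure M {w \<in> space M. s < t n w \<and> n \<in> births w}) \<in> borel_measurable lborel" for n
    by measurable
  have "(\<integral>\<^sup>+ w. last_birth w \<partial>M) \<le> (\<integral>\<^sup>+ w. ennreal T + (\<Sum>n. \<integral>\<^sup>+ s. ?I n s w \<partial>lborel) \<partial>M)"
    by (rule nn_integral_mono) (rule pw)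
  also have "\<dots> = ennreal T + (\<Sum>n. \<integral>\<^sup>+ w. \<integral>\<^sup>+ s. ?I n s w \<partial>lborel \<partial>M)"
    using meas1 by (simp add: nn_integral_add nn_integral_suminf emeasure_space_1)
  also have "(\<Sum>n. \<integral>\<^sup>+ w. \<integral>\<^sup>+ s. ?I n s w \<partial>lborel \<partial>M) =
      (\<Sum>n. \<integral>\<^sup>+ s. indicator {T..} s * emeasure M {w \<in> space M. s < t n w \<and> n \<in> births w} \<partial>lborel)"
  proof (intro arg_cong[where f = suminf] ext)
    fix n
    have "(\<integral>\<^sup>+ w. \<integral>\<^sup>+ s. ?I n s w \<partial>lborel \<partial>M) = (\<integral>\<^sup>+ s. \<integral>\<^sup>+ w. ?I n s w \<partial>M \<partial>lborel)"
      by (rule Fubini'[symmetric]) (rule meas)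
    also have "\<dots> = (\<integral>\<^sup>+ s. indicator {T..} s * emeasure M {w \<in> space M. s < t n w \<and> n \<in> births w} \<partial>lborel)"
      by (intro nn_integral_cong nn_integral_cmult_indicator) measurable
    finally show "(\<integral>\<^sup>+ w. \<integral>\<^sup>+ s. ?I n s w \<partial>lborel \<partial>M) = \<dots>" .
  qed
  also have "\<dots> = (\<integral>\<^sup>+ s. (\<Sum>n. indicator {T..} s * emeasure M {w \<in> space M. s < t n w \<and> n \<in> births w}) \<partial>lborel)"
    using meas2 by (intro nn_integral_suminf[symmetric]) simp
  also have "\<dots> \<le> (\<integral>\<^sup>+ s. ennreal (2 * pi * N / decay * exp (- decay * s)) * indicator {T..} s \<partial>lborel)"
  proof (rule nn_integral_mono)
    fix s
    show "(\<Sum>n. indicator {T..} s * emeasure M {w \<in> space M. s < t n w \<and> n \<in> births w}) \<le>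
        ennreal (2 * pi * N / decay * exp (- decay * s)) * indicator {T..} s"
      using suminf_late_birth[of s] T by (cases "T \<le> s") auto
  qed
  also have "\<dots> = ennreal (0 - (- (2 * pi * N / decay\<^sup>2 * exp (- decay * T))))"
  proof (rule nn_integral_FTC_atLeast)
    show "((\<lambda>s. - (2 * pi * N / decay\<^sup>2 * exp (- decay * s))) has_real_derivative 2 * pi * N / decay * exp (- decay * s)) (at s)" for s
      using decay_pos by (auto intro!: derivative_eq_intros simp: power2_eq_square)
    show "((\<lambda>s. - (2 * pi * N / decay\<^sup>2 * exp (- decay * s))) \<longlongrightarrow> 0) at_top"
      using decay_pos by real_asymp
    show "0 \<le> 2 * pi * N / decay * exp (- decay * s)" for s using decay_pos N by simp
  qed simp
  also have "ennreal T + ennreal (0 - (- (2 * pi * N / decay\<^sup>2 * exp (- decay * T)))) =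
      ennreal (T + 2 * pi * N / decay\<^sup>2 * exp (- decay * T))"
    using T N decay_pos by (subst ennreal_plus) auto
  finally show ?thesis by (simp add: add_left_mono)
qed

text \<open>The completion time agrees with \<open>last_birth\<close> on good outcomes only; the
  others lie in a null set, which the completion makes harmless for measurability.\<close>

lemma tree_completion_time:
  shows "(\<lambda>w. tree_completion_time N lam (\<lambda>j. t j w) (\<lambda>j. x j w)) \<in> borel_measurable (completion M)"
    "(\<integral>\<^sup>+ w. tree_completion_time N lam (\<lambda>j. t j w) (\<lambda>j. x j w) \<partial>completion M) = (\<integral>\<^sup>+ w. last_birth w \<partial>M)"
proof -
  let ?f = "\<lambda>w. tree_completion_time N lam (\<lambda>j. t j w) (\<lambda>j. x j w)"
  have ae: "AE w in M. ?f w = last_birth w"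
    using AE_good by eventually_elim (rule good_tree_completion_time)
  show "?f \<in> borel_measurable (completion M)"
  proof (rule measurableI)
    fix B :: "ennreal set" assume B: "B \<in> sets borel"
    show "?f -` B \<inter> space (completion M) \<in> sets (completion M)"
    proof (rule completion.in_sets_AE)
      show "AE w in completion M. w \<in> last_birth -` B \<inter> space M \<longleftrightarrow> w \<in> ?f -` B \<inter> space (completion M)"
        using AE_completion[OF ae] by eventually_elim simp
      show "last_birth -` B \<inter> space M \<in> sets (completion M)"
        using measurable_sets[OF measurable_completion[OF measurable_last_birth] B] by simp
    qed simp
  qed simp
  have "(\<integral>\<^sup>+ w. ?f w \<partial>completion M) = (\<integral>\<^sup>+ w. ?f w \<partial>M)" by (rule nn_integral_completion)
  also have "\<dots> = (\<integral>\<^sup>+ w. last_birth w \<partial>M)" by (rule nn_integral_cong_AE[OF ae])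
  finally show "(\<integral>\<^sup>+ w. ?f w \<partial>completion M) = (\<integral>\<^sup>+ w. last_birth w \<partial>M)" .
qed

lemma expected_completion_time:
  assumes "N > 1"
  shows "(\<integral>\<^sup>+ w. tree_completion_time N lam (\<lambda>j. t j w) (\<lambda>j. x j w) \<partial>completion M) \<le>
    ennreal (ln N / decay + 2 * pi / decay\<^sup>2)"
proof -
  have T: "ln N / decay > 0" using assms decay_pos by simp
  \<comment> \<open>This cancels the factor N in front of the exponential bound.\<close>
  have "exp (- decay * (ln N / decay)) = 1 / N"
  proof -
    have "- decay * (ln N / decay) = - ln N" using decay_pos by simp
    then show ?thesis using N by (simp only:) (simp add: exp_minus divide_inverse)
  qed
  then show ?thesis
    using nn_integral_last_birth[OF T] N unfolding tree_completion_time(2) by simp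
qed

end

section \<open>The bound for large circumference\<close>

lemma chl_arrivals_imp_chl:
  assumes "N > 0" "lam > 0" "chl_arrivals N M t x"
  shows "chl N lam M t x"
  using assms by unfold_locales (auto simp: chl_arrivals_def)

theorem theorem1p5:
  fixes lam \<epsilon> :: real
  assumes "lam > 0" and "\<epsilon> > 0"
  shows "\<forall>\<^sub>F N :: real in at_top.
    \<forall>(M :: 'w measure) (t :: nat \<Rightarrow> 'w \<Rightarrow> real) (x :: nat \<Rightarrow> 'w \<Rightarrow> real).
      chl_arrivals N M t x \<longrightarrow>
        (\<lambda>w. tree_completion_time N lam (\<lambda>j. t j w) (\<lambda>j. x j w))
          \<in> borel_measurable (completion M) \<and>
        (\<integral>\<^sup>+ w. tree_completion_time N lam (\<lambda>j. t j w) (\<lambda>j. x j w) \<partial>completion M)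
          \<le> ennreal ((1 + \<epsilon>) * (ln N / (2 * lam)))"
proof -
  define r where "r N = 4 * N * slit_delta N lam" for N
  \<comment> \<open>\<open>slit_delta N lam\<close> equals tanh (lam / (2 N)), which behaves like
    lam / (2 N).\<close>
  have r: "(r \<longlongrightarrow> 2 * lam) at_top"
    unfolding r_def slit_delta_def using assms(1) by real_asymp
  \<comment> \<open>The bound of \<open>expected_completion_time\<close> divided by ln N; the second
    term vanishes in the limit, and \<epsilon> > 0 leaves room above 1 / (2 lam).\<close>
  have "((\<lambda>N. 1 / r N + 2 * pi / (r N)\<^sup>2 * (1 / ln N)) \<longlongrightarrow> 1 / (2 * lam) + 2 * pi / (2 * lam)\<^sup>2 * 0) at_top"
    using assms(1) by (intro tendsto_intros r) (auto, real_asymp)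
  moreover have "1 / (2 * lam) + 2 * pi / (2 * lam)\<^sup>2 * 0 < (1 + \<epsilon>) / (2 * lam)"
    using assms by (simp add: divide_strict_right_mono)
  ultimately have "\<forall>\<^sub>F N in at_top. 1 / r N + 2 * pi / (r N)\<^sup>2 * (1 / ln N) < (1 + \<epsilon>) / (2 * lam)"
    by (rule order_tendstoD)
  then show ?thesis
    using eventually_gt_at_top[of 1]
  proof eventually_elim
    case (elim N)
    show ?case
    proof (intro allI impI)
      fix M :: "'w measure" and t x :: "nat \<Rightarrow> 'w \<Rightarrow> real"
      assume "chl_arrivals N M t x"
      then interpret chl N lam M t x using elim assms by (intro chl_arrivals_imp_chl) auto
      have "ln N > 0" using elim by simp
      then have "(1 / r N + 2 * pi / (r N)\<^sup>2 * (1 / ln N)) * ln N \<le> (1 + \<epsilon>) / (2 * lam) * ln N"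
        using elim by (intro mult_right_mono) auto
      then have "ln N / decay + 2 * pi / decay\<^sup>2 \<le> (1 + \<epsilon>) * (ln N / (2 * lam))"
        using \<open>ln N > 0\<close> by (simp add: r_def decay_def distrib_right)
      then show "(\<lambda>w. tree_completion_time N lam (\<lambda>j. t j w) (\<lambda>j. x j w)) \<in> borel_measurable (completion M) \<and>
        (\<integral>\<^sup>+ w. tree_completion_time N lam (\<lambda>j. t j w) (\<lambda>j. x j w) \<partial>completion M)
          \<le> ennreal ((1 + \<epsilon>) * (ln N / (2 * lam)))"
        using tree_completion_time(1) expected_completion_time elim by (meson ennreal_leI order_trans)
    qed
  qed
qed

end
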